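(* Let $n\ge2$, let $1\le q\le n$ be an integer, let $\Omega\subset\mathbb{C}^n$ be a domain, let $\pi:E\to\Omega$ be a holomorphic vector bundle and $h$ a smooth Hermitian metric on $E$ with Chern curvature $\Theta_h$. For fixed $a\in\Omega$ and $\xi\in E_a\setminus\{0\}$, the $q$-$L^2$-extension index has the expansion $$ \begin{aligned} L^{(q)}_{h}(a,r,s,A,\xi)=1&-\frac{r^2}{q+1}\sum_{j=1}^{q}\frac{\langle\Theta_h(Ae_j,\overline{Ae_j})\xi,\xi\rangle_{h(a)}}{|\xi|^2_{h(a)}}\\ &-\frac{s^2}{n-q+1}\sum_{j=q+1}^n\frac{\langle\Theta_h(Ae_j,\overline{Ae_j})\xi,\xi\rangle_{h(a)}}{|\xi|^2_{h(a)}}+O\big((r^2+s^2)^2\big), \end{aligned} $$ as $(r,s)\to(0,0)$ with $r,s>0$, for $A\in\mathbf{U}(n)$, where $\{e_1,\dots,e_n\}$ is the standard basis of $\mathbb{C}^n$ and the constant in the $O$-term does not depend on $r,s,A$. When $q=n$, with the convention $\mathbb{B}^0_s=\{0\}$, one has $P^{(n)}_{r,s,A}=\mathbb{B}^n_r$, the second sum is empty, and the remainder term can be written as $O(r^4)$.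
   Context: $\mathbf{U}(n)$ is the unitary group of degree $n$, and $\mathbb{B}^{k}_s\subset\mathbb{C}^k$ is the open ball of radius $s$ centered at $0$ (with $\mathbb{B}^0_s=\{0\}$). For $r,s>0$, $A\in\mathbf{U}(n)$, put $P^{(q)}_{r,s,A}=A(\mathbb{B}^q_r\times\mathbb{B}^{n-q}_s)$, with Lebesgue measure $|P^{(q)}_{r,s,A}|$. For $a\in\Omega$, $r,s>0$, $A\in\mathbf{U}(n)$ with $a+P^{(q)}_{r,s,A}\subset\Omega$, and $\xi\in E_a\setminus\{0\}$, the $q$-$L^2$-extension index of $h$ is $$L^{(q)}_h(a,r,s,A,\xi)=\inf\left\{\frac{\int_{a+P^{(q)}_{r,s,A}}|\sigma|_h^2}{|P^{(q)}_{r,s,A}|\,|\xi|^2_{h(a)}}\ \middle|\ \sigma\in A^2(a+P^{(q)}_{r,s,A},E;h),\ \sigma(a)=\xi\right\},$$ where $A^2(a+P^{(q)}_{r,s,A},E;h)$ is the space of holomorphic sections of $E$ on $a+P^{(q)}_{r,s,A}$ that are square integrable with respect to $h$ (and Lebesgue measure). Curvature convention: writing $\Theta_h=\sum_{j,k}\Theta_{h,j\bar k}\,dz_j\wedge d\bar z_k$ with $\Theta_{h,j\bar k}\in\mathrm{End}(E)$, we set $\Theta_h(v,\bar v)=\sum_{j,k}\Theta_{h,j\bar k}(a)v_j\bar v_k$ for $v\in\mathbb{C}^n$. The sign is such that for a line bundle with $h=e^{-\varphi}$ one has $\Theta_{h,j\bar k}=\partial^2\varphi/\partial z_j\partial\bar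 z_k$. *)

theory Defs
  imports "HOL-Analysis.Analysis"
begin

section \<open>Holomorphic and smooth maps of several variables\<close>

definition holomorphic_map_on ::
    "(complex^'n::finite) set \<Rightarrow> (complex^'n \<Rightarrow> complex^'m::finite) \<Rightarrow> bool" where
  "holomorphic_map_on S f \<longleftrightarrow>
     (\<forall>z\<in>S. \<exists>D. (f has_derivative D) (at z) \<and> (\<forall>c v. D (c *s v) = c *s D v))"

text \<open>Used for open \<open>S\<close> only. On finite-dimensional spaces it suffices to control
  the directional derivatives along every fixed vector.\<close>

primrec Ck_on :: "nat \<Rightarrow> 'a::real_normed_vector set \<Rightarrow> ('a \<Rightarrow> 'b::real_normed_vector) \<Rightarrow> bool" where
  "Ck_on 0 S f \<longleftrightarrow> continuous_on S f"
| "Ck_on (Suc k) S f \<longleftrightarrow> (\<forall>x\<in>S. f differentiable (at x)) \<and>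
     (\<forall>v. Ck_on k S (\<lambda>x. frechet_derivative f (at x) v))"

definition smooth_map_on :: "'a::real_normed_vector set \<Rightarrow> ('a \<Rightarrow> 'b::real_normed_vector) \<Rightarrow> bool" where
  "smooth_map_on S f \<longleftrightarrow> (\<forall>k. Ck_on k S f)"

text \<open>The Wirtinger derivatives \<open>\<partial>f/\<partial>z\<^sub>j\<close> and \<open>\<partial>f/\<partial>\<zeta>\<^sub>j\<close>, where \<open>\<zeta>\<^sub>j\<close> is the conjugate of \<open>z\<^sub>j\<close>.\<close>

definition wirtinger :: "'n::finite \<Rightarrow> (complex^'n \<Rightarrow> complex) \<Rightarrow> complex^'n \<Rightarrow> complex" where
  "wirtinger j f z =
     (frechet_derivative f (at z) (axis j 1) - \<i> * frechet_derivative f (at z) (axis j \<i>)) / 2"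

definition wirtinger_bar :: "'n::finite \<Rightarrow> (complex^'n \<Rightarrow> complex) \<Rightarrow> complex^'n \<Rightarrow> complex" where
  "wirtinger_bar j f z =
     (frechet_derivative f (at z) (axis j 1) + \<i> * frechet_derivative f (at z) (axis j \<i>)) / 2"


section \<open>Holomorphic vector bundles\<close>

text \<open>A vector bundle over a subset of \<open>\<complex>\<^sup>n\<close>, of rank \<open>CARD('m)\<close>: total space, projection,
  the vector space operations of the fibres, and an atlas of local trivializations. An atlas
  element \<open>(U, \<phi>)\<close> stands for the trivialization \<open>u \<mapsto> (vb_proj u, \<phi> u)\<close> from the part of the
  total space over \<open>U\<close> to \<open>U \<times> \<complex>\<^sup>m\<close>.\<close>

record ('e, 'n, 'm) vbundle =
  vb_total :: "'e set"
  vb_proj :: "'e \<Rightarrow> complex^'n"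
  vb_add :: "'e \<Rightarrow> 'e \<Rightarrow> 'e"
  vb_scale :: "complex \<Rightarrow> 'e \<Rightarrow> 'e"
  vb_zero :: "complex^'n \<Rightarrow> 'e"
  vb_atlas :: "((complex^'n) set \<times> ('e \<Rightarrow> complex^'m)) set"

definition fibre :: "('e, 'n::finite, 'm::finite) vbundle \<Rightarrow> complex^'n \<Rightarrow> 'e set" where
  "fibre E z = {u \<in> vb_total E. vb_proj E u = z}"

text \<open>\<open>triv_inv E \<phi> z\<close> is the inverse of \<open>\<phi>\<close> restricted to the fibre at \<open>z\<close>, so the sections
  \<open>\<lambda>z. triv_inv E \<phi> z (axis j 1)\<close> form the frame belonging to the trivialization \<open>\<phi>\<close>.\<close>

definition triv_inv :: "('e, 'n::finite, 'm::finite) vbundle \<Rightarrow> ('e \<Rightarrow> complex^'m) \<Rightarrow>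
    complex^'n \<Rightarrow> complex^'m \<Rightarrow> 'e" where
  "triv_inv E \<phi> z = the_inv_into (fibre E z) \<phi>"

text \<open>The vector space axioms for the fibres need not be listed: they are transported along the
  fibrewise linear bijections \<open>\<phi>\<close>. The topology and complex structure of the total
  space are the ones induced by the atlas, whose transition maps are holomorphic
  (fibrewise linear, hence holomorphic matrix-valued functions).\<close>

definition holomorphic_vector_bundle ::
    "(complex^'n::finite) set \<Rightarrow> ('e, 'n, 'm::finite) vbundle \<Rightarrow> bool" where
  "holomorphic_vector_bundle \<Omega> E \<longleftrightarrow>
     vb_proj E ` vb_total E \<subseteq> \<Omega> \<and>
     (\<forall>z\<in>\<Omega>. vb_zero E z \<in> fibre E z \<and>
        (\<forall>u\<in>fibre E z. \<forall>v\<in>fibre E z. vb_add E u v \<in> fibre E z) \<and>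
        (\<forall>c. \<forall>u\<in>fibre E z. vb_scale E c u \<in> fibre E z)) \<and>
     (\<Union>(U, \<phi>)\<in>vb_atlas E. U) = \<Omega> \<and>
     (\<forall>(U, \<phi>)\<in>vb_atlas E. open U \<and>
        (\<forall>z\<in>U. bij_betw \<phi> (fibre E z) UNIV \<and> \<phi> (vb_zero E z) = 0 \<and>
           (\<forall>u\<in>fibre E z. \<forall>v\<in>fibre E z. \<phi> (vb_add E u v) = \<phi> u + \<phi> v) \<and>
           (\<forall>c. \<forall>u\<in>fibre E z. \<phi> (vb_scale E c u) = c *s \<phi> u))) \<and>
     (\<forall>(U, \<phi>)\<in>vb_atlas E. \<forall>(V, \<psi>)\<in>vb_atlas E. \<forall>w.
        holomorphic_map_on (U \<inter> V) (\<lambda>z. \<psi> (triv_inv E \<phi> z w)))"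

definition holomorphic_section ::
    "('e, 'n::finite, 'm::finite) vbundle \<Rightarrow> (complex^'n) set \<Rightarrow> (complex^'n \<Rightarrow> 'e) \<Rightarrow> bool" where
  "holomorphic_section E D \<sigma> \<longleftrightarrow> (\<forall>z\<in>D. \<sigma> z \<in> fibre E z) \<and>
     (\<forall>(U, \<phi>)\<in>vb_atlas E. holomorphic_map_on (D \<inter> U) (\<lambda>z. \<phi> (\<sigma> z)))"


section \<open>Hermitian metrics and Chern curvature\<close>

text \<open>Gram matrix of the frame of \<open>\<phi>\<close>, with \<open>gram\<^sub>\<alpha>\<^sub>\<beta> = h(\<epsilon>\<^sub>\<beta>, \<epsilon>\<^sub>\<alpha>)\<close>: for coefficient (column) vectors
  \<open>s, t\<close> of two fibre elements their inner product is \<open>t\<^sup>* gram s\<close>.\<close>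

definition gram :: "('e, 'n::finite, 'm::finite) vbundle \<Rightarrow> ('e \<Rightarrow> 'e \<Rightarrow> complex) \<Rightarrow>
    ('e \<Rightarrow> complex^'m) \<Rightarrow> complex^'n \<Rightarrow> complex^'m^'m" where
  "gram E h \<phi> z =
     (\<chi> \<alpha> \<beta>. h (triv_inv E \<phi> z (axis \<beta> 1)) (triv_inv E \<phi> z (axis \<alpha> 1)))"

definition smooth_hermitian_metric :: "(complex^'n::finite) set \<Rightarrow>
    ('e, 'n, 'm::finite) vbundle \<Rightarrow> ('e \<Rightarrow> 'e \<Rightarrow> complex) \<Rightarrow> bool" where
  "smooth_hermitian_metric \<Omega> E h \<longleftrightarrow>
     (\<forall>z\<in>\<Omega>.
        (\<forall>u\<in>fibre E z. \<forall>v\<in>fibre E z. \<forall>w\<in>fibre E z. h (vb_add E u v) w = h u w + h v w) \<and>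
        (\<forall>c. \<forall>u\<in>fibre E z. \<forall>v\<in>fibre E z. h (vb_scale E c u) v = c * h u v) \<and>
        (\<forall>u\<in>fibre E z. \<forall>v\<in>fibre E z. h v u = cnj (h u v)) \<and>
        (\<forall>u\<in>fibre E z. u \<noteq> vb_zero E z \<longrightarrow> 0 < Re (h u u))) \<and>
     (\<forall>(U, \<phi>)\<in>vb_atlas E. smooth_map_on U (gram E h \<phi>))"

text \<open>\<open>|u|\<^sup>2\<^sub>h\<close>; the number \<open>h u u\<close> is real by Hermitian symmetry.\<close>

definition hnorm2 :: "('e \<Rightarrow> 'e \<Rightarrow> complex) \<Rightarrow> 'e \<Rightarrow> real" where
  "hnorm2 h u = Re (h u u)"

text \<open>Let \<open>G\<close> be the Gram matrix of a holomorphic frame. The Chern connection is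
  \<open>\<nabla> = d + \<Sum>\<^sub>j \<theta>\<^sub>j dz\<^sub>j\<close>, acting on coefficient vectors; being of type \<open>(1,0)\<close> and
  compatible with \<open>h(s,t) = t\<^sup>* G s\<close> forces \<open>\<partial>\<^sub>j G = G \<theta>\<^sub>j\<close>.\<close>

definition chern_connection_form ::
    "(complex^'n::finite \<Rightarrow> complex^'m::finite^'m) \<Rightarrow> 'n \<Rightarrow> complex^'n \<Rightarrow> complex^'m^'m" where
  "chern_connection_form G j z =
     matrix_inv (G z) ** (\<chi> \<alpha> \<beta>. wirtinger j (\<lambda>w. G w $ \<alpha> $ \<beta>) z)"

text \<open>The Chern curvature is the \<open>(1,1)\<close>-form \<open>\<partial>\<^sup>-\<theta> = \<Sum>\<^sub>j\<^sub>,\<^sub>k (\<partial>\<^sup>-\<^sub>k \<theta>\<^sub>j) d\<zeta>\<^sub>k \<and> dz\<^sub>j\<close>, where \<open>\<partial>\<^sup>-\<close> is the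
  \<open>(0,1)\<close>-part of \<open>d\<close> and \<open>\<zeta>\<^sub>k\<close> the conjugate of \<open>z\<^sub>k\<close>. So its coefficient at \<open>dz\<^sub>j \<and> d\<zeta>\<^sub>k\<close> is
  \<open>- \<partial>\<^sup>-\<^sub>k \<theta>\<^sub>j\<close>. For rank one and \<open>G = exp (- \<phi>)\<close> this is \<open>\<partial>\<^sub>j \<partial>\<^sup>-\<^sub>k \<phi>\<close>.\<close>

definition chern_curvature_coeff ::
    "(complex^'n::finite \<Rightarrow> complex^'m::finite^'m) \<Rightarrow> 'n \<Rightarrow> 'n \<Rightarrow> complex^'n \<Rightarrow> complex^'m^'m" where
  "chern_curvature_coeff G j k z =
     (\<chi> \<alpha> \<beta>. - wirtinger_bar k (\<lambda>w. chern_connection_form G j w $ \<alpha> $ \<beta>) z)"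

text \<open>The endomorphism \<open>\<Theta>\<^sub>h(v, v\<^sup>-) = \<Sum>\<^sub>j\<^sub>,\<^sub>k \<Theta>\<^sub>j\<^sub>k v\<^sub>j v\<^sup>-\<^sub>k\<close> of the fibre at \<open>a\<close>, where \<open>v\<^sup>-\<close> is the
  conjugate of \<open>v\<close>, applied to \<open>\<xi>\<close>. The curvature is a tensor, so the choice of the
  trivialization around \<open>a\<close> is immaterial.\<close>

definition chern_curvature :: "('e, 'n::finite, 'm::finite) vbundle \<Rightarrow> ('e \<Rightarrow> 'e \<Rightarrow> complex) \<Rightarrow>
    complex^'n \<Rightarrow> complex^'n \<Rightarrow> 'e \<Rightarrow> 'e" where
  "chern_curvature E h a v \<xi> =
     (let \<phi> = snd (SOME (U, \<phi>). (U, \<phi>) \<in> vb_atlas E \<and> a \<in> U)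
      in triv_inv E \<phi> a (\<Sum>j\<in>UNIV. \<Sum>k\<in>UNIV.
           (v $ j * cnj (v $ k)) *s (chern_curvature_coeff (gram E h \<phi>) j k a *v \<phi> \<xi>)))"


section \<open>The extension index\<close>

definition unitary_group :: "(complex^'n::finite^'n) set" where
  "unitary_group = {A. A ** (\<chi> i j. cnj (A $ j $ i)) = mat 1 \<and>
                       (\<chi> i j. cnj (A $ j $ i)) ** A = mat 1}"

text \<open>\<open>\<iota>\<close> enumerates the coordinates as \<open>1, \<dots>, n\<close>. For \<open>q = n\<close> the second condition
  is \<open>0 < s\<close>, in agreement with the convention that the zero-dimensional ball is \<open>{0}\<close>.\<close>

definition polyball :: "(nat \<Rightarrow> 'n::finite) \<Rightarrow> nat \<Rightarrow> real \<Rightarrow> real \<Rightarrow> complex^'n^'n \<Rightarrow> (complex^'n) set" where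
  "polyball \<iota> q r s A = (\<lambda>z. A *v z) `
     {z. L2_set (\<lambda>j. cmod (z $ \<iota> j)) {1..q} < r \<and>
         L2_set (\<lambda>j. cmod (z $ \<iota> j)) {q+1..CARD('n)} < s}"

definition A2 :: "('e, 'n::finite, 'm::finite) vbundle \<Rightarrow> ('e \<Rightarrow> 'e \<Rightarrow> complex) \<Rightarrow>
    (complex^'n) set \<Rightarrow> (complex^'n \<Rightarrow> 'e) set" where
  "A2 E h D = {\<sigma>. holomorphic_section E D \<sigma> \<and>
                  set_integrable lebesgue D (\<lambda>z. hnorm2 h (\<sigma> z))}"

definition L2_ext_index :: "('e, 'n::finite, 'm::finite) vbundle \<Rightarrow> ('e \<Rightarrow> 'e \<Rightarrow> complex) \<Rightarrow>
    (nat \<Rightarrow> 'n) \<Rightarrow> nat \<Rightarrow> complex^'n \<Rightarrow> real \<Rightarrow> real \<Rightarrow> complex^'n^'n \<Rightarrow> 'e \<Rightarrow> real" where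
  "L2_ext_index E h \<iota> q a r s A \<xi> =
     Inf {(LINT z:(+) a ` polyball \<iota> q r s A|lebesgue. hnorm2 h (\<sigma> z)) /
            (measure lebesgue (polyball \<iota> q r s A) * hnorm2 h \<xi>) | \<sigma>.
          \<sigma> \<in> A2 E h ((+) a ` polyball \<iota> q r s A) \<and> \<sigma> a = \<xi>}"

end

theory Submission
  imports Defs "HOL-Complex_Analysis.Cauchy_Integral_Formula"
begin

text \<open>Let \<open>P\<close> be a small open set that contains \<open>0\<close> and is balanced: it contains \<open>c z\<close> for all
\<open>z \<in> P\<close> and all complex \<open>c\<close> with \<open>|c| \<le> 1\<close>. Fix a trivialization around the base point \<open>a\<close> and coordinates
\<open>z\<close> centered at \<open>a\<close>, let \<open>G\<close> be the Gram matrix and \<open>x\<close> the coefficient vector of \<open>\<xi>\<close>. A competitor in the infimum is a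
holomorphic vector function \<open>f\<close> on \<open>a + P\<close> with \<open>f(a) = x\<close>, and the quantity to be minimized is the
integral of \<open>f\<^sup>* G f\<close>. The theorem holds because one explicit competitor, affine in the coordinates,
is optimal up to \<open>O(\<rho>\<^sup>4)\<close> relative to \<open>|P|\<close> whenever \<open>P\<close> lies in the ball of radius \<open>\<rho>\<close>. It is
\<open>frame z = x + corr z\<close>, where \<open>corr z = - \<Sum>\<^sub>j z\<^sub>j \<theta>\<^sub>j(a) x\<close> is dictated by the Chern connection form
\<open>\<theta>\<close>: the section is parallel to first order at \<open>a\<close>. In consequence \<open>frame\<^sup>* G\<close> has no antiholomorphic
linear part; it equals a row vector depending holomorphically on \<open>z\<close>, plus \<open>O(|z|\<^sup>2)\<close>.

\<^item> Upper bound. Averaging \<open>frame\<^sup>* G frame\<close> over the four points \<open>\<plusminus>z, \<plusminus>\<i>z\<close> removes from the Taylor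
expansion the odd terms and the quadratic terms of type \<open>z\<^sub>j z\<^sub>k\<close> and their conjugates. What remains
is \<open>|\<xi>|\<^sup>2 - \<langle>\<Theta>(z, z\<^sup>-)\<xi>, \<xi>\<rangle> + O(|z|\<^sup>4)\<close> (\<open>Q_average\<close>). Multiplication by \<open>\<i>\<close> preserves \<open>P\<close> and its
measure, so the integral over \<open>P\<close> does not see the averaging (\<open>LINT_Q\<close>).

\<^item> Lower bound. For another competitor write \<open>f = frame + y\<close>, so that \<open>y\<close> vanishes at the base point.
In the cross term \<open>2 Re (frame\<^sup>* G y)\<close> the product is a holomorphic function vanishing at \<open>0\<close>, up to an error
\<open>O(|z|\<^sup>2 |y|)\<close>; the term \<open>y\<^sup>* G y \<ge> c |y|\<^sup>2\<close> absorbs this error at the price of \<open>O(|z|\<^sup>4)\<close>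
(\<open>Q_lower\<close>). The holomorphic function integrates to zero by the mean value property of balanced sets
(\<open>mean_value_balanced\<close>), so no competitor does better than \<open>frame\<close> by more than \<open>O(\<rho>\<^sup>4) |P|\<close>
(\<open>LINT_lower\<close>).

Together they give, for every such \<open>P\<close>, the expansion \<open>1 - m / |\<xi>|\<^sup>2 + O(\<rho>\<^sup>4)\<close> of the index, where \<open>m\<close>
is the mean of \<open>\<langle>\<Theta>(z, z\<^sup>-)\<xi>, \<xi>\<rangle>\<close> over \<open>P\<close> (\<open>ext_index_expansion\<close>). For the image of a product of two
balls under a unitary matrix the mean is computed from the second moments of the product: those of
two different coordinates vanish, and the mean of \<open>|w\<^sub>j|\<^sup>2\<close> over the ball of radius \<open>r\<close> in \<open>\<complex>\<^sup>q\<close> is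
\<open>r\<^sup>2 / (q + 1)\<close> (\<open>LINT_biball_moments\<close>). Both remainders in the theorem come from the same estimate:
a polyball lies in the ball of radius \<open>\<rho>\<close> with \<open>\<rho>\<^sup>2 = r\<^sup>2 + s\<^sup>2\<close>, and when \<open>q = n\<close> even in the one
with \<open>\<rho> = r\<close>.\<close>

section \<open>Orthogonal maps and Lebesgue measure\<close>

lemma lborel_nn_integral_shift:
  fixes c :: "'a::euclidean_space"
  assumes "f \<in> borel_measurable borel"
  shows "(\<integral>\<^sup>+x. f (c + x) \<partial>lborel) = (\<integral>\<^sup>+x. f x \<partial>lborel)"
proof -
  have "(\<integral>\<^sup>+x. f x \<partial>lborel) = (\<integral>\<^sup>+x. f x \<partial>distr lborel borel ((+) c))"
    by (simp add: lborel_distr_plus)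
  also have "\<dots> = (\<integral>\<^sup>+x. f (c + x) \<partial>lborel)"
    using assms by (subst nn_integral_distr) auto
  finally show ?thesis ..
qed

lemma measure_lborel_open_pos:
  fixes S :: "'a::euclidean_space set"
  assumes "open S" "bounded S" "S \<noteq> {}"
  shows "0 < measure lborel S"
proof (rule ccontr)
  assume "\<not> 0 < measure lborel S"
  then have "measure lborel S = 0" using measure_nonneg[of lborel S] by linarith
  moreover have "emeasure lborel S < \<infinity>" using emeasure_bounded_finite assms(2) by blast
  ultimately have "emeasure lborel S = 0"
    by (auto simp: measure_def enn2real_eq_0_iff)
  then have "negligible S"
    using assms(1) by (simp add: negligible_iff_null_sets null_sets_completionI null_setsI borel_open)
  then show False using open_not_negligible assms by blast
qed

text \<open>The uniqueness argument for Haar measure. Let \<open>M\<close> be the image measure, \<open>\<lambda>\<close> Lebesgue measure and \<open>B\<close>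
the unit ball. Both measures are translation invariant, so integrating \<open>1\<^sub>X(u) 1\<^sub>B(y - u)\<close> against
\<open>M(du) \<lambda>(dy)\<close> in both orders gives \<open>\<lambda>(B) M(X) = M(B) \<lambda>(X)\<close>; and \<open>M(B) = \<lambda>(B)\<close> because an orthogonal
map preserves \<open>B\<close>. Below, integrals against \<open>M\<close> are written as integrals of \<open>\<lambda>x. f (T x)\<close> against \<open>\<lambda>\<close>.\<close>

lemma distr_lborel_orthogonal:
  fixes T :: "'a::euclidean_space \<Rightarrow> 'a"
  assumes "orthogonal_transformation T"
  shows "distr lborel borel T = lborel"
proof (rule measure_eqI)
  fix X assume "X \<in> sets (distr lborel borel T)"
  then have X[measurable]: "X \<in> sets borel" by simp
  have lin: "linear T" and nrm: "\<And>x. norm (T x) = norm x"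
    using assms by (auto simp: orthogonal_transformation)
  have T[measurable]: "T \<in> borel_measurable borel"
    using lin by (intro borel_measurable_continuous_onI linear_continuous_on)
       (simp add: linear_conv_bounded_linear)
  define B where "B = ball (0::'a) 1"
  have B[measurable]: "B \<in> sets borel" by (simp add: B_def)
  define I where "I = (\<lambda>S (x::'a). indicator S x :: ennreal)"
  have I[measurable]: "I S \<in> borel_measurable borel" if "S \<in> sets borel" for S
    using that unfolding I_def by measurable
  have Xm[measurable]: "I X \<in> borel_measurable borel" and Bm[measurable]: "I B \<in> borel_measurable borel"
    by (auto intro: I)
  define b where "b = emeasure lborel B"
  have b: "b \<noteq> 0" "b \<noteq> \<infinity>"
    using emeasure_bounded_finite[of B] measure_lborel_open_pos[of B]
    by (auto simp: b_def B_def measure_def top_unique)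
  have b_shift: "(\<integral>\<^sup>+y. I B (y - c) \<partial>lborel) = b" for c
    using lborel_nn_integral_shift[of "I B" "-c"] by (simp add: I_def b_def)
  have X_shift: "(\<integral>\<^sup>+y. I X (c + y) \<partial>lborel) = emeasure lborel X" for c
    using lborel_nn_integral_shift[of "I X" c] by (simp add: I_def)
  have shift_y: "(\<integral>\<^sup>+x. I X (T x) * I B (y - T x) \<partial>lborel) = (\<integral>\<^sup>+x. I X (T x + y) * I B x \<partial>lborel)" for y
  proof -
    obtain w where w: "T w = y" using orthogonal_transformation_surj[OF assms] by (metis surjD)
    have "(\<integral>\<^sup>+x. I X (T x) * I B (y - T x) \<partial>lborel) = (\<integral>\<^sup>+x. I X (T (w + x)) * I B (y - T (w + x)) \<partial>lborel)"
      by (rule lborel_nn_integral_shift[symmetric]) measurable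
    also have "\<dots> = (\<integral>\<^sup>+x. I X (T x + y) * I B x \<partial>lborel)"
      \<comment> \<open>the norm is even, so the minus sign of \<open>- T x\<close> disappears and \<open>T\<close> drops out of the ball condition\<close>
      by (simp add: linear_add[OF lin] w add.commute I_def B_def indicator_def nrm)
    finally show ?thesis .
  qed
  have "b * emeasure (distr lborel borel T) X = b * (\<integral>\<^sup>+x. I X (T x) \<partial>lborel)"
  proof -
    have "(\<integral>\<^sup>+x. I X (T x) \<partial>lborel) = (\<integral>\<^sup>+x. I X x \<partial>distr lborel borel T)"
      by (subst nn_integral_distr) auto
    then show ?thesis by (simp add: I_def)
  qed
  also have "\<dots> = (\<integral>\<^sup>+x. I X (T x) * b \<partial>lborel)"
    by (subst nn_integral_multc) (auto simp: mult.commute)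
  also have "\<dots> = (\<integral>\<^sup>+x. (\<integral>\<^sup>+y. I X (T x) * I B (y - T x) \<partial>lborel) \<partial>lborel)"
    by (subst nn_integral_cmult) (auto simp: b_shift)
  also have "\<dots> = (\<integral>\<^sup>+y. (\<integral>\<^sup>+x. I X (T x) * I B (y - T x) \<partial>lborel) \<partial>lborel)"
    by (rule lborel_pair.Fubini'[symmetric]) (measurable)
  also have "\<dots> = (\<integral>\<^sup>+y. (\<integral>\<^sup>+x. I X (T x + y) * I B x \<partial>lborel) \<partial>lborel)"
    by (simp add: shift_y)
  also have "\<dots> = (\<integral>\<^sup>+x. (\<integral>\<^sup>+y. I X (T x + y) * I B x \<partial>lborel) \<partial>lborel)"
    by (rule lborel_pair.Fubini') (measurable)
  also have "\<dots> = (\<integral>\<^sup>+x. emeasure lborel X * I B x \<partial>lborel)"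
    by (subst nn_integral_multc) (auto simp: X_shift)
  also have "\<dots> = b * emeasure lborel X"
    by (subst nn_integral_cmult) (auto simp: I_def b_def mult.commute)
  finally show "emeasure (distr lborel borel T) X = emeasure lborel X"
    using b by (simp add: ennreal_mult_cancel_left)
qed simp

lemma borel_measurable_orthogonal:
  fixes T :: "'a::euclidean_space \<Rightarrow> 'a"
  assumes "orthogonal_transformation T"
  shows "T \<in> borel_measurable borel"
  using assms
  by (intro borel_measurable_continuous_onI linear_continuous_on)
    (simp add: orthogonal_transformation_def linear_conv_bounded_linear)

lemma integral_orthogonal:
  fixes T :: "'a::euclidean_space \<Rightarrow> 'a" and f :: "'a \<Rightarrow> 'b::{banach,second_countable_topology}"
  assumes T: "orthogonal_transformation T"
  shows "(LINT x|lborel. f (T x)) = (LINT x|lborel. f x)"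
    and "integrable lborel (\<lambda>x. f (T x)) \<longleftrightarrow> integrable lborel f"
proof -
  have 1: "integrable lborel (\<lambda>x. g (T x))" "(LINT x|lborel. g (T x)) = (LINT x|lborel. g x)"
    if "integrable lborel g" "orthogonal_transformation T" for g :: "'a \<Rightarrow> 'b" and T :: "'a \<Rightarrow> 'a"
  proof -
    have m[measurable]: "T \<in> borel_measurable borel" "g \<in> borel_measurable borel"
      using that borel_measurable_orthogonal by auto
    show "integrable lborel (\<lambda>x. g (T x))"
      using integrable_distr[of T lborel borel g] distr_lborel_orthogonal[OF that(2)] that(1) m by simp
    show "(LINT x|lborel. g (T x)) = (LINT x|lborel. g x)"
      using integral_distr[of T lborel borel g] distr_lborel_orthogonal[OF that(2)] m by simp
  qed
  show *: "integrable lborel (\<lambda>x. f (T x)) \<longleftrightarrow> integrable lborel f"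
  proof
    assume "integrable lborel (\<lambda>x. f (T x))"
    then have "integrable lborel (\<lambda>x. f (T (inv T x)))"
      using 1(1)[of "\<lambda>x. f (T x)" "inv T"] orthogonal_transformation_inv[OF T] by simp
    then show "integrable lborel f"
      using orthogonal_transformation_surj[OF T] by (simp add: surj_f_inv_f)
  qed (use 1 T in auto)
  show "(LINT x|lborel. f (T x)) = (LINT x|lborel. f x)"
    using 1(2)[of f T] T * not_integrable_integral_eq by metis
qed

lemma set_integral_orthogonal:
  fixes T :: "'a::euclidean_space \<Rightarrow> 'a" and f :: "'a \<Rightarrow> 'b::{banach,second_countable_topology}"
  assumes T: "orthogonal_transformation T"
  shows "(LINT x:S|lborel. f (T x)) = (LINT x:T ` S|lborel. f x)"
proof -
  have "indicator S x = (indicator (T ` S) (T x) :: real)" for x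
    using orthogonal_transformation_inj[OF T] by (auto simp: indicator_def inj_on_def)
  then show ?thesis
    unfolding set_lebesgue_integral_def
    using integral_orthogonal(1)[OF T, of "\<lambda>x. indicator (T ` S) x *\<^sub>R f x"] by simp
qed

lemma borel_orthogonal_image:
  fixes T :: "'a::euclidean_space \<Rightarrow> 'a"
  assumes T: "orthogonal_transformation T" and "S \<in> sets borel"
  shows "T ` S \<in> sets borel"
proof -
  have "T ` S = inv T -` S \<inter> space borel"
    using orthogonal_transformation_bij[OF T] by (simp add: bij_vimage_eq_inv_image bij_imp_bij_inv inv_inv_eq)
  then show ?thesis
    using measurable_sets[OF borel_measurable_orthogonal[OF orthogonal_transformation_inv[OF T]] assms(2)] by simp
qed

lemma measure_orthogonal_image_eq:
  fixes T :: "'a::euclidean_space \<Rightarrow> 'a"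
  assumes T: "orthogonal_transformation T" and "S \<in> sets borel"
  shows "measure lborel (T ` S) = measure lborel S"
proof -
  have m: "T \<in> lborel \<rightarrow>\<^sub>M borel" using borel_measurable_orthogonal[OF T] by simp
  have "T -` T ` S \<inter> space lborel = S"
    using orthogonal_transformation_inj[OF T] by (simp add: inj_vimage_image_eq)
  then show ?thesis
    using measure_distr[OF m borel_orthogonal_image[OF assms]] distr_lborel_orthogonal[OF T] by simp
qed

lemma orthogonal_vimage_image:
  fixes T :: "'a::euclidean_space \<Rightarrow> 'a"
  assumes "orthogonal_transformation T" "\<And>w. T w \<in> S \<longleftrightarrow> w \<in> S"
  shows "T ` S = S"
  using assms orthogonal_transformation_surj[OF assms(1)] by (force simp: surj_def)

lemma set_borel_measurable_continuous_open:
  fixes f :: "'a::euclidean_space \<Rightarrow> 'b::real_normed_vector"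
  assumes "open S" "continuous_on S f"
  shows "set_borel_measurable lborel S f"
  unfolding set_borel_measurable_def
  using borel_measurable_continuous_on_indicator[OF _ assms(2)] assms(1) by (simp add: borel_open)

text \<open>The integrals in the definition of the extension index are taken against the completed measure;
continuous integrands on open sets are Borel measurable, so that \<open>lborel\<close> gives the same integrals.\<close>

lemma lebesgue_continuous_open:
  fixes g :: "'a::euclidean_space \<Rightarrow> real"
  assumes "open S" "continuous_on S g"
  shows "set_integrable lebesgue S g \<longleftrightarrow> set_integrable lborel S g"
    and "(LINT z:S|lebesgue. g z) = (LINT z:S|lborel. g z)"
  using set_borel_measurable_continuous_open[OF assms]
  by (simp_all add: set_integrable_def set_lebesgue_integral_def set_borel_measurable_def integrable_completion integral_completion)

lemma lborel_translation:
  fixes g :: "'a::euclidean_space \<Rightarrow> real"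
  assumes "open S" "continuous_on ((+) a ` S) g"
  shows "set_integrable lborel ((+) a ` S) g \<longleftrightarrow> set_integrable lborel S (\<lambda>z. g (a + z))"
    and "(LINT z:(+) a ` S|lborel. g z) = (LINT z:S|lborel. g (a + z))"
proof -
  let ?k = "\<lambda>z. indicator ((+) a ` S) z *\<^sub>R g z"
  have k: "?k \<in> borel_measurable borel"
    using set_borel_measurable_continuous_open[OF open_translation[OF assms(1)] assms(2)] by (simp add: set_borel_measurable_def)
  have ind: "?k (a + z) = indicator S z *\<^sub>R g (a + z)" for z by (auto simp: indicator_def)
  have m: "(+) a \<in> lborel \<rightarrow>\<^sub>M borel" by simp
  show "set_integrable lborel ((+) a ` S) g \<longleftrightarrow> set_integrable lborel S (\<lambda>z. g (a + z))"
    using integrable_distr_eq[OF m k] unfolding lborel_distr_plus set_integrable_def ind .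
  show "(LINT z:(+) a ` S|lborel. g z) = (LINT z:S|lborel. g (a + z))"
    using integral_distr[OF m k] unfolding lborel_distr_plus set_lebesgue_integral_def ind .
qed

lemma set_integrable_bounded_continuous:
  fixes f :: "'a::euclidean_space \<Rightarrow> 'b::{banach,second_countable_topology}"
  assumes "continuous_on UNIV f" "bounded S" "S \<in> sets borel"
  shows "set_integrable lborel S f"
proof -
  have "set_integrable lborel (closure S) f"
    unfolding set_integrable_def
    by (rule borel_integrable_compact) (use assms in \<open>auto intro: continuous_on_subset\<close>)
  then show ?thesis
    by (rule set_integrable_subset) (use assms closure_subset in auto)
qed


section \<open>The mean value property on balanced sets\<close>

lemma norm_vector_smult: "norm (c *s (z::complex^'n::finite)) = cmod c * norm z"
  by (simp add: norm_vec_def norm_mult L2_set_right_distrib)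

lemma scaleR_vector_smult: "r *\<^sub>R (z::complex^'n::finite) = complex_of_real r *s z"
  by (simp add: vec_eq_iff scaleR_conv_of_real[where 'a=complex])

lemma orthogonal_transformation_smult:
  assumes "cmod c = 1"
  shows "orthogonal_transformation (\<lambda>z::complex^'n::finite. c *s z)"
  unfolding orthogonal_transformation linear_iff
  using assms by (auto simp: norm_vector_smult scaleR_vector_smult vector_add_ldistrib vector_smult_assoc mult.commute)

lemma bounded_bilinear_vector_smult: "bounded_bilinear (\<lambda>c (v::complex^'m::finite). c *s v)"
  by (rule bounded_bilinear.intro)
    (auto simp: vector_sadd_rdistrib vector_add_ldistrib scaleR_vector_smult vector_smult_assoc
      scaleR_conv_of_real[where 'a=complex] norm_vector_smult mult.commute intro!: exI[of _ 1])

lemma continuous_on_vector_smult [continuous_intros]: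
  fixes f :: "'a::topological_space \<Rightarrow> complex" and g :: "'a \<Rightarrow> complex^'n::finite"
  assumes "continuous_on S f" "continuous_on S g"
  shows "continuous_on S (\<lambda>x. f x *s g x)"
  unfolding vector_scalar_mult_def
  by (intro continuous_intros assms)

definition balanced :: "(complex^'n::finite) set \<Rightarrow> bool" where
  "balanced P \<longleftrightarrow> (\<forall>z\<in>P. \<forall>c. cmod c \<le> 1 \<longrightarrow> c *s z \<in> P)"

lemma balanced_unit_smult_iff:
  assumes "balanced P" "cmod c = 1"
  shows "c *s z \<in> P \<longleftrightarrow> z \<in> P"
proof
  assume "c *s z \<in> P"
  then have "cnj c *s (c *s z) \<in> P" using assms by (metis balanced_def complex_mod_cnj order_refl)
  moreover have "cnj c * c = 1" using assms(2) by (simp add: complex_norm_square[symmetric] mult.commute)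
  ultimately show "z \<in> P" by (simp add: vector_smult_assoc)
qed (use assms in \<open>auto simp: balanced_def\<close>)

text \<open>Multiplication by a unit scalar is an orthogonal map of the underlying real space that fixes the
set, so the substitution rule applies with Jacobian \<open>1\<close>.\<close>

lemma balanced_LINT_smult:
  fixes f :: "complex^'n::finite \<Rightarrow> 'b::{banach,second_countable_topology}"
  assumes "balanced P" "cmod c = 1"
  shows "(LINT z:P|lborel. f (c *s z)) = (LINT z:P|lborel. f z)"
  using set_integral_orthogonal[OF orthogonal_transformation_smult[OF assms(2)], of P f]
    orthogonal_vimage_image[OF orthogonal_transformation_smult[OF assms(2)], of P] balanced_unit_smult_iff[OF assms] by simp

lemma circle_mean_value:
  assumes "f holomorphic_on cball 0 1"
  shows "(LINT t:{0..1}|lborel. f (exp (2 * of_real pi * \<i> * of_real t))) = f 0"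
proof -
  let ?e = "\<lambda>t::real. exp (2 * of_real pi * \<i> * of_real t)"
  have "((\<lambda>u. f u / (u - 0)) has_contour_integral (2 * of_real pi * \<i> * f 0)) (circlepath 0 1)"
    by (rule Cauchy_integral_circlepath_simple) (use assms in auto)
  then have "((\<lambda>x. f (circlepath 0 1 x) / circlepath 0 1 x * vector_derivative (circlepath 0 1) (at x within {0..1}))
      has_integral (2 * of_real pi * \<i> * f 0)) {0..1}"
    by (simp add: has_contour_integral_def)
  then have "((\<lambda>x. 2 * of_real pi * \<i> * f (?e x)) has_integral (2 * of_real pi * \<i> * f 0)) {0..1}"
  proof (rule has_integral_eq [rotated])
    fix x :: real assume "x \<in> {0..1}"
    then have "vector_derivative (circlepath 0 1) (at x within {0..1}) = 2 * of_real pi * \<i> * 1 * ?e x"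
      using vector_derivative_circlepath01[of x 0 1] by simp
    then show "f (circlepath 0 1 x) / circlepath 0 1 x * vector_derivative (circlepath 0 1) (at x within {0..1})
        = 2 * of_real pi * \<i> * f (?e x)"
      by (simp only:) (simp add: circlepath)
  qed
  from has_integral_mult_right[OF this, of "1 / (2 * of_real pi * \<i>)"]
  have "((\<lambda>x. f (?e x)) has_integral f 0) {0..1}"
    by simp
  moreover have "set_integrable lborel {0..1} (\<lambda>x. f (?e x))"
  proof (rule borel_integrable_atLeastAtMost')
    have "continuous_on (cball 0 1) f" using assms holomorphic_on_imp_continuous_on by blast
    then show "continuous_on {0..1} (\<lambda>x. f (?e x))"
      by (rule continuous_on_compose2) (auto intro!: continuous_intros)
  qed
  ultimately show ?thesis
    using set_borel_integral_eq_integral(2) by (metis integral_unique)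
qed

text \<open>Replacing \<open>z\<close> by \<open>e\<^sup>i\<^sup>t z\<close> does not change the integral. Averaging over \<open>t\<close> and exchanging the order of
integration, the inner integral is the mean of the one-variable function \<open>w \<mapsto> g(w z)\<close> over the unit
circle, which is \<open>g 0\<close> for every \<open>z\<close>. Near the boundary of \<open>P\<close> the function \<open>g\<close> may be unbounded;
Fubini's theorem applies because the integral of \<open>|g|\<close> is invariant under the rotations as well.\<close>

theorem mean_value_balanced:
  fixes P :: "(complex^'n::finite) set" and g :: "complex^'n \<Rightarrow> complex"
  assumes "open P" and "bounded P"
    and balanced: "balanced P"
    and hol: "\<And>z. z \<in> P \<Longrightarrow> (\<lambda>w. g (w *s z)) holomorphic_on cball 0 1"
    and int: "set_integrable lborel P g"
  shows "(LINT z:P|lborel. g z) = measure lborel P * g 0"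
proof -
  let ?e = "\<lambda>t::real. exp (2 * of_real pi * \<i> * of_real t)"
  have cmod_e: "cmod (?e t) = 1" for t by simp
  have mem: "?e t *s z \<in> P \<longleftrightarrow> z \<in> P" for t z
    by (rule balanced_unit_smult_iff[OF balanced cmod_e])
  define G where "G = (\<lambda>z. indicator P z *\<^sub>R g z)"
  have G: "integrable lborel G" using int by (simp add: G_def set_integrable_def)
  then have Gm[measurable]: "G \<in> borel_measurable borel" by auto
  define F where "F = (\<lambda>t z. indicator {0..1::real} t *\<^sub>R G (?e t *s z))"
  have [measurable]: "(\<lambda>p. ?e (fst p) *s snd p) \<in> borel_measurable (borel :: (real \<times> (complex^'n)) measure)"
    by (intro borel_measurable_continuous_onI continuous_intros)
  have [measurable]: "fst \<in> borel_measurable (borel :: (real \<times> (complex^'n)) measure)"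
    by (intro borel_measurable_continuous_onI continuous_intros)
  have "(\<lambda>p. F (fst p) (snd p)) \<in> borel_measurable (borel :: (real \<times> (complex^'n)) measure)"
    unfolding F_def by measurable
  then have Fm: "case_prod F \<in> borel_measurable (lborel \<Otimes>\<^sub>M lborel)"
    by (simp add: lborel_prod case_prod_unfold)
  have rot: "(LINT z|lborel. K (?e t *s z)) = (LINT z|lborel. K z)" for K :: "complex^'n \<Rightarrow> 'b::{banach,second_countable_topology}" and t
    by (rule integral_orthogonal(1)[OF orthogonal_transformation_smult[OF cmod_e]])
  have rot_int: "integrable lborel (\<lambda>z. G (?e t *s z))" for t
    using integral_orthogonal(2)[OF orthogonal_transformation_smult[OF cmod_e]] G by blast
  have "integrable (lborel \<Otimes>\<^sub>M lborel) (case_prod F)"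
  proof (rule lborel_pair.Fubini_integrable[OF Fm])
    have "(\<lambda>t. LINT z|lborel. norm (case_prod F (t, z))) = (\<lambda>t. indicator {0..1} t *\<^sub>R (LINT z|lborel. norm (G z)))"
    proof
      fix t
      have "(LINT z|lborel. norm (case_prod F (t, z))) = indicator {0..1} t * (LINT z|lborel. norm (G (?e t *s z)))"
        by (simp add: F_def)
      also have "(LINT z|lborel. norm (G (?e t *s z))) = (LINT z|lborel. norm (G z))"
        by (rule rot[of "\<lambda>z. norm (G z)"])
      finally show "(LINT z|lborel. norm (case_prod F (t, z))) = indicator {0..1} t *\<^sub>R (LINT z|lborel. norm (G z))"
        by simp
    qed
    then show "integrable lborel (\<lambda>t. LINT z|lborel. norm (case_prod F (t, z)))"
      by (simp add: integrable_mult_left)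
    show "AE t in lborel. integrable lborel (\<lambda>z. case_prod F (t, z))"
      unfolding F_def using rot_int by auto
  qed
  from lborel_pair.Fubini_integral[OF this]
  have "(LINT z|lborel. LINT t|lborel. F t z) = (LINT t|lborel. LINT z|lborel. F t z)" .
  also have "(LINT t|lborel. LINT z|lborel. F t z) = (LINT t:{0..1::real}|lborel. (LINT z|lborel. G z))"
    unfolding F_def set_lebesgue_integral_def by (simp add: rot)
  also have "\<dots> = (LINT z|lborel. G z)"
    by (simp add: set_lebesgue_integral_def)
  also have "(LINT z|lborel. LINT t|lborel. F t z) = (LINT z|lborel. indicator P z *\<^sub>R g 0)"
  proof (rule Bochner_Integration.integral_cong[OF refl])
    fix z
    show "(LINT t|lborel. F t z) = indicator P z *\<^sub>R g 0"
    proof (cases "z \<in> P")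
      case True
      have "(LINT t|lborel. F t z) = (LINT t:{0..1}|lborel. g (?e t *s z))"
        unfolding F_def G_def set_lebesgue_integral_def using True by (simp add: mem)
      also have "\<dots> = g 0" using circle_mean_value[OF hol[OF True]] by simp
      finally show ?thesis using True by simp
    qed (simp add: F_def G_def mem)
  qed
  also have "\<dots> = measure lborel P * g 0"
    using assms(1,2) by (simp add: emeasure_bounded_finite scaleR_conv_of_real)
  finally show ?thesis by (simp add: G_def set_lebesgue_integral_def)
qed


section \<open>Second moments of a product of two balls\<close>

text \<open>Sums of squares instead of norms of subvectors avoid square roots and make \<open>- J\<close>, the remaining
coordinates, symmetric to \<open>J\<close>.\<close>

definition sqsum :: "'n set \<Rightarrow> complex^'n::finite \<Rightarrow> real" where
  "sqsum J w = (\<Sum>j\<in>J. (cmod (w $ j))\<^sup>2)"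

definition biball :: "'n set \<Rightarrow> real \<Rightarrow> real \<Rightarrow> (complex^'n::finite) set" where
  "biball J r s = {w. sqsum J w < r\<^sup>2 \<and> sqsum (- J) w < s\<^sup>2}"

lemma continuous_on_sqsum [continuous_intros]:
  "continuous_on S f \<Longrightarrow> continuous_on S (\<lambda>x. sqsum J (f x))"
  unfolding sqsum_def by (intro continuous_intros) auto

lemma sqsum_nonneg [simp]: "0 \<le> sqsum J w"
  by (simp add: sqsum_def sum_nonneg)

lemma sqsum_split: "sqsum J w + sqsum (- J) w = (norm (w :: complex^'n::finite))\<^sup>2"
proof -
  have "(norm w)\<^sup>2 = sqsum UNIV w"
    by (simp add: norm_vec_def L2_set_def sqsum_def sum_nonneg)
  then show ?thesis
    unfolding sqsum_def using sum.subset_diff[of J UNIV "\<lambda>j. (cmod (w $ j))\<^sup>2"] by (simp add: Compl_eq_Diff_UNIV add.commute)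
qed

lemma biball_norm: "w \<in> biball J r s \<Longrightarrow> (norm w)\<^sup>2 < r\<^sup>2 + s\<^sup>2"
  using sqsum_split[of J w] by (simp add: biball_def)

lemma biball_UNIV:
  assumes "0 < r" "0 < s" shows "biball UNIV r s = ball (0 :: complex^'n::finite) r"
proof -
  have "sqsum UNIV w < r\<^sup>2 \<longleftrightarrow> norm w < r" for w :: "complex^'n"
    using sqsum_split[of UNIV w] assms(1) power2_less_imp_less[of "norm w" r] power_strict_mono[of "norm w" r 2]
    by (auto simp: sqsum_def)
  then show ?thesis
    using assms(2) by (simp add: biball_def set_eq_iff) (simp add: sqsum_def)
qed

lemma biball_swap: "biball (- J) s r = biball J r s"
  by (auto simp: biball_def)

lemma open_biball: "open (biball J r s)"
proof -
  have "biball J r s = {w. sqsum J w < r\<^sup>2} \<inter> {w. sqsum (- J) w < s\<^sup>2}"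
    by (auto simp: biball_def)
  then show ?thesis
    by (auto intro!: open_Int open_Collect_less continuous_intros)
qed

lemma bounded_biball: "bounded (biball J r s)"
proof -
  have "norm w \<le> sqrt (r\<^sup>2 + s\<^sup>2)" if "w \<in> biball J r s" for w
    using biball_norm[OF that] by (intro real_le_rsqrt) simp
  then show ?thesis unfolding bounded_iff by blast
qed

lemma borel_biball: "biball J r s \<in> sets borel"
  by (simp add: open_biball borel_open)

lemma zero_in_biball: "0 < r \<Longrightarrow> 0 < s \<Longrightarrow> 0 \<in> biball J r s"
  by (simp add: biball_def sqsum_def)

lemma sqsum_smult: "sqsum J (c *s w) = (cmod c)\<^sup>2 * sqsum J w"
  by (simp add: sqsum_def norm_mult power_mult_distrib sum_distrib_left)

lemma biball_balanced: "w \<in> biball J r s \<Longrightarrow> cmod c \<le> 1 \<Longrightarrow> c *s w \<in> biball J r s"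
proof -
  assume "w \<in> biball J r s" "cmod c \<le> 1"
  moreover have "(cmod c)\<^sup>2 * sqsum K w \<le> sqsum K w" for K
    using \<open>cmod c \<le> 1\<close> by (intro mult_left_le_one_le) (auto simp: power_le_one)
  ultimately show ?thesis
    unfolding biball_def by (auto simp: sqsum_smult intro: le_less_trans)
qed

lemma measure_biball_pos: "0 < r \<Longrightarrow> 0 < s \<Longrightarrow> 0 < measure lborel (biball J r s)"
  using measure_lborel_open_pos[OF open_biball bounded_biball] zero_in_biball by blast

text \<open>Scaling the coordinates in \<open>J\<close> by \<open>l\<close> is a diagonal real linear map; each complex coordinate contributes
two basis vectors, whence the exponent \<open>2 card J\<close>.\<close>

lemma measure_biball_scale:
  fixes J :: "'n::finite set"
  assumes l: "0 < l" and "0 < r"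
  shows "measure lborel (biball J (l * r) s) = l ^ (2 * card J) * measure lborel (biball J r s)"
proof -
  \<comment> \<open>the real basis vectors that belong to the coordinates in \<open>J\<close>\<close>
  define D where "D = (\<lambda>(j::'n, u::complex). axis j u) ` (J \<times> {1, \<i>})"
  have D: "D \<subseteq> Basis" unfolding D_def by (auto simp: Basis_vec_def Basis_complex_def)
  have cD: "card D = 2 * card J"
    unfolding D_def by (subst card_image) (auto simp: inj_on_def axis_eq_axis card_cartesian_product complex_eq_iff)
  define c where "c = (\<lambda>b::complex^'n. if b \<in> D then l else 1)"
  define T where "T = (\<lambda>x::complex^'n. 0 + (\<Sum>b\<in>Basis. (c b * (x \<bullet> b)) *\<^sub>R b))"
  have c0: "c b \<noteq> 0" for b using l by (simp add: c_def)
  have lb: "lborel = density (distr lborel borel T) (\<lambda>_. (\<Prod>b\<in>Basis. \<bar>c b\<bar>))"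
    unfolding T_def using c0 by (rule lborel_affine_euclidean)
  have K: "(\<Prod>b\<in>Basis. \<bar>c b\<bar>) = l ^ (2 * card J)"
  proof -
    have "(\<Prod>b\<in>Basis. \<bar>c b\<bar>) = (\<Prod>b\<in>Basis. if b \<in> D then l else 1)"
      using l by (intro prod.cong) (auto simp: c_def)
    also have "\<dots> = l ^ card D"
      using D by (simp add: prod.If_cases Int_absorb1 Int_absorb2)
    finally show ?thesis by (simp add: cD)
  qed
  have Tj: "T x $ j = (if j \<in> J then of_real l * x $ j else x $ j)" for x j
  proof -
    have inner_T: "T x \<bullet> b = c b * (x \<bullet> b)" if "b \<in> Basis" for b
      unfolding T_def using that by (simp add: inner_sum_left inner_Basis if_distrib sum.delta cong: if_cong)
    have B: "axis j 1 \<in> (Basis :: (complex^'n) set)" "axis j \<i> \<in> (Basis :: (complex^'n) set)"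
      by (auto simp: Basis_vec_def Basis_complex_def)
    have mem: "axis j 1 \<in> D \<longleftrightarrow> j \<in> J" "axis j \<i> \<in> D \<longleftrightarrow> j \<in> J"
      unfolding D_def by (auto simp: axis_eq_axis image_iff)
    show ?thesis
      using inner_T[OF B(1)] inner_T[OF B(2)] mem
      by (auto simp: complex_eq_iff inner_axis c_def inner_complex_def)
  qed
  have sq: "sqsum J (T w) = l\<^sup>2 * sqsum J w" "sqsum (- J) (T w) = sqsum (- J) w" for w
    using l by (simp_all add: sqsum_def Tj norm_mult power_mult_distrib sum_distrib_left)
  have Tm[measurable]: "T \<in> borel_measurable borel"
    unfolding T_def by (intro borel_measurable_continuous_onI continuous_intros)
  have pre: "T -` biball J (l * r) s = biball J r s"
    using l by (auto simp: biball_def sq power_mult_distrib)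
  have "emeasure lborel (biball J (l * r) s) = ennreal (l ^ (2 * card J)) * emeasure lborel (biball J r s)"
    using l by (subst lb) (simp add: emeasure_density K borel_biball nn_integral_cmult_indicator emeasure_distr pre)
  then show ?thesis
    using l by (simp add: measure_def enn2real_mult)
qed

lemma LINT_power_interval:
  assumes "0 \<le> (b::real)"
  shows "(LINT t:{0<..<b}|lborel. t ^ k) = b ^ Suc k / Suc k"
proof -
  have "((\<lambda>t. t ^ k) has_integral (b ^ Suc k / Suc k - 0 ^ Suc k / Suc k)) {0..b}"
  proof (rule fundamental_theorem_of_calculus[OF assms])
    fix t :: real
    have "((\<lambda>t. t ^ Suc k / real (Suc k)) has_real_derivative t ^ k) (at t within {0..b})"
      using DERIV_cdivide[OF DERIV_pow[of "Suc k" t], of "real (Suc k)"] by (simp del: of_nat_Suc power_Suc)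
    then show "((\<lambda>t. t ^ Suc k / real (Suc k)) has_vector_derivative t ^ k) (at t within {0..b})"
      by (simp only: has_real_derivative_iff_has_vector_derivative)
  qed
  then have "((\<lambda>t. t ^ k) has_integral (b ^ Suc k / Suc k)) {0..b}" by simp
  then have "integral {0<..<b} (\<lambda>t. t ^ k) = b ^ Suc k / Suc k"
    using integral_open_interval_real[of 0 b "\<lambda>t. t ^ k"] by (auto simp: integral_unique)
  moreover have "set_integrable lborel {0<..<b} (\<lambda>t::real. t ^ k)"
    by (rule set_integrable_bounded_continuous) (auto intro!: continuous_intros)
  ultimately show ?thesis by (simp add: set_borel_integral_eq_integral)
qed

text \<open>Layer cake: \<open>r\<^sup>2 - |w'|\<^sup>2\<close> is the length of the interval of all \<open>t\<close> with \<open>|w'|\<^sup>2 < t < r\<^sup>2\<close>, where \<open>w'\<close>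
is the part of \<open>w\<close> with indices in \<open>J\<close>. Integrating over \<open>w\<close> first, the slice at height \<open>t\<close> is a product
of balls with first radius \<open>sqrt t\<close>, whose measure is \<open>(t / r\<^sup>2)\<^sup>k\<close> times the full one, \<open>k = card J\<close>.
Hence \<open>r\<^sup>2 - |w'|\<^sup>2\<close> has mean \<open>r\<^sup>2 / (k + 1)\<close>.\<close>

lemma LINT_biball_sqsum:
  fixes J :: "'n::finite set"
  assumes r: "0 < r" and s: "0 < s"
  shows "(LINT w:biball J r s|lborel. sqsum J w)
    = measure lborel (biball J r s) * (real (card J) * r\<^sup>2 / (real (card J) + 1))"
proof -
  let ?V = "measure lborel (biball J r s)"
  define A where "A = {(t::real, w::complex^'n). sqsum J w < t \<and> t < r\<^sup>2 \<and> sqsum (- J) w < s\<^sup>2}"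
  define H where "H = (\<lambda>t w. indicator A (t, w) :: real)"
  have oA: "open A"
  proof -
    have "A = {p. sqsum J (snd p) < fst p} \<inter> {p. fst p < r\<^sup>2} \<inter> {p. sqsum (- J) (snd p) < s\<^sup>2}"
      by (auto simp: A_def)
    then show ?thesis by (auto intro!: open_Int open_Collect_less continuous_intros)
  qed
  have sub: "A \<subseteq> {0..r\<^sup>2} \<times> biball J r s"
    by (auto simp: A_def biball_def intro: order.trans[OF sqsum_nonneg less_imp_le])
  have "bounded A"
    by (rule bounded_subset[OF _ sub]) (auto intro!: bounded_Times bounded_biball)
  then have "emeasure lborel A < \<infinity>" by (rule emeasure_bounded_finite)
  then have "integrable (lborel \<Otimes>\<^sub>M lborel) (indicator A :: real \<times> (complex^'n) \<Rightarrow> real)"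
    using oA by (simp add: lborel_prod integrable_indicator_iff)
  then have "integrable (lborel \<Otimes>\<^sub>M lborel) (case_prod H)"
    by (simp add: H_def case_prod_unfold)
  from lborel_pair.Fubini_integral[OF this]
  have "(LINT w|lborel. LINT t|lborel. H t w) = (LINT t|lborel. LINT w|lborel. H t w)" .
  also have "(LINT w|lborel. LINT t|lborel. H t w) = (LINT w:biball J r s|lborel. r\<^sup>2 - sqsum J w)"
    unfolding set_lebesgue_integral_def
  proof (rule Bochner_Integration.integral_cong[OF refl])
    fix w
    have "(LINT t|lborel. H t w) = (LINT t|lborel. indicator (if sqsum (- J) w < s\<^sup>2 then {sqsum J w<..<r\<^sup>2} else {}) t)"
      by (rule Bochner_Integration.integral_cong) (auto simp: H_def A_def indicator_def)
    also have "\<dots> = (if sqsum (- J) w < s\<^sup>2 \<and> sqsum J w < r\<^sup>2 then r\<^sup>2 - sqsum J w else 0)"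
      using measure_lborel_Ioo[of "sqsum J w" "r\<^sup>2"] by (cases "sqsum J w < r\<^sup>2") (simp_all del: measure_lborel_Ioo)
    also have "\<dots> = indicator (biball J r s) w *\<^sub>R (r\<^sup>2 - sqsum J w)"
      by (auto simp: biball_def indicator_def)
    finally show "(LINT t|lborel. H t w) = indicator (biball J r s) w *\<^sub>R (r\<^sup>2 - sqsum J w)" .
  qed
  also have "(LINT t|lborel. LINT w|lborel. H t w) = (LINT t:{0<..<r\<^sup>2}|lborel. ?V / r ^ (2 * card J) * t ^ card J)"
    unfolding set_lebesgue_integral_def
  proof (rule Bochner_Integration.integral_cong[OF refl])
    fix t :: real
    show "(LINT w|lborel. H t w) = indicator {0<..<r\<^sup>2} t *\<^sub>R (?V / r ^ (2 * card J) * t ^ card J)"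
    proof (cases "0 < t \<and> t < r\<^sup>2")
      case True
      \<comment> \<open>the radius \<open>sqrt t\<close> is written as a multiple of \<open>r\<close>, the form needed for scaling\<close>
      have "(LINT w|lborel. H t w) = (LINT w|lborel. indicator (biball J (sqrt t / r * r) s) w)"
        using True r by (intro Bochner_Integration.integral_cong) (auto simp: H_def A_def indicator_def biball_def)
      also have "\<dots> = measure lborel (biball J (sqrt t / r * r) s)" by (simp add: borel_biball)
      also have "\<dots> = (sqrt t / r) ^ (2 * card J) * ?V"
        using True r by (intro measure_biball_scale) auto
      also have "(sqrt t / r) ^ (2 * card J) = t ^ card J / r ^ (2 * card J)"
        using True by (simp add: power_divide power_mult)
      finally show ?thesis using True by simp
    next
      case False
      then have "H t w = 0" for w
        using sqsum_nonneg[of J w] by (auto simp: H_def A_def indicator_def simp del: sqsum_nonneg)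
      then show ?thesis using False by auto
    qed
  qed
  also have "\<dots> = ?V / r ^ (2 * card J) * ((r\<^sup>2) ^ Suc (card J) / Suc (card J))"
    by (simp add: LINT_power_interval set_integral_mult_right)
  also have "\<dots> = ?V * (r\<^sup>2 / (real (card J) + 1))"
    using r by (simp add: power_mult[symmetric] power_add field_simps)
  finally have *: "(LINT w:biball J r s|lborel. r\<^sup>2 - sqsum J w) = ?V * (r\<^sup>2 / (real (card J) + 1))" .
  have "(LINT w:biball J r s|lborel. r\<^sup>2 - sqsum J w) = (LINT w:biball J r s|lborel. r\<^sup>2) - (LINT w:biball J r s|lborel. sqsum J w)"
    by (intro set_integral_diff(2) set_integrable_bounded_continuous continuous_intros bounded_biball borel_biball)
  moreover have "(LINT w:biball J r s|lborel. r\<^sup>2) = ?V * r\<^sup>2"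
    using emeasure_bounded_finite[OF bounded_biball, of J r s] borel_biball[of J r s] by (simp add: set_lebesgue_integral_def)
  ultimately have "(LINT w:biball J r s|lborel. sqsum J w) = ?V * r\<^sup>2 - ?V * (r\<^sup>2 / (real (card J) + 1))"
    using * by simp
  also have "\<dots> = ?V * (real (card J) * r\<^sup>2 / (real (card J) + 1))"
    by (simp add: field_simps)
  finally show ?thesis .
qed

lemma orthogonal_transformation_flip_sign:
  "orthogonal_transformation (\<lambda>w::complex^'n::finite. \<chi> k. if k = i then - (w $ k) else w $ k)"
  by (auto simp: orthogonal_transformation linear_iff vec_eq_iff norm_vec_def L2_set_def intro!: sum.cong)

lemma orthogonal_transformation_permute:
  assumes "p permutes UNIV"
  shows "orthogonal_transformation (\<lambda>w::complex^'n::finite. \<chi> k. w $ p k)"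
proof -
  have "(\<Sum>k\<in>UNIV. (cmod (w $ p k))\<^sup>2) = (\<Sum>k\<in>UNIV. (cmod (w $ k))\<^sup>2)" for w :: "complex^'n"
    using sum.permute[OF assms, of "\<lambda>k. (cmod (w $ k))\<^sup>2"] by (simp add: o_def)
  then show ?thesis
    by (auto simp: orthogonal_transformation linear_iff vec_eq_iff norm_vec_def L2_set_def)
qed

text \<open>The product of balls is invariant under a change of sign of one coordinate, while the integrand
changes sign.\<close>

lemma LINT_biball_offdiag:
  fixes i j :: "'n::finite"
  assumes "i \<noteq> j"
  shows "(LINT w:biball J r s|lborel. w $ i * cnj (w $ j)) = 0"
proof -
  let ?T = "\<lambda>w::complex^'n. \<chi> k. if k = i then - (w $ k) else w $ k"
  have sq: "sqsum K (?T w) = sqsum K w" for K w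
    unfolding sqsum_def by (intro sum.cong) auto
  have "?T ` biball J r s = biball J r s"
    by (rule orthogonal_vimage_image[OF orthogonal_transformation_flip_sign]) (simp add: biball_def sq)
  then have "(LINT w:biball J r s|lborel. ?T w $ i * cnj (?T w $ j)) = (LINT w:biball J r s|lborel. w $ i * cnj (w $ j))"
    using set_integral_orthogonal[OF orthogonal_transformation_flip_sign, of "biball J r s" "\<lambda>w. w $ i * cnj (w $ j)" i] by simp
  moreover have "(LINT w:biball J r s|lborel. ?T w $ i * cnj (?T w $ j)) = - (LINT w:biball J r s|lborel. w $ i * cnj (w $ j))"
    using assms by (simp add: set_lebesgue_integral_def)
  ultimately show ?thesis by (simp add: eq_neg_iff_add_eq_0)
qed

text \<open>Exchanging two coordinates with indices in \<open>J\<close> preserves the product of balls.\<close>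

lemma LINT_biball_diag_sym:
  fixes i j :: "'n::finite"
  assumes "i \<in> J" "j \<in> J"
  shows "(LINT w:biball J r s|lborel. (cmod (w $ i))\<^sup>2) = (LINT w:biball J r s|lborel. (cmod (w $ j))\<^sup>2)"
proof -
  let ?p = "Transposition.transpose i j"
  let ?T = "\<lambda>w::complex^'n. \<chi> k. w $ ?p k"
  have p: "?p permutes UNIV" "?p permutes J"
    using assms by (auto intro: permutes_swap_id)
  have T: "orthogonal_transformation ?T" by (rule orthogonal_transformation_permute[OF p(1)])
  have sq: "sqsum J (?T w) = sqsum J w" "sqsum (- J) (?T w) = sqsum (- J) w" for w
  proof -
    show "sqsum J (?T w) = sqsum J w"
      using sum.permute[OF p(2), of "\<lambda>k. (cmod (w $ k))\<^sup>2"] by (simp add: sqsum_def o_def)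
    have "?p k = k" if "k \<in> - J" for k
      using that assms by (metis ComplD transpose_apply_other)
    then show "sqsum (- J) (?T w) = sqsum (- J) w"
      by (simp add: sqsum_def)
  qed
  have "?T ` biball J r s = biball J r s"
    by (rule orthogonal_vimage_image[OF T]) (simp add: biball_def sq)
  then show ?thesis
    using set_integral_orthogonal[OF T, of "biball J r s" "\<lambda>w. (cmod (w $ j))\<^sup>2"] by simp
qed

lemma LINT_biball_diag:
  fixes j :: "'n::finite"
  assumes r: "0 < r" and s: "0 < s" and j: "j \<in> J"
  shows "(LINT w:biball J r s|lborel. (cmod (w $ j))\<^sup>2)
    = measure lborel (biball J r s) * (r\<^sup>2 / (real (card J) + 1))"
proof -
  let ?I = "\<lambda>i. LINT w:biball J r s|lborel. (cmod (w $ i))\<^sup>2"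
  have "(LINT w:biball J r s|lborel. sqsum J w) = (\<Sum>i\<in>J. ?I i)"
  proof -
    have "set_integrable lborel (biball J r s) (\<lambda>w. (cmod (w $ i))\<^sup>2)" for i
      by (intro set_integrable_bounded_continuous continuous_intros bounded_biball borel_biball)
    then show ?thesis
      unfolding sqsum_def set_lebesgue_integral_def set_integrable_def scaleR_sum_right
      by (intro Bochner_Integration.integral_sum) auto
  qed
  also have "\<dots> = (\<Sum>i\<in>J. ?I j)"
    using LINT_biball_diag_sym[OF _ j] by (intro sum.cong) auto
  also have "\<dots> = real (card J) * ?I j" by simp
  finally have "real (card J) * ?I j = real (card J) * (measure lborel (biball J r s) * (r\<^sup>2 / (real (card J) + 1)))"
    using LINT_biball_sqsum[OF r s, of J] by (simp add: mult_ac)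
  moreover have "real (card J) \<noteq> 0" using j by auto
  ultimately show ?thesis by (metis mult_left_cancel)
qed

theorem LINT_biball_moments:
  fixes i j :: "'n::finite"
  assumes r: "0 < r" and s: "0 < s"
  shows "(LINT w:biball J r s|lborel. w $ i * cnj (w $ j)) = measure lborel (biball J r s) *
     (if i = j then of_real (if i \<in> J then r\<^sup>2 / (real (card J) + 1) else s\<^sup>2 / (real (card (- J)) + 1)) else 0)"
proof (cases "i = j")
  case True
  have "(LINT w:biball J r s|lborel. w $ i * cnj (w $ i)) = (LINT w:biball J r s|lborel. of_real ((cmod (w $ i))\<^sup>2))"
    by (simp only: complex_norm_square)
  also have "\<dots> = of_real (LINT w:biball J r s|lborel. (cmod (w $ i))\<^sup>2)"
    by (rule set_integral_complex_of_real)
  also have "\<dots> = of_real (measure lborel (biball J r s) * (if i \<in> J then r\<^sup>2 / (real (card J) + 1) else s\<^sup>2 / (real (card (- J)) + 1)))"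
    using LINT_biball_diag[OF r s, of i J] LINT_biball_diag[OF s r, of i "- J"] biball_swap[of J s r] by auto
  finally show ?thesis using True by simp
qed (use LINT_biball_offdiag in auto)


section \<open>Directional derivatives and Taylor expansion\<close>

text \<open>The derivative in the direction \<open>v\<close>, as an operator on functions, so that it can be iterated and
commuted.\<close>

definition dird :: "'a::real_normed_vector \<Rightarrow> ('a \<Rightarrow> 'b::real_normed_vector) \<Rightarrow> 'a \<Rightarrow> 'b" where
  "dird v f x = frechet_derivative f (at x) v"

lemma dirdI: "(f has_derivative D) (at x) \<Longrightarrow> dird v f x = D v"
  unfolding dird_def using frechet_derivative_at by metis

lemma differentiable_dird: "f differentiable (at x) \<Longrightarrow> (f has_derivative (\<lambda>v. dird v f x)) (at x)"
  unfolding dird_def using frechet_derivative_works[of f "at x"] by simp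

lemma dird_add: "f differentiable (at x) \<Longrightarrow> dird (u + v) f x = dird u f x + dird v f x"
  using linear_add[OF has_derivative_linear[OF differentiable_dird]] .

lemma dird_scaleR: "f differentiable (at x) \<Longrightarrow> dird (c *\<^sub>R v) f x = c *\<^sub>R dird v f x"
  using linear_cmul[OF has_derivative_linear[OF differentiable_dird]] .

lemma has_derivative_cong_open:
  assumes "open S" "x \<in> S" "\<And>y. y \<in> S \<Longrightarrow> f y = g y"
  shows "(f has_derivative D) (at x) \<longleftrightarrow> (g has_derivative D) (at x)"
  using assms has_derivative_transform_within_open[of f D x UNIV S g]
    has_derivative_transform_within_open[of g D x UNIV S f] by auto

lemma dird_cong:
  assumes "open S" "x \<in> S" "\<And>y. y \<in> S \<Longrightarrow> f y = g y"
  shows "dird v f x = dird v g x"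
  unfolding dird_def frechet_derivative_def using has_derivative_cong_open[OF assms] by simp

lemma Ck_on_Suc_iff:
  "Ck_on (Suc k) S f \<longleftrightarrow> (\<forall>x\<in>S. f differentiable (at x)) \<and> (\<forall>v. Ck_on k S (dird v f))"
  by (simp add: dird_def[abs_def])

declare Ck_on.simps(2) [simp del]

lemma Ck_on_cong:
  assumes "open S" "\<And>y. y \<in> S \<Longrightarrow> f y = g y"
  shows "Ck_on k S f \<longleftrightarrow> Ck_on k S g"
  using assms(2)
proof (induction k arbitrary: f g)
  case 0
  then show ?case using continuous_on_cong[OF refl] by auto
next
  case (Suc k)
  have "f differentiable (at x) \<longleftrightarrow> g differentiable (at x)" if "x \<in> S" for x
    using has_derivative_cong_open[OF assms(1) that Suc.prems] by (simp add: differentiable_def)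
  moreover have "Ck_on k S (dird v f) \<longleftrightarrow> Ck_on k S (dird v g)" for v
    using dird_cong[OF assms(1) _ Suc.prems] by (intro Suc.IH) auto
  ultimately show ?case by (simp add: Ck_on_Suc_iff)
qed

lemma Ck_on_differentiable: "Ck_on (Suc k) S f \<Longrightarrow> x \<in> S \<Longrightarrow> f differentiable (at x)"
  by (simp add: Ck_on_Suc_iff)

lemma Ck_on_dird: "Ck_on (Suc k) S f \<Longrightarrow> Ck_on k S (dird v f)"
  by (simp add: Ck_on_Suc_iff)

lemma Ck_on_Suc_imp: "Ck_on (Suc k) S f \<Longrightarrow> Ck_on k S f"
proof (induction k arbitrary: f)
  case 0
  then have "continuous (at x within S) f" if "x \<in> S" for x
    using that differentiable_imp_continuous_within Ck_on_differentiable differentiable_at_withinI by blast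
  then show ?case by (simp add: continuous_on_eq_continuous_within)
next
  case (Suc k)
  then show ?case by (subst Ck_on_Suc_iff) (auto simp: Ck_on_Suc_iff[of "Suc k"])
qed

lemma Ck_on_imp_continuous: "Ck_on k S f \<Longrightarrow> continuous_on S f"
  by (induction k) (auto dest: Ck_on_Suc_imp)

lemma Ck_on_bounded_linear:
  assumes T: "bounded_linear T" and S: "open S" and f: "Ck_on k S f"
  shows "Ck_on k S (\<lambda>x. T (f x))"
  using f
proof (induction k arbitrary: f)
  case 0
  then show ?case using bounded_linear.continuous_on[OF T] by simp
next
  case (Suc k)
  have D: "((\<lambda>x. T (f x)) has_derivative (\<lambda>v. T (dird v f x))) (at x)" if "x \<in> S" for x
    by (rule bounded_linear.has_derivative[OF T differentiable_dird[OF Ck_on_differentiable[OF Suc.prems that]]])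
  have "Ck_on k S (dird v (\<lambda>x. T (f x)))" for v
    using Suc.IH[OF Ck_on_dird[OF Suc.prems, of v]] Ck_on_cong[OF S, of "dird v (\<lambda>x. T (f x))" "\<lambda>x. T (dird v f x)" k]
      dirdI[OF D] by blast
  then show ?case using D by (auto simp: Ck_on_Suc_iff differentiable_def)
qed

abbreviation iterd :: "'a::real_normed_vector \<Rightarrow> nat \<Rightarrow> ('a \<Rightarrow> 'b::real_normed_vector) \<Rightarrow> 'a \<Rightarrow> 'b" where
  "iterd v k f \<equiv> (dird v ^^ k) f"

lemma iterd_Suc: "iterd v (Suc k) f = iterd v k (dird v f)"
  by (simp add: funpow_swap1)

lemma Ck_on_iterd: "Ck_on (m + k) S f \<Longrightarrow> Ck_on m S (iterd v k f)"
proof (induction k arbitrary: m)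
  case (Suc k)
  then show ?case using Ck_on_dird[of m S "iterd v k f"] Suc.IH[of "Suc m"] by simp
qed simp

lemma iterd_cong:
  assumes "open S" "\<And>y. y \<in> S \<Longrightarrow> f y = g y" "x \<in> S"
  shows "iterd v k f x = iterd v k g x"
  using assms(3)
proof (induction k arbitrary: x)
  case (Suc k)
  then show ?case using dird_cong[OF assms(1), of x "iterd v k f" "iterd v k g"] by simp
qed (use assms in auto)

lemma iterd_sum:
  assumes S: "open S" and I: "finite I" and g: "\<And>i. i \<in> I \<Longrightarrow> Ck_on k S (g i)" and x: "x \<in> S"
  shows "iterd v k (\<lambda>x. \<Sum>i\<in>I. c i *\<^sub>R g i x) x = (\<Sum>i\<in>I. c i *\<^sub>R iterd v k (g i) x)"
  using g
proof (induction k arbitrary: g)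
  case (Suc k)
  have "dird v (\<lambda>x. \<Sum>i\<in>I. c i *\<^sub>R g i x) y = (\<Sum>i\<in>I. c i *\<^sub>R dird v (g i) y)" if "y \<in> S" for y
    by (rule dirdI[where D = "\<lambda>v. \<Sum>i\<in>I. c i *\<^sub>R dird v (g i) y"])
      (intro has_derivative_sum has_derivative_scaleR_right differentiable_dird, use Suc.prems that Ck_on_differentiable in blast)
  then have "iterd v (Suc k) (\<lambda>x. \<Sum>i\<in>I. c i *\<^sub>R g i x) x = iterd v k (\<lambda>x. \<Sum>i\<in>I. c i *\<^sub>R dird v (g i) x) x"
    unfolding iterd_Suc by (intro iterd_cong[OF S _ x]) auto
  also have "\<dots> = (\<Sum>i\<in>I. c i *\<^sub>R iterd v (Suc k) (g i) x)"
    unfolding iterd_Suc using Suc.prems Ck_on_dird by (intro Suc.IH) blast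
  finally show ?case .
qed simp

lemma dird_Basis:
  fixes f :: "'a::euclidean_space \<Rightarrow> 'b::real_normed_vector"
  assumes "f differentiable (at x)"
  shows "dird v f x = (\<Sum>b\<in>Basis. (v \<bullet> b) *\<^sub>R dird b f x)"
  using linear_sum[OF has_derivative_linear[OF differentiable_dird[OF assms]], of "\<lambda>b. (v \<bullet> b) *\<^sub>R b" Basis]
  by (simp add: euclidean_representation dird_scaleR[OF assms])

text \<open>The constant has to be uniform in the direction. Expanding one derivative at a time in the standard
basis, \<open>D\<^sub>v = \<Sum>\<^sub>b (v \<bullet> b) D\<^sub>b\<close>, reduces the bound for \<open>D\<^sub>v\<^sup>k f\<close> to finitely many applications of the
induction hypothesis, to the functions \<open>D\<^sub>b f\<close>.\<close>

lemma iterd_bound: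
  fixes f :: "'a::euclidean_space \<Rightarrow> 'b::real_normed_vector"
  assumes S: "open S" and K: "compact K" "K \<subseteq> S" and f: "Ck_on k S f"
  shows "\<exists>C\<ge>0. \<forall>x\<in>K. \<forall>v. norm (iterd v k f x) \<le> C * norm v ^ k"
  using f
proof (induction k arbitrary: f)
  case 0
  then have "continuous_on K f" using K continuous_on_subset by auto
  then have "bounded (f ` K)" using K compact_continuous_image compact_imp_bounded by blast
  then obtain B where "0 < B" "\<forall>x\<in>K. norm (f x) \<le> B" by (auto simp: bounded_pos)
  then show ?case by (intro exI[of _ B]) auto
next
  case (Suc k)
  have ck: "Ck_on k S (dird b f)" for b using Ck_on_dird[OF Suc.prems] .
  from Suc.IH[OF ck] obtain C where C: "\<And>b. C b \<ge> 0" "\<And>b x v. x \<in> K \<Longrightarrow> norm (iterd v k (dird b f) x) \<le> C b * norm v ^ k"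
    by metis
  have "norm (iterd v (Suc k) f x) \<le> (\<Sum>b\<in>Basis. C b) * norm v ^ Suc k" if x: "x \<in> K" for x v
  proof -
    have "iterd v (Suc k) f x = iterd v k (\<lambda>x. \<Sum>b\<in>Basis. (v \<bullet> b) *\<^sub>R dird b f x) x"
      unfolding iterd_Suc using Suc.prems x K by (intro iterd_cong[OF S] dird_Basis Ck_on_differentiable) auto
    also have "\<dots> = (\<Sum>b\<in>Basis. (v \<bullet> b) *\<^sub>R iterd v k (dird b f) x)"
      using x K ck by (intro iterd_sum[OF S]) auto
    also have "norm \<dots> \<le> (\<Sum>b\<in>Basis. norm v * (C b * norm v ^ k))"
      using C x Basis_le_norm by (intro sum_norm_le) (auto intro!: mult_mono)
    also have "\<dots> = (\<Sum>b\<in>Basis. C b) * norm v ^ Suc k"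
      by (simp add: sum_distrib_right sum_distrib_left mult_ac)
    finally show ?thesis .
  qed
  then show ?case using C(1) by (intro exI[of _ "\<Sum>b\<in>Basis. C b"]) (auto intro: sum_nonneg)
qed

text \<open>Taylor's formula with integral remainder for the restriction of \<open>f\<close> to the segment from \<open>a\<close> to
\<open>a + z\<close>, whose derivatives are the iterated derivatives in the direction \<open>z\<close>.\<close>

lemma taylor_bound:
  fixes f :: "'a::euclidean_space \<Rightarrow> 'b::banach"
  assumes S: "open S" and ball: "cball a \<rho> \<subseteq> S" and f: "Ck_on p S f" and p: "0 < p"
  shows "\<exists>C\<ge>0. \<forall>z. norm z \<le> \<rho> \<longrightarrow>
     norm (f (a + z) - (\<Sum>i<p. (1 / fact i) *\<^sub>R iterd z i f a)) \<le> C * norm z ^ p"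
proof -
  obtain C where C: "C \<ge> 0" "\<And>x v. x \<in> cball a \<rho> \<Longrightarrow> norm (iterd v p f x) \<le> C * norm v ^ p"
    using iterd_bound[OF S compact_cball ball f] by blast
  have "norm (f (a + z) - (\<Sum>i<p. (1 / fact i) *\<^sub>R iterd z i f a)) \<le> C * norm z ^ p" if z: "norm z \<le> \<rho>" for z
  proof -
    have mem: "a + t *\<^sub>R z \<in> cball a \<rho>" if "0 \<le> t" "t \<le> 1" for t
      using z that by (simp add: dist_norm) (metis mult_left_le_one_le norm_ge_zero order_trans)
    define Df where "Df = (\<lambda>m t. iterd z m f (a + t *\<^sub>R z))"
    have Df: "(Df m has_vector_derivative Df (Suc m) t) (at t within {0..1})" if "m < p" "0 \<le> t" "t \<le> 1" for m t
    proof -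
      have "Ck_on (Suc (p - Suc m)) S (iterd z m f)"
        using Ck_on_iterd[of "Suc (p - Suc m)" m S f z] f that by simp
      then have "iterd z m f differentiable (at (a + t *\<^sub>R z))"
        using Ck_on_differentiable mem[OF that(2,3)] ball by blast
      note d = differentiable_dird[OF this]
      have "((\<lambda>t. a + t *\<^sub>R z) has_derivative (\<lambda>h. h *\<^sub>R z)) (at t within {0..1})"
        by (auto intro!: derivative_eq_intros)
      from has_derivative_compose[OF this d]
      have "(Df m has_derivative (\<lambda>h. dird (h *\<^sub>R z) (iterd z m f) (a + t *\<^sub>R z))) (at t within {0..1})"
        by (simp add: Df_def)
      moreover have "dird (h *\<^sub>R z) (iterd z m f) (a + t *\<^sub>R z) = h *\<^sub>R Df (Suc m) t" for h
        using linear_cmul[OF has_derivative_linear[OF d]] by (simp add: Df_def)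
      ultimately show ?thesis by (simp add: has_vector_derivative_def)
    qed
    have hi: "((\<lambda>x. ((1 - x) ^ (p - 1) / fact (p - 1)) *\<^sub>R Df p x) has_integral
        (Df 0 1 - (\<Sum>i<p. ((1 - 0) ^ i / fact i) *\<^sub>R Df i 0))) {0..1}"
      using Df by (intro Taylor_has_integral[OF p]) auto
    have "norm (Df 0 1 - (\<Sum>i<p. ((1 - 0) ^ i / fact i) *\<^sub>R Df i 0)) \<le> (C * norm z ^ p) * measure lborel {0..1::real}"
    proof (rule has_integral_bound_real[OF _ _ hi])
      show "finite {}" by simp
      show "0 \<le> C * norm z ^ p" using C by simp
      fix x :: real assume "x \<in> {0..1} - {}"
      then have x: "0 \<le> x" "x \<le> 1" by auto
      have "\<bar>(1 - x) ^ (p - 1) / fact (p - 1)\<bar> \<le> 1"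
      proof -
        have "(1 - x) ^ (p - 1) \<le> 1" using x by (intro power_le_one) auto
        also have "1 \<le> (fact (p - 1) :: real)" by (rule fact_ge_1)
        finally show ?thesis using x by (simp add: abs_mult)
      qed
      then have "norm (((1 - x) ^ (p - 1) / fact (p - 1)) *\<^sub>R Df p x) \<le> 1 * norm (Df p x)"
        unfolding norm_scaleR by (intro mult_right_mono) auto
      also have "\<dots> \<le> C * norm z ^ p"
        using C(2)[OF mem[OF x]] by (simp add: Df_def)
      finally show "norm (((1 - x) ^ (p - 1) / fact (p - 1)) *\<^sub>R Df p x) \<le> C * norm z ^ p" .
    qed
    then show ?thesis by (simp add: Df_def)
  qed
  then show ?thesis using C(1) by blast
qed

lemma iterd_uminus:
  assumes S: "open S" and f: "Ck_on k S f" and x: "x \<in> S"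
  shows "iterd (- v) k f x = (- 1) ^ k *\<^sub>R iterd v k f x"
  using f
proof (induction k arbitrary: f)
  case (Suc k)
  have "iterd (- v) (Suc k) f x = iterd (- v) k (\<lambda>x. \<Sum>i\<in>{()}. (- 1) *\<^sub>R dird v f x) x"
    unfolding iterd_Suc
    using dird_scaleR[OF Ck_on_differentiable[OF Suc.prems], of _ "-1" v]
    by (intro iterd_cong[OF S _ x]) auto
  also have "\<dots> = (- 1) *\<^sub>R iterd (- v) k (dird v f) x"
    using iterd_sum[OF S, of "{()}" k "\<lambda>_. dird v f" x "-v" "\<lambda>_. - 1"] Ck_on_dird[OF Suc.prems] x by simp
  also have "\<dots> = (- 1) ^ Suc k *\<^sub>R iterd v (Suc k) f x"
    using Suc.IH[OF Ck_on_dird[OF Suc.prems, of v]] by (simp add: iterd_Suc del: funpow.simps)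
  finally show ?case .
qed simp

text \<open>The even part is expanded up to the fourth order and the odd part up to the third, although only two
derivatives appear: the missing terms cancel between \<open>z\<close> and \<open>- z\<close>.\<close>

lemma taylor_even_odd:
  fixes f :: "'a::euclidean_space \<Rightarrow> 'b::banach"
  assumes S: "open S" and ball: "cball a \<rho> \<subseteq> S" and \<rho>: "0 \<le> \<rho>" and f: "smooth_map_on S f"
  shows "\<exists>C\<ge>0. \<forall>z. norm z \<le> \<rho> \<longrightarrow>
     norm (f (a + z) - f a) \<le> C * norm z \<and>
     norm (f (a + z) - f a - dird z f a) \<le> C * norm z ^ 2 \<and>
     norm ((1/2) *\<^sub>R (f (a + z) + f (a - z)) - f a - (1/2) *\<^sub>R dird z (dird z f) a) \<le> C * norm z ^ 4 \<and>
     norm ((1/2) *\<^sub>R (f (a + z) - f (a - z)) - dird z f a) \<le> C * norm z ^ 3"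
proof -
  have ck: "Ck_on k S f" for k using f by (simp add: smooth_map_on_def)
  have a: "a \<in> S" using ball \<rho> by auto
  define T where "T = (\<lambda>p z. \<Sum>i<p. (1 / fact i) *\<^sub>R iterd z i f a)"
  have "\<forall>p. \<exists>C. 0 < p \<longrightarrow> C \<ge> 0 \<and> (\<forall>z. norm z \<le> \<rho> \<longrightarrow> norm (f (a + z) - T p z) \<le> C * norm z ^ p)"
    unfolding T_def using taylor_bound[OF S ball ck] by blast
  then obtain C where C: "\<And>p. 0 < p \<Longrightarrow> C p \<ge> 0" "\<And>p z. 0 < p \<Longrightarrow> norm z \<le> \<rho> \<Longrightarrow> norm (f (a + z) - T p z) \<le> C p * norm z ^ p"
    by metis
  have T2: "T 2 z = f a + dird z f a" for z by (simp add: T_def numeral_2_eq_2)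
  have neg: "iterd (- z) i f a = (- 1) ^ i *\<^sub>R iterd z i f a" for z i
    by (rule iterd_uminus[OF S ck a])
  have T3: "(1/2) *\<^sub>R (T 3 z - T 3 (- z)) = dird z f a" for z
    unfolding T_def neg by (simp add: numeral_3_eq_3 algebra_simps)
      (simp flip: scaleR_left_distrib)
  have T4: "(1/2) *\<^sub>R (T 4 z + T 4 (- z)) = f a + (1/2) *\<^sub>R dird z (dird z f) a" for z
    unfolding T_def neg by (simp add: eval_nat_numeral algebra_simps)
      (simp add: add.assoc[symmetric] flip: scaleR_left_distrib)
  define M where "M = C 1 + C 2 + C 3 + C 4"
  have M: "C 1 \<le> M" "C 2 \<le> M" "C 3 \<le> M" "C 4 \<le> M" "0 \<le> M"
    using C(1)[of 1] C(1)[of 2] C(1)[of 3] C(1)[of 4] by (auto simp: M_def)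
  have "norm (f (a + z) - f a) \<le> M * norm z"
      "norm (f (a + z) - f a - dird z f a) \<le> M * norm z ^ 2"
      "norm ((1/2) *\<^sub>R (f (a + z) + f (a - z)) - f a - (1/2) *\<^sub>R dird z (dird z f) a) \<le> M * norm z ^ 4"
      "norm ((1/2) *\<^sub>R (f (a + z) - f (a - z)) - dird z f a) \<le> M * norm z ^ 3" if z: "norm z \<le> \<rho>" for z
  proof -
    have "norm (f (a + z) - f a) \<le> C 1 * norm z"
      using C(2)[of 1, OF _ z] by (simp add: T_def)
    also have "\<dots> \<le> M * norm z" using M by (intro mult_right_mono) auto
    finally show "norm (f (a + z) - f a) \<le> M * norm z" .
    have "norm (f (a + z) - f a - dird z f a) \<le> C 2 * norm z ^ 2"
      using C(2)[of 2, OF _ z] by (simp add: T2 algebra_simps)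
    also have "\<dots> \<le> M * norm z ^ 2" using M by (intro mult_right_mono) auto
    finally show "norm (f (a + z) - f a - dird z f a) \<le> M * norm z ^ 2" .
    have b: "norm (f (a + z) - T p z) \<le> C p * norm z ^ p" "norm (f (a - z) - T p (- z)) \<le> C p * norm z ^ p" if "0 < p" for p
      using C(2)[OF that z] C(2)[OF that, of "- z"] z by auto
    have "(1/2) *\<^sub>R (f (a + z) + f (a - z)) - f a - (1/2) *\<^sub>R dird z (dird z f) a
        = (1/2) *\<^sub>R ((f (a + z) - T 4 z) + (f (a - z) - T 4 (- z)))"
      using T4[of z] by (simp add: algebra_simps)
    also have "norm \<dots> \<le> C 4 * norm z ^ 4"
      using b[of 4] norm_triangle_ineq[of "f (a + z) - T 4 z" "f (a - z) - T 4 (- z)"] by simp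
    also have "\<dots> \<le> M * norm z ^ 4" using M by (intro mult_right_mono) auto
    finally show "norm ((1/2) *\<^sub>R (f (a + z) + f (a - z)) - f a - (1/2) *\<^sub>R dird z (dird z f) a) \<le> M * norm z ^ 4" .
    have "(1/2) *\<^sub>R (f (a + z) - f (a - z)) - dird z f a
        = (1/2) *\<^sub>R ((f (a + z) - T 3 z) - (f (a - z) - T 3 (- z)))"
      using T3[of z] by (simp add: algebra_simps)
    also have "norm \<dots> \<le> C 3 * norm z ^ 3"
      using b[of 3] norm_triangle_ineq4[of "f (a + z) - T 3 z" "f (a - z) - T 3 (- z)"] by simp
    also have "\<dots> \<le> M * norm z ^ 3" using M by (intro mult_right_mono) auto
    finally show "norm ((1/2) *\<^sub>R (f (a + z) - f (a - z)) - dird z f a) \<le> M * norm z ^ 3" .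
  qed
  then show ?thesis using M(5) by blast
qed

lemma line_norm_bound:
  fixes g :: "real \<Rightarrow> 'b::real_normed_vector"
  assumes "0 \<le> s" and "\<And>t. 0 \<le> t \<Longrightarrow> t \<le> s \<Longrightarrow> (g has_vector_derivative g' t) (at t)"
    and "\<And>t. 0 \<le> t \<Longrightarrow> t \<le> s \<Longrightarrow> norm (g' t) \<le> B"
  shows "norm (g s - g 0) \<le> B * s"
proof -
  have "norm (g s - g 0) \<le> B * norm (s - 0)"
  proof (rule differentiable_bound[where S = "{0..s}" and f' = "\<lambda>t h. h *\<^sub>R g' t"])
    fix t assume "t \<in> {0..s}"
    then show "(g has_derivative (\<lambda>h. h *\<^sub>R g' t)) (at t within {0..s})"
      using assms(2)[of t] by (auto simp: has_vector_derivative_def intro: has_derivative_at_withinI)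
    show "onorm (\<lambda>h. h *\<^sub>R g' t) \<le> B"
      using assms(3)[of t] \<open>t \<in> {0..s}\<close> by (intro onorm_le) (simp add: mult.commute[of B] mult_left_mono)
  qed (use assms(1) in auto)
  then show ?thesis using assms(1) by simp
qed

lemma line_has_vector_derivative:
  assumes "f differentiable (at (a + t *\<^sub>R u))"
  shows "((\<lambda>t. f (a + t *\<^sub>R u)) has_vector_derivative dird u f (a + t *\<^sub>R u)) (at t)"
proof -
  have "((\<lambda>t. a + t *\<^sub>R u) has_derivative (\<lambda>h. h *\<^sub>R u)) (at t)"
    by (auto intro!: derivative_eq_intros)
  from has_derivative_compose[OF this differentiable_dird[OF assms]] show ?thesis
    by (simp add: has_vector_derivative_def dird_scaleR[OF assms])
qed

text \<open>The mean value inequality twice, first in the direction \<open>v\<close> and then in the direction \<open>u\<close>, applied to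
the second difference from which its expected value is subtracted; continuity of the mixed derivative
makes the remaining derivative small.\<close>

lemma second_difference_bound:
  fixes f :: "'a::euclidean_space \<Rightarrow> 'b::real_normed_vector"
  assumes S: "open S" "a \<in> S" and f: "Ck_on 2 S f" and e: "0 < e"
  shows "\<exists>d>0. \<forall>s. 0 < s \<and> s < d \<longrightarrow>
    norm (f (a + s *\<^sub>R u + s *\<^sub>R v) - f (a + s *\<^sub>R u) - f (a + s *\<^sub>R v) + f a
          - (s * s) *\<^sub>R dird u (dird v f) a) \<le> e * (s * s)"
proof -
  let ?B = "dird u (dird v f) a"
  have f2: "Ck_on (Suc (Suc 0)) S f" using f by (simp add: numeral_2_eq_2)
  have df: "f differentiable (at x)" if "x \<in> S" for x using Ck_on_differentiable[OF f2 that] .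
  have ddf: "dird v f differentiable (at x)" if "x \<in> S" for x
    using Ck_on_differentiable[OF Ck_on_dird[OF f2] that] .
  have "continuous_on S (dird u (dird v f))"
    using Ck_on_dird[OF Ck_on_dird[OF f2]] by simp
  then obtain d0 where d0: "d0 > 0" "\<And>x. x \<in> S \<Longrightarrow> dist x a < d0 \<Longrightarrow> dist (dird u (dird v f) x) ?B < e"
    using S e unfolding continuous_on_iff by metis
  obtain d1 where d1: "d1 > 0" "ball a d1 \<subseteq> S" using S openE by blast
  \<comment> \<open>keeps the parallelogram with sides \<open>s u\<close>, \<open>s v\<close> inside both neighbourhoods of \<open>a\<close>\<close>
  define d where "d = min d0 d1 / (norm u + norm v + 1)"
  have pos: "0 < norm u + norm v + 1" by (simp add: add_nonneg_pos)
  have d: "d > 0" using d0 d1 pos by (simp add: d_def)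
  have "norm (f (a + s *\<^sub>R u + s *\<^sub>R v) - f (a + s *\<^sub>R u) - f (a + s *\<^sub>R v) + f a - (s * s) *\<^sub>R ?B) \<le> e * (s * s)"
    if s: "0 < s" "s < d" for s
  proof -
    have near: "dist (a + t *\<^sub>R v + \<sigma> *\<^sub>R u) a < min d0 d1" if "0 \<le> t" "t \<le> s" "0 \<le> \<sigma>" "\<sigma> \<le> s" for t \<sigma>
    proof -
      have "dist (a + t *\<^sub>R v + \<sigma> *\<^sub>R u) a \<le> t * norm v + \<sigma> * norm u"
        using that norm_triangle_ineq[of "t *\<^sub>R v" "\<sigma> *\<^sub>R u"] by (simp add: dist_norm add.assoc)
      also have "\<dots> \<le> s * norm v + s * norm u"
        using that by (intro add_mono mult_right_mono) auto
      also have "\<dots> \<le> s * (norm u + norm v + 1)" using s by (simp add: algebra_simps)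
      also have "\<dots> < d * (norm u + norm v + 1)" using s pos by (intro mult_strict_right_mono) auto
      finally show ?thesis using pos by (simp add: d_def)
    qed
    then have inS: "a + t *\<^sub>R v + \<sigma> *\<^sub>R u \<in> S" if "0 \<le> t" "t \<le> s" "0 \<le> \<sigma>" "\<sigma> \<le> s" for t \<sigma>
      using d1 that by (auto simp: dist_commute)
    define g where "g = (\<lambda>t. f ((a + s *\<^sub>R u) + t *\<^sub>R v) - f (a + t *\<^sub>R v) - (t * s) *\<^sub>R ?B)"
    define g' where "g' = (\<lambda>t. dird v f ((a + s *\<^sub>R u) + t *\<^sub>R v) - dird v f (a + t *\<^sub>R v) - s *\<^sub>R ?B)"
    have "norm (g s - g 0) \<le> (e * s) * s"
    proof (rule line_norm_bound)
      fix t assume t: "0 \<le> t" "t \<le> s"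
      show "(g has_vector_derivative g' t) (at t)"
        unfolding g_def g'_def
      proof (intro has_vector_derivative_diff line_has_vector_derivative df)
        show "a + s *\<^sub>R u + t *\<^sub>R v \<in> S" using inS[of t s] t s by (simp add: ac_simps)
        show "a + t *\<^sub>R v \<in> S" using inS[of t 0] t s by simp
        show "((\<lambda>t. (t * s) *\<^sub>R ?B) has_vector_derivative s *\<^sub>R ?B) (at t)"
          by (auto intro!: derivative_eq_intros simp: has_vector_derivative_def)
      qed
      define k where "k = (\<lambda>\<sigma>. dird v f ((a + t *\<^sub>R v) + \<sigma> *\<^sub>R u) - \<sigma> *\<^sub>R ?B)"
      have "norm (k s - k 0) \<le> e * s"
      proof (rule line_norm_bound)
        fix \<sigma> assume \<sigma>: "0 \<le> \<sigma>" "\<sigma> \<le> s"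
        show "(k has_vector_derivative dird u (dird v f) ((a + t *\<^sub>R v) + \<sigma> *\<^sub>R u) - ?B) (at \<sigma>)"
          unfolding k_def
        proof (intro has_vector_derivative_diff line_has_vector_derivative ddf)
          show "((\<lambda>t. t *\<^sub>R ?B) has_vector_derivative ?B) (at \<sigma>)"
            by (auto intro!: derivative_eq_intros simp: has_vector_derivative_def)
        qed (use inS t \<sigma> in auto)
        show "norm (dird u (dird v f) ((a + t *\<^sub>R v) + \<sigma> *\<^sub>R u) - ?B) \<le> e"
          using d0(2)[OF inS[OF t \<sigma>]] near[OF t \<sigma>] by (simp add: dist_norm)
      qed (use s in auto)
      then show "norm (g' t) \<le> e * s" by (simp add: k_def g'_def algebra_simps)
    qed (use s in auto)
    then show ?thesis by (simp add: g_def algebra_simps)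
  qed
  then show ?thesis using d by blast
qed

text \<open>The second difference is symmetric in \<open>u\<close> and \<open>v\<close>, so both mixed derivatives are limits of the same
quotient.\<close>

lemma dird_commute:
  fixes f :: "'a::euclidean_space \<Rightarrow> 'b::real_normed_vector"
  assumes S: "open S" "a \<in> S" and f: "Ck_on 2 S f"
  shows "dird u (dird v f) a = dird v (dird u f) a"
proof -
  let ?X = "dird u (dird v f) a" and ?Y = "dird v (dird u f) a"
  have "norm (?X - ?Y) \<le> e" if "e > 0" for e
  proof -
    have e2: "e / 2 > 0" using that by simp
    obtain d1 where d1: "d1 > 0" "\<And>s. 0 < s \<Longrightarrow> s < d1 \<Longrightarrow>
      norm (f (a + s *\<^sub>R u + s *\<^sub>R v) - f (a + s *\<^sub>R u) - f (a + s *\<^sub>R v) + f a - (s * s) *\<^sub>R ?X) \<le> e / 2 * (s * s)"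
      using second_difference_bound[OF assms e2] by metis
    obtain d2 where d2: "d2 > 0" "\<And>s. 0 < s \<Longrightarrow> s < d2 \<Longrightarrow>
      norm (f (a + s *\<^sub>R v + s *\<^sub>R u) - f (a + s *\<^sub>R v) - f (a + s *\<^sub>R u) + f a - (s * s) *\<^sub>R ?Y) \<le> e / 2 * (s * s)"
      using second_difference_bound[OF assms e2] by metis
    define s where "s = min d1 d2 / 2"
    have s: "0 < s" "s < d1" "s < d2" using d1(1) d2(1) by (auto simp: s_def)
    define D where "D = f (a + s *\<^sub>R u + s *\<^sub>R v) - f (a + s *\<^sub>R u) - f (a + s *\<^sub>R v) + f a"
    have "norm (D - (s * s) *\<^sub>R ?X) \<le> e / 2 * (s * s)" using d1(2)[OF s(1,2)] by (simp add: D_def)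
    moreover have "norm (D - (s * s) *\<^sub>R ?Y) \<le> e / 2 * (s * s)" using d2(2)[OF s(1,3)] by (simp add: D_def algebra_simps)
    moreover have "norm ((s * s) *\<^sub>R (?X - ?Y)) \<le> norm (D - (s * s) *\<^sub>R ?Y) + norm (D - (s * s) *\<^sub>R ?X)"
      using norm_triangle_ineq4[of "D - (s * s) *\<^sub>R ?Y" "D - (s * s) *\<^sub>R ?X"] by (simp add: algebra_simps)
    ultimately have "norm ((s * s) *\<^sub>R (?X - ?Y)) \<le> e / 2 * (s * s) + e / 2 * (s * s)" by linarith
    moreover have "norm ((s * s) *\<^sub>R (?X - ?Y)) = (s * s) * norm (?X - ?Y)" by simp
    ultimately have "(s * s) * norm (?X - ?Y) \<le> (s * s) * e" by (simp add: mult.commute)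
    then show ?thesis using s(1) by (simp add: mult_le_cancel_left)
  qed
  then have "norm (?X - ?Y) \<le> 0" by (rule field_le_epsilon[of _ 0, simplified])
  then show ?thesis by simp
qed


section \<open>Wirtinger derivatives and the Levi form\<close>

lemma wirtinger_dird: "wirtinger j f w = (dird (axis j 1) f w - \<i> * dird (axis j \<i>) f w) / 2"
  and wirtinger_bar_dird: "wirtinger_bar j f w = (dird (axis j 1) f w + \<i> * dird (axis j \<i>) f w) / 2"
  unfolding wirtinger_def wirtinger_bar_def dird_def by (rule refl)+

lemma dird_axis_expansion:
  fixes f :: "complex^'n::finite \<Rightarrow> complex"
  assumes "f differentiable (at w)"
  shows "dird v f w = (\<Sum>j\<in>UNIV. of_real (Re (v $ j)) * dird (axis j 1) f w + of_real (Im (v $ j)) * dird (axis j \<i>) f w)"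
proof -
  have "(Re (v $ j) *\<^sub>R axis j 1 + Im (v $ j) *\<^sub>R axis j \<i> :: complex^'n) $ i = (if j = i then v $ i else 0)" for i j
    by (cases "j = i") (auto simp: axis_def complex_eq_iff)
  then have "v = (\<Sum>j\<in>UNIV. Re (v $ j) *\<^sub>R axis j 1 + Im (v $ j) *\<^sub>R axis j \<i>)"
    by (simp add: vec_eq_iff del: vector_add_component)
  then have "dird v f w = dird (\<Sum>j\<in>UNIV. Re (v $ j) *\<^sub>R axis j 1 + Im (v $ j) *\<^sub>R axis j \<i>) f w"
    by simp
  also have "\<dots> = (\<Sum>j\<in>UNIV. dird (Re (v $ j) *\<^sub>R axis j 1 + Im (v $ j) *\<^sub>R axis j \<i>) f w)"
    by (rule linear_sum[OF has_derivative_linear[OF differentiable_dird[OF assms]]])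
  also have "\<dots> = (\<Sum>j\<in>UNIV. of_real (Re (v $ j)) * dird (axis j 1) f w + of_real (Im (v $ j)) * dird (axis j \<i>) f w)"
    by (simp add: dird_add[OF assms] dird_scaleR[OF assms] scaleR_conv_of_real[where 'a=complex])
  finally show ?thesis .
qed

text \<open>The real derivative in the direction \<open>z\<close> is the sum of a complex linear and a conjugate linear
function of \<open>z\<close>; the Wirtinger derivatives are the coefficients of the two parts.\<close>

lemma wirtinger_sum:
  fixes f :: "complex^'n::finite \<Rightarrow> complex"
  assumes "f differentiable (at w)"
  shows "(\<Sum>j\<in>UNIV. z $ j * wirtinger j f w) = (dird z f w - \<i> * dird (\<i> *s z) f w) / 2"
    and wirtinger_bar_sum: "(\<Sum>j\<in>UNIV. cnj (z $ j) * wirtinger_bar j f w) = (dird z f w + \<i> * dird (\<i> *s z) f w) / 2"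
proof -
  define A where "A v j = of_real (Re (v $ j)) * dird (axis j 1) f w + of_real (Im (v $ j)) * dird (axis j \<i>) f w" for v :: "complex^'n" and j
  have A: "dird v f w = (\<Sum>j\<in>UNIV. A v j)" for v
    unfolding A_def by (rule dird_axis_expansion[OF assms])
  have "z $ j * wirtinger j f w = (A z j - \<i> * A (\<i> *s z) j) / 2"
      "cnj (z $ j) * wirtinger_bar j f w = (A z j + \<i> * A (\<i> *s z) j) / 2" for j
    unfolding wirtinger_dird wirtinger_bar_dird A_def
    by (subst (1) complex_eq[of "z $ j"], simp add: algebra_simps)+
  then show "(\<Sum>j\<in>UNIV. z $ j * wirtinger j f w) = (dird z f w - \<i> * dird (\<i> *s z) f w) / 2"
    and "(\<Sum>j\<in>UNIV. cnj (z $ j) * wirtinger_bar j f w) = (dird z f w + \<i> * dird (\<i> *s z) f w) / 2"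
    unfolding A by (simp_all only: sum_divide_distrib[symmetric] sum_subtractf sum.distrib sum_distrib_left[symmetric])
qed

lemma wirtinger_bar_cong:
  assumes "open S" "x \<in> S" "\<And>y. y \<in> S \<Longrightarrow> f y = g y"
  shows "wirtinger_bar k f x = wirtinger_bar k g x"
  unfolding wirtinger_bar_dird by (simp only: dird_cong[OF assms])

lemma dird_cnj:
  assumes "f differentiable (at z)"
  shows "dird v (\<lambda>w. cnj (f w)) z = cnj (dird v f z)"
  by (rule dirdI[where D = "\<lambda>v. cnj (dird v f z)"])
    (rule bounded_linear.has_derivative[OF bounded_linear_cnj differentiable_dird[OF assms]])

lemma dird_complex_linear_combination:
  fixes f g :: "'a::real_normed_vector \<Rightarrow> complex"
  assumes "f differentiable (at x)" "g differentiable (at x)"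
  shows "dird v (\<lambda>w. c * f w + d * g w) x = c * dird v f x + d * dird v g x"
    and "(\<lambda>w. c * f w + d * g w) differentiable (at x)"
proof -
  have D: "((\<lambda>w. c * f w + d * g w) has_derivative (\<lambda>v. c * dird v f x + d * dird v g x)) (at x)"
    by (intro derivative_intros differentiable_dird assms)
  show "dird v (\<lambda>w. c * f w + d * g w) x = c * dird v f x + d * dird v g x"
    by (rule dirdI[OF D])
  show "(\<lambda>w. c * f w + d * g w) differentiable (at x)"
    using D by (auto simp: differentiable_def)
qed

lemma dird_sum_cmult:
  fixes f :: "'i \<Rightarrow> 'a::real_normed_vector \<Rightarrow> complex"
  assumes "\<And>i. i \<in> I \<Longrightarrow> f i differentiable (at x)"
  shows "dird v (\<lambda>w. \<Sum>i\<in>I. c i * f i w) x = (\<Sum>i\<in>I. c i * dird v (f i) x)"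
proof (rule dirdI[where D = "\<lambda>v. \<Sum>i\<in>I. c i * dird v (f i) x"])
  show "((\<lambda>w. \<Sum>i\<in>I. c i * f i w) has_derivative (\<lambda>v. \<Sum>i\<in>I. c i * dird v (f i) x)) (at x)"
    by (rule has_derivative_sum) (rule has_derivative_mult_right[OF differentiable_dird[OF assms]])
qed

lemma wirtinger_bar_sum_cmult:
  fixes f :: "'i \<Rightarrow> complex^'n::finite \<Rightarrow> complex"
  assumes "\<And>i. i \<in> I \<Longrightarrow> f i differentiable (at x)"
  shows "wirtinger_bar k (\<lambda>w. \<Sum>i\<in>I. c i * f i w) x = (\<Sum>i\<in>I. c i * wirtinger_bar k (f i) x)"
proof -
  have d: "dird v (\<lambda>w. \<Sum>i\<in>I. c i * f i w) x = (\<Sum>i\<in>I. c i * dird v (f i) x)" for v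
    using assms by (rule dird_sum_cmult)
  show ?thesis
  proof -
    have "c i * wirtinger_bar k (f i) x = (c i * dird (axis k 1) (f i) x + \<i> * (c i * dird (axis k \<i>) (f i) x)) / 2" for i
      by (simp add: wirtinger_bar_dird algebra_simps)
    then show ?thesis
      unfolding wirtinger_bar_dird[of k "\<lambda>w. \<Sum>i\<in>I. c i * f i w"] d
      by (simp only: sum_divide_distrib[symmetric] sum.distrib sum_distrib_left[symmetric])
  qed
qed

text \<open>By \<open>wirtinger_sum\<close> and \<open>wirtinger_bar_sum\<close> the left-hand side is
\<open>(D\<^sub>z + \<i> D\<^sub>i\<^sub>z) (D\<^sub>z - \<i> D\<^sub>i\<^sub>z) f / 4\<close>, and the mixed terms cancel since the derivatives commute.\<close>

lemma levi_form_eq: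
  fixes f :: "complex^'n::finite \<Rightarrow> complex"
  assumes S: "open S" "a \<in> S" and f: "Ck_on 2 S f"
  shows "(\<Sum>j\<in>UNIV. \<Sum>k\<in>UNIV. z $ j * cnj (z $ k) * wirtinger_bar k (wirtinger j f) a)
       = (dird z (dird z f) a + dird (\<i> *s z) (dird (\<i> *s z) f) a) / 4"
proof -
  have f2: "Ck_on (Suc (Suc 0)) S f" using f by (simp add: numeral_2_eq_2)
  have df: "f differentiable (at x)" if "x \<in> S" for x using Ck_on_differentiable[OF f2 that] .
  have ddf: "dird v f differentiable (at x)" if "x \<in> S" for x v
    using Ck_on_differentiable[OF Ck_on_dird[OF f2] that] .
  have dw: "wirtinger j f differentiable (at a)" for j
  proof -
    have "wirtinger j f = (\<lambda>w. (1/2) * dird (axis j 1) f w + (- \<i> / 2) * dird (axis j \<i>) f w)"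
      by (auto simp: wirtinger_dird field_simps)
    then show ?thesis
      by (simp only:) (rule dird_complex_linear_combination(2)[OF ddf[OF S(2)] ddf[OF S(2)]])
  qed
  define F where "F = (\<lambda>w. (1/2) * dird z f w + (- \<i> / 2) * dird (\<i> *s z) f w)"
  have F: "(\<Sum>j\<in>UNIV. z $ j * wirtinger j f w) = F w" if "w \<in> S" for w
    using wirtinger_sum[OF df[OF that], of z] by (simp add: F_def field_simps)
  have dF: "F differentiable (at a)"
    unfolding F_def by (rule dird_complex_linear_combination(2)[OF ddf[OF S(2)] ddf[OF S(2)]])
  have dF2: "dird v F a = (1/2) * dird v (dird z f) a + (- \<i> / 2) * dird v (dird (\<i> *s z) f) a" for v
    unfolding F_def by (rule dird_complex_linear_combination(1)[OF ddf[OF S(2)] ddf[OF S(2)]])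
  have "(\<Sum>j\<in>UNIV. \<Sum>k\<in>UNIV. z $ j * cnj (z $ k) * wirtinger_bar k (wirtinger j f) a)
      = (\<Sum>k\<in>UNIV. cnj (z $ k) * (\<Sum>j\<in>UNIV. z $ j * wirtinger_bar k (wirtinger j f) a))"
    by (subst sum.swap) (simp add: sum_distrib_left mult_ac)
  also have "\<dots> = (\<Sum>k\<in>UNIV. cnj (z $ k) * wirtinger_bar k F a)"
  proof -
    have "(\<Sum>j\<in>UNIV. z $ j * wirtinger_bar k (wirtinger j f) a) = wirtinger_bar k (\<lambda>w. \<Sum>j\<in>UNIV. z $ j * wirtinger j f w) a" for k
      using dw by (intro wirtinger_bar_sum_cmult[symmetric])
    moreover have "wirtinger_bar k (\<lambda>w. \<Sum>j\<in>UNIV. z $ j * wirtinger j f w) a = wirtinger_bar k F a" for k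
      by (rule wirtinger_bar_cong[OF S F])
    ultimately show ?thesis by simp
  qed
  also have "\<dots> = (dird z F a + \<i> * dird (\<i> *s z) F a) / 2"
    by (rule wirtinger_bar_sum[OF dF])
  also have "\<dots> = (dird z (dird z f) a + dird (\<i> *s z) (dird (\<i> *s z) f) a) / 4"
    unfolding dF2 dird_commute[OF S f, of "\<i> *s z" z] by (simp add: algebra_simps add_divide_distrib diff_divide_distrib)
  finally show ?thesis .
qed


section \<open>Sesquilinear forms and matrix inverses\<close>

text \<open>\<open>t\<^sup>* M s\<close>, the Hermitian product of \<open>M s\<close> with \<open>t\<close>: linear in \<open>s\<close> and conjugate linear in \<open>t\<close>. With a
Gram matrix for \<open>M\<close> it is the metric expressed in coefficient vectors.\<close>

definition sesq :: "complex^'m::finite^'m \<Rightarrow> complex^'m \<Rightarrow> complex^'m \<Rightarrow> complex" where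
  "sesq M s t = (\<Sum>\<alpha>\<in>UNIV. cnj (t $ \<alpha>) * (M *v s) $ \<alpha>)"

lemma sesq_entries: "sesq M s t = (\<Sum>\<alpha>\<in>UNIV. \<Sum>\<beta>\<in>UNIV. cnj (t $ \<alpha>) * (M $ \<alpha> $ \<beta> * s $ \<beta>))"
  by (simp add: sesq_def matrix_vector_mult_def sum_distrib_left)

lemma sesq_add_left: "sesq M (s + s') t = sesq M s t + sesq M s' t"
  by (simp add: sesq_def matrix_vector_right_distrib distrib_left sum.distrib)

lemma sesq_add_right: "sesq M s (t + t') = sesq M s t + sesq M s t'"
  by (simp add: sesq_def distrib_right sum.distrib)

lemma sesq_add_matrix: "sesq (M + M') s t = sesq M s t + sesq M' s t"
  by (simp add: sesq_def matrix_vector_mult_add_rdistrib distrib_left sum.distrib)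

lemma sesq_smult_left: "sesq M (c *s s) t = c * sesq M s t"
  by (simp add: sesq_def vector_scalar_commute sum_distrib_left mult_ac)

lemma sesq_smult_right: "sesq M s (c *s t) = cnj c * sesq M s t"
  by (simp add: sesq_def sum_distrib_left mult_ac)

lemma sesq_uminus_left: "sesq M (- s) t = - sesq M s t"
  using sesq_smult_left[of M "-1" s t] by simp

lemma sesq_diff_matrix: "sesq (M - M') s t = sesq M s t - sesq M' s t"
  using sesq_add_matrix[of "M - M'" M' s t] by simp

lemma sesq_0_left [simp]: "sesq M 0 t = 0"
  by (simp add: sesq_def)

lemma sesq_sum_left: "sesq M (\<Sum>i\<in>I. f i) t = (\<Sum>i\<in>I. sesq M (f i) t)"
  by (induction I rule: infinite_finite_induct) (auto simp: sesq_add_left)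

lemma sesq_scaleR: "sesq (c *\<^sub>R M) s t = of_real c * sesq M s t"
  by (simp add: sesq_entries sum_distrib_left scaleR_conv_of_real[where 'a=complex] mult_ac)

lemma sesq_diff_left: "sesq M (s - s') t = sesq M s t - sesq M s' t"
  using sesq_add_left[of M "s - s'" s' t] by simp

lemma sesq_diff_right: "sesq M s (t - t') = sesq M s t - sesq M s t'"
  using sesq_add_right[of M s "t - t'" t'] by simp

lemma sesq_sum_right: "sesq M s (\<Sum>i\<in>I. f i) = (\<Sum>i\<in>I. sesq M s (f i))"
proof (induction I rule: infinite_finite_induct)
  case empty
  show ?case by (simp add: sesq_def)
qed (simp_all add: sesq_add_right, simp add: sesq_def)

lemma sesq_mat_1: "sesq (mat 1) v v = of_real ((norm v)\<^sup>2)"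
proof -
  have "cnj c * c = complex_of_real ((cmod c)\<^sup>2)" for c
    by (simp only: complex_norm_square mult.commute)
  then show ?thesis
    by (simp add: sesq_def norm_vec_def L2_set_def sum_nonneg del: of_real_power)
qed

lemma sesq_adjoint:
  assumes "\<And>\<alpha> \<beta>. M' $ \<beta> $ \<alpha> = cnj (M $ \<alpha> $ \<beta>)"
  shows "sesq M' s t = cnj (sesq M t s)"
  unfolding sesq_entries by (subst sum.swap) (simp add: assms mult_ac)

lemma sesq_bound:
  fixes s t :: "complex^'m::finite"
  assumes "\<And>\<alpha> \<beta>. cmod (M $ \<alpha> $ \<beta>) \<le> K"
  shows "cmod (sesq M s t) \<le> (real CARD('m))\<^sup>2 * K * norm s * norm t"
proof -
  have "cmod (sesq M s t) \<le> (\<Sum>\<alpha>\<in>(UNIV::'m set). \<Sum>\<beta>\<in>(UNIV::'m set). norm t * (K * norm s))"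
    unfolding sesq_entries
  proof (intro sum_norm_le)
    fix \<alpha> \<beta> :: 'm
    have "0 \<le> K" using assms[of \<alpha> \<beta>] norm_ge_zero order_trans by blast
    then show "cmod (cnj (t $ \<alpha>) * (M $ \<alpha> $ \<beta> * s $ \<beta>)) \<le> norm t * (K * norm s)"
      unfolding norm_mult complex_mod_cnj using assms Finite_Cartesian_Product.norm_nth_le
      by (intro mult_mono) auto
  qed
  then show ?thesis by (simp add: power2_eq_square mult_ac)
qed

lemma sesq_bound_le:
  fixes s t :: "complex^'m::finite"
  assumes M: "\<And>\<alpha> \<beta>. cmod (M $ \<alpha> $ \<beta>) \<le> K" and "norm s \<le> S" "norm t \<le> T"
  shows "cmod (sesq M s t) \<le> (real CARD('m))\<^sup>2 * K * S * T"
proof -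
  have K: "0 \<le> K" using M norm_ge_zero order_trans by blast
  note sesq_bound[OF M]
  also have "(real CARD('m))\<^sup>2 * K * norm s * norm t \<le> (real CARD('m))\<^sup>2 * K * S * T"
    using K assms(2,3) order_trans[OF norm_ge_zero assms(2)] by (intro mult_mono) auto
  finally show ?thesis .
qed

lemma continuous_on_sesq [continuous_intros]:
  fixes M :: "'a::topological_space \<Rightarrow> complex^'m::finite^'m"
  assumes "continuous_on S M" "continuous_on S f" "continuous_on S g"
  shows "continuous_on S (\<lambda>z. sesq (M z) (f z) (g z))"
  unfolding sesq_entries by (intro continuous_intros assms)

lemma invertible_matrix_inv:
  assumes "invertible (A :: complex^'m::finite^'m)"
  shows "A ** matrix_inv A = mat 1"
  using someI_ex[OF assms[unfolded invertible_def]] by (simp add: matrix_inv_def)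

lemma matrix_inv_entry:
  fixes A :: "complex^'m::finite^'m"
  assumes "det A \<noteq> 0"
  shows "matrix_inv A $ k $ l = det (\<chi> i j. if j = k then (if i = l then 1 else 0) else A $ i $ j) / det A"
proof -
  have "invertible A" using assms by (simp add: invertible_det_nz)
  then have "A ** matrix_inv A = mat 1" by (rule invertible_matrix_inv)
  then have "(A ** matrix_inv A) $ i $ l = (if i = l then 1 else 0)" for i by (simp add: mat_def)
  then have "A *v column l (matrix_inv A) = (\<chi> i. if i = l then 1 else 0)"
    by (simp add: vec_eq_iff matrix_matrix_mult_def matrix_vector_mult_def column_def)
  then have "column l (matrix_inv A) = (\<chi> k. det (\<chi> i j. if j = k then (\<chi> i. if i = l then 1 else 0) $ i else A $ i $ j) / det A)"
    using cramer[OF assms] by blast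
  then show ?thesis by (simp add: column_def vec_eq_iff cong: if_cong)
qed

lemma differentiable_prod:
  fixes f :: "'i \<Rightarrow> 'a::real_normed_vector \<Rightarrow> complex"
  assumes "\<And>i. i \<in> I \<Longrightarrow> f i differentiable (at x0)"
  shows "(\<lambda>x. \<Prod>i\<in>I. f i x) differentiable (at x0)"
  using assms by (induction I rule: infinite_finite_induct) auto

lemma differentiable_det:
  fixes M :: "'a::real_normed_vector \<Rightarrow> complex^'m::finite^'m"
  assumes "\<And>i j. (\<lambda>x. M x $ i $ j) differentiable (at x0)"
  shows "(\<lambda>x. det (M x)) differentiable (at x0)"
  unfolding det_def
  by (intro differentiable_sum ballI differentiable_mult differentiable_prod differentiable_const assms)
    (simp add: finite_permutations)

text \<open>The entries of the inverse are quotients of determinants by Cramer's rule, and determinants are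
polynomials in the entries. Invertibility is required near \<open>a\<close> because the quotient represents
the inverse only there.\<close>

lemma differentiable_matrix_inv:
  fixes M :: "'a::real_normed_vector \<Rightarrow> complex^'m::finite^'m"
  assumes S: "open S" "a \<in> S" and M: "\<And>i j. (\<lambda>x. M x $ i $ j) differentiable (at a)"
    and inv: "\<And>x. x \<in> S \<Longrightarrow> invertible (M x)"
  shows "(\<lambda>x. matrix_inv (M x) $ k $ l) differentiable (at a)"
proof -
  have det: "det (M x) \<noteq> 0" if "x \<in> S" for x using inv[OF that] by (simp add: invertible_det_nz)
  define N where "N = (\<lambda>x. (\<chi> i j. if j = k then (if i = l then 1 else 0) else M x $ i $ j) :: complex^'m^'m)"
  have "(\<lambda>x. N x $ i $ j) differentiable (at a)" for i j
    by (cases "j = k") (auto simp: N_def M)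
  then have "(\<lambda>x. det (N x) / det (M x)) differentiable (at a)"
    using det[OF S(2)] by (intro differentiable_divide differentiable_det M) auto
  then obtain D where "((\<lambda>x. det (N x) / det (M x)) has_derivative D) (at a)"
    by (auto simp: differentiable_def)
  moreover have "det (N x) / det (M x) = matrix_inv (M x) $ k $ l" if "x \<in> S" for x
    using matrix_inv_entry[OF det[OF that]] by (simp add: N_def)
  ultimately have "((\<lambda>x. matrix_inv (M x) $ k $ l) has_derivative D) (at a)"
    using has_derivative_cong_open[OF S, of "\<lambda>x. det (N x) / det (M x)" "\<lambda>x. matrix_inv (M x) $ k $ l"] by blast
  then show ?thesis by (auto simp: differentiable_def)
qed

lemma matrix_vector_mult_minus: "(M :: complex^'m::finite^'k::finite) *v (- v) = - (M *v v)"
  by (simp add: vec_eq_iff matrix_vector_mult_def sum_negf)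

lemma matrix_vector_mult_sum: "(M :: complex^'m::finite^'k::finite) *v (\<Sum>i\<in>I. f i) = (\<Sum>i\<in>I. M *v f i)"
  by (induction I rule: infinite_finite_induct) (simp_all add: matrix_vector_right_distrib)

lemma sesquilinear_eq_sesq:
  fixes H :: "complex^'m::finite \<Rightarrow> complex^'m \<Rightarrow> complex"
  assumes add: "\<And>s s' t. H (s + s') t = H s t + H s' t"
    and smult: "\<And>c s t. H (c *s s) t = c * H s t"
    and sym: "\<And>s t. H t s = cnj (H s t)"
  shows "H s t = sesq (\<chi> \<alpha> \<beta>. H (axis \<beta> 1) (axis \<alpha> 1)) s t"
proof -
  have zero: "H 0 t = 0" for t using smult[of 0 0 t] by simp
  have sum: "H (\<Sum>i\<in>I. f i) t = (\<Sum>i\<in>I. H (f i) t)" for I :: "'m set" and f t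
    by (induction I rule: infinite_finite_induct) (simp_all add: zero add)
  have exp: "H s t = (\<Sum>\<beta>\<in>UNIV. s $ \<beta> * H (axis \<beta> 1) t)" for s t
    by (subst basis_expansion[of s, symmetric]) (simp only: sum smult)
  have "H s t = (\<Sum>\<beta>\<in>UNIV. s $ \<beta> * cnj (\<Sum>\<alpha>\<in>UNIV. t $ \<alpha> * H (axis \<alpha> 1) (axis \<beta> 1)))"
  proof -
    have "H (axis \<beta> 1) t = cnj (\<Sum>\<alpha>\<in>UNIV. t $ \<alpha> * H (axis \<alpha> 1) (axis \<beta> 1))" for \<beta>
      by (subst sym) (simp only: exp[of t])
    then show ?thesis by (simp only: exp[of s])
  qed
  also have "\<dots> = (\<Sum>\<beta>\<in>UNIV. \<Sum>\<alpha>\<in>UNIV. cnj (t $ \<alpha>) * (H (axis \<beta> 1) (axis \<alpha> 1) * s $ \<beta>))"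
    by (simp add: sum_distrib_left sym[symmetric] mult_ac)
  also have "\<dots> = sesq (\<chi> \<alpha> \<beta>. H (axis \<beta> 1) (axis \<alpha> 1)) s t"
    unfolding sesq_entries by (subst sum.swap) simp
  finally show ?thesis .
qed


section \<open>Curvature in a holomorphic frame\<close>

text \<open>The situation in one trivialization: \<open>G\<close> is the Gram matrix of the frame, \<open>a\<close> the base point and \<open>x\<close>
the coefficient vector whose extensions are considered.\<close>

locale hermitian_matrix_map =
  fixes U :: "(complex^'n::finite) set" and G :: "complex^'n \<Rightarrow> complex^'m::finite^'m"
    and a :: "complex^'n" and x :: "complex^'m"
  assumes open_U: "open U" and a_in_U: "a \<in> U" and smooth_G: "smooth_map_on U G"
    and hermitian_G: "\<And>z \<alpha> \<beta>. z \<in> U \<Longrightarrow> G z $ \<beta> $ \<alpha> = cnj (G z $ \<alpha> $ \<beta>)"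
    and pos_G: "\<And>z s. z \<in> U \<Longrightarrow> s \<noteq> 0 \<Longrightarrow> 0 < Re (sesq (G z) s s)"
begin

abbreviation entry :: "'m \<Rightarrow> 'm \<Rightarrow> complex^'n \<Rightarrow> complex" where
  "entry \<alpha> \<beta> \<equiv> \<lambda>z. G z $ \<alpha> $ \<beta>"

text \<open>The first and second real derivatives of \<open>G\<close> at \<open>a\<close> in the direction \<open>z\<close>, the complex linear and
conjugate linear parts of the first one, and the part of type \<open>(1,1)\<close> of the second one.\<close>

definition "D1 z = (\<chi> \<alpha> \<beta>. dird z (entry \<alpha> \<beta>) a)"
definition "D2 z = (\<chi> \<alpha> \<beta>. dird z (dird z (entry \<alpha> \<beta>)) a)"
definition "del z = (\<chi> \<alpha> \<beta>. \<Sum>j\<in>UNIV. z $ j * wirtinger j (entry \<alpha> \<beta>) a)"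
definition "delbar z = (\<chi> \<alpha> \<beta>. \<Sum>j\<in>UNIV. cnj (z $ j) * wirtinger_bar j (entry \<alpha> \<beta>) a)"
definition "levi z = (\<chi> \<alpha> \<beta>. \<Sum>j\<in>UNIV. \<Sum>k\<in>UNIV. z $ j * cnj (z $ k) * wirtinger_bar k (wirtinger j (entry \<alpha> \<beta>)) a)"
text \<open>The linear part of the almost optimal extension: \<open>x + corr z\<close> is parallel at \<open>a\<close> for the Chern
connection.\<close>

definition "corr z = - (\<Sum>j\<in>UNIV. z $ j *s (chern_connection_form G j a *v x))"
text \<open>The Hermitian form \<open>z \<mapsto> \<langle>\<Theta>(z, z\<^sup>-) x, x\<rangle>\<close>.\<close>

definition "curv z = (\<Sum>j\<in>UNIV. \<Sum>k\<in>UNIV. z $ j * cnj (z $ k) * sesq (G a) (chern_curvature_coeff G j k a *v x) x)"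

lemma smooth_entry: "Ck_on k U (entry \<alpha> \<beta>)"
proof -
  have "bounded_linear (\<lambda>M::complex^'m^'m. M $ \<alpha> $ \<beta>)"
    using bounded_linear_compose[OF bounded_linear_vec_nth bounded_linear_vec_nth] .
  then show ?thesis
    using Ck_on_bounded_linear[OF _ open_U, of "\<lambda>M. M $ \<alpha> $ \<beta>" k G] smooth_G by (simp add: smooth_map_on_def)
qed

lemma diff_entry: "z \<in> U \<Longrightarrow> entry \<alpha> \<beta> differentiable (at z)"
  using Ck_on_differentiable[OF smooth_entry] .

lemma diff_dird_entry: "z \<in> U \<Longrightarrow> dird v (entry \<alpha> \<beta>) differentiable (at z)"
  using Ck_on_differentiable[OF Ck_on_dird[OF smooth_entry]] .

lemma del_eq: "del z $ \<alpha> $ \<beta> = (D1 z $ \<alpha> $ \<beta> - \<i> * D1 (\<i> *s z) $ \<alpha> $ \<beta>) / 2"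
  using wirtinger_sum[OF diff_entry[OF a_in_U]] by (simp add: del_def D1_def)

lemma delbar_eq: "delbar z $ \<alpha> $ \<beta> = (D1 z $ \<alpha> $ \<beta> + \<i> * D1 (\<i> *s z) $ \<alpha> $ \<beta>) / 2"
  using wirtinger_bar_sum[OF diff_entry[OF a_in_U]] by (simp add: delbar_def D1_def)

lemma D1_eq: "D1 z = del z + delbar z"
  by (simp add: vec_eq_iff del_eq delbar_eq field_simps)

lemma levi_entry: "levi z $ \<alpha> $ \<beta> = (D2 z $ \<alpha> $ \<beta> + D2 (\<i> *s z) $ \<alpha> $ \<beta>) / 4"
  unfolding levi_def D2_def by (simp add: levi_form_eq[OF open_U a_in_U smooth_entry])

lemma levi_eq: "levi z = (1/4) *\<^sub>R (D2 z + D2 (\<i> *s z))"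
  by (simp add: vec_eq_iff levi_entry scaleR_conv_of_real[where 'a=complex])

lemma D1_i: "D1 (\<i> *s z) $ \<alpha> $ \<beta> = \<i> * (del z $ \<alpha> $ \<beta> - delbar z $ \<alpha> $ \<beta>)"
  by (simp add: del_eq delbar_eq field_simps)

lemma dird_entry_hermitian:
  assumes "w \<in> U"
  shows "dird z (entry \<beta> \<alpha>) w = cnj (dird z (entry \<alpha> \<beta>) w)"
proof -
  have "dird z (entry \<beta> \<alpha>) w = dird z (\<lambda>w. cnj (entry \<alpha> \<beta> w)) w"
    by (rule dird_cong[OF open_U assms hermitian_G])
  also have "\<dots> = cnj (dird z (entry \<alpha> \<beta>) w)"
    by (rule dird_cnj[OF diff_entry[OF assms]])
  finally show ?thesis .
qed

lemma D1_hermitian: "D1 z $ \<beta> $ \<alpha> = cnj (D1 z $ \<alpha> $ \<beta>)"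
  unfolding D1_def vec_lambda_beta by (rule dird_entry_hermitian[OF a_in_U])

lemma D2_hermitian: "D2 z $ \<beta> $ \<alpha> = cnj (D2 z $ \<alpha> $ \<beta>)"
proof -
  have "dird z (dird z (entry \<beta> \<alpha>)) a = dird z (\<lambda>w. cnj (dird z (entry \<alpha> \<beta>) w)) a"
    by (rule dird_cong[OF open_U a_in_U dird_entry_hermitian])
  also have "\<dots> = cnj (dird z (dird z (entry \<alpha> \<beta>)) a)"
    by (rule dird_cnj[OF diff_dird_entry[OF a_in_U]])
  finally show ?thesis by (simp add: D2_def)
qed

lemma del_adjoint: "del z $ \<beta> $ \<alpha> = cnj (delbar z $ \<alpha> $ \<beta>)"
  unfolding del_eq delbar_eq D1_hermitian[of z \<beta> \<alpha>] D1_hermitian[of "\<i> *s z" \<beta> \<alpha>] by simp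

lemma sesq_del_adjoint: "sesq (del z) s t = cnj (sesq (delbar z) t s)"
  by (rule sesq_adjoint) (rule del_adjoint)

lemma sesq_G_hermitian: "z \<in> U \<Longrightarrow> sesq (G z) s t = cnj (sesq (G z) t s)"
  by (rule sesq_adjoint) (rule hermitian_G)

lemma sesq_levi_real: "Im (sesq (levi z) s s) = 0"
proof -
  have "sesq (D2 w) s s = cnj (sesq (D2 w) s s)" for w
    by (rule sesq_adjoint) (rule D2_hermitian)
  then have "Im (sesq (D2 w) s s) = 0" for w by (metis complex_cnj_cancel_iff Reals_cnj_iff complex_is_Real_iff)
  then show ?thesis by (simp add: levi_eq sesq_scaleR sesq_add_matrix)
qed

lemma invertible_G: assumes "z \<in> U" shows "invertible (G z)"
proof -
  have "s = 0" if "G z *v s = 0" for s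
    using pos_G[OF assms, of s] that by (auto simp: sesq_def)
  then show ?thesis
    by (metis invertible_left_inverse matrix_left_invertible_ker)
qed

text \<open>This is the defining relation \<open>\<partial>\<^sub>j G = G \<theta>\<^sub>j\<close> of the Chern connection. It is kept on all of \<open>U\<close>, since
\<open>curv_eq\<close> differentiates it once more.\<close>

lemma G_connection: "z \<in> U \<Longrightarrow> G z ** chern_connection_form G j z = (\<chi> \<alpha> \<beta>. wirtinger j (entry \<alpha> \<beta>) z)"
  unfolding chern_connection_form_def matrix_mul_assoc
  using invertible_matrix_inv[OF invertible_G] by simp

lemma G_corr: "G a *v corr z = - (del z *v x)"
proof -
  have "(\<Sum>j\<in>UNIV. z $ j *s ((\<chi> \<alpha> \<beta>. wirtinger j (entry \<alpha> \<beta>) a) *v x)) $ i = (del z *v x) $ i" for i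
  proof -
    have "(\<Sum>j\<in>UNIV. z $ j *s ((\<chi> \<alpha> \<beta>. wirtinger j (entry \<alpha> \<beta>) a) *v x)) $ i
        = (\<Sum>j\<in>UNIV. \<Sum>\<beta>\<in>UNIV. z $ j * (wirtinger j (entry i \<beta>) a * x $ \<beta>))"
      by (simp add: matrix_vector_mult_def sum_distrib_left)
    also have "\<dots> = (\<Sum>\<beta>\<in>UNIV. \<Sum>j\<in>UNIV. z $ j * (wirtinger j (entry i \<beta>) a * x $ \<beta>))"
      by (rule sum.swap)
    also have "\<dots> = (del z *v x) $ i"
      by (simp add: matrix_vector_mult_def del_def sum_distrib_right mult.assoc)
    finally show ?thesis .
  qed
  then have del: "(\<Sum>j\<in>UNIV. z $ j *s ((\<chi> \<alpha> \<beta>. wirtinger j (entry \<alpha> \<beta>) a) *v x)) = del z *v x"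
    unfolding vec_eq_iff by blast
  have "G a *v corr z = - (\<Sum>j\<in>UNIV. G a *v (z $ j *s (chern_connection_form G j a *v x)))"
    unfolding corr_def matrix_vector_mult_minus matrix_vector_mult_sum ..
  also have "\<dots> = - (\<Sum>j\<in>UNIV. z $ j *s ((G a ** chern_connection_form G j a) *v x))"
    by (simp only: vector_scalar_commute matrix_vector_mul_assoc)
  also have "\<dots> = - (del z *v x)"
    unfolding G_connection[OF a_in_U] del ..
  finally show ?thesis .
qed

text \<open>The reason for the choice of \<open>corr\<close>: pairing with \<open>corr z\<close> cancels the antiholomorphic first-order
term \<open>delbar z\<close> of the metric.\<close>

lemma sesq_G_corr_right: "sesq (G a) y (corr z) = - sesq (delbar z) y x"
proof -
  have "sesq (G a) (corr z) y = - sesq (del z) x y"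
    unfolding sesq_def G_corr by (simp add: sum_negf)
  then show ?thesis
    by (simp only: sesq_G_hermitian[OF a_in_U, of y "corr z"] sesq_del_adjoint[of z x y] complex_cnj_minus complex_cnj_cnj)
qed

text \<open>Differentiating \<open>\<partial>\<^sub>j G = G \<theta>\<^sub>j\<close> with respect to the conjugate of \<open>z\<^sub>k\<close> gives
\<open>G \<Theta>\<^sub>j\<^sub>k = (\<partial>\<^sup>-\<^sub>k G) \<theta>\<^sub>j - \<partial>\<^sup>-\<^sub>k \<partial>\<^sub>j G\<close>. Summed against \<open>z\<^sub>j\<close> and the conjugate of \<open>z\<^sub>k\<close>, the second term
becomes the Levi form and \<open>\<Sum>\<^sub>j z\<^sub>j \<theta>\<^sub>j x = - corr z\<close>.\<close>

lemma curv_eq: "curv z = - sesq (levi z) x x - sesq (delbar z) (corr z) x"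
proof -
  let ?\<theta> = "\<lambda>j w. chern_connection_form G j w"
  have dinv: "(\<lambda>w. matrix_inv (G w) $ \<alpha> $ \<beta>) differentiable (at a)" for \<alpha> \<beta>
    by (rule differentiable_matrix_inv[where M = G, OF open_U a_in_U diff_entry[OF a_in_U] invertible_G])
  have dw: "wirtinger j (entry \<alpha> \<beta>) differentiable (at a)" for j \<alpha> \<beta>
  proof -
    have "wirtinger j (entry \<alpha> \<beta>) = (\<lambda>w. (1/2) * dird (axis j 1) (entry \<alpha> \<beta>) w + (- \<i> / 2) * dird (axis j \<i>) (entry \<alpha> \<beta>) w)"
      by (auto simp: wirtinger_dird field_simps)
    then show ?thesis
      by (simp only:) (rule dird_complex_linear_combination(2)[OF diff_dird_entry[OF a_in_U] diff_dird_entry[OF a_in_U]])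
  qed
  have d\<theta>: "(\<lambda>w. ?\<theta> j w $ \<alpha> $ \<beta>) differentiable (at a)" for j \<alpha> \<beta>
    unfolding chern_connection_form_def matrix_matrix_mult_def
    using dinv dw by (simp add: differentiable_sum)
  have product: "wirtinger_bar k (wirtinger j (entry \<alpha> \<beta>)) a =
      (\<Sum>\<gamma>\<in>UNIV. wirtinger_bar k (entry \<alpha> \<gamma>) a * ?\<theta> j a $ \<gamma> $ \<beta> + G a $ \<alpha> $ \<gamma> * wirtinger_bar k (\<lambda>w. ?\<theta> j w $ \<gamma> $ \<beta>) a)" for j k \<alpha> \<beta>
  proof -
    have eq: "wirtinger j (entry \<alpha> \<beta>) w = (\<Sum>\<gamma>\<in>UNIV. G w $ \<alpha> $ \<gamma> * ?\<theta> j w $ \<gamma> $ \<beta>)" if "w \<in> U" for w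
      using arg_cong[OF G_connection[OF that, of j], of "\<lambda>M. M $ \<alpha> $ \<beta>"] by (simp add: matrix_matrix_mult_def)
    have d: "dird v (wirtinger j (entry \<alpha> \<beta>)) a = (\<Sum>\<gamma>\<in>UNIV. G a $ \<alpha> $ \<gamma> * dird v (\<lambda>w. ?\<theta> j w $ \<gamma> $ \<beta>) a + dird v (entry \<alpha> \<gamma>) a * ?\<theta> j a $ \<gamma> $ \<beta>)" for v
    proof -
      have "dird v (wirtinger j (entry \<alpha> \<beta>)) a = dird v (\<lambda>w. \<Sum>\<gamma>\<in>UNIV. G w $ \<alpha> $ \<gamma> * ?\<theta> j w $ \<gamma> $ \<beta>) a"
        by (rule dird_cong[OF open_U a_in_U eq])
      also have "\<dots> = (\<Sum>\<gamma>\<in>UNIV. G a $ \<alpha> $ \<gamma> * dird v (\<lambda>w. ?\<theta> j w $ \<gamma> $ \<beta>) a + dird v (entry \<alpha> \<gamma>) a * ?\<theta> j a $ \<gamma> $ \<beta>)"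
        by (rule dirdI[where D = "\<lambda>v. \<Sum>\<gamma>\<in>UNIV. G a $ \<alpha> $ \<gamma> * dird v (\<lambda>w. ?\<theta> j w $ \<gamma> $ \<beta>) a + dird v (entry \<alpha> \<gamma>) a * ?\<theta> j a $ \<gamma> $ \<beta>"])
          (intro has_derivative_sum has_derivative_mult differentiable_dird d\<theta> diff_entry[OF a_in_U])
      finally show ?thesis .
    qed
    have "wirtinger_bar k (wirtinger j (entry \<alpha> \<beta>)) a =
      (\<Sum>\<gamma>\<in>UNIV. (G a $ \<alpha> $ \<gamma> * dird (axis k 1) (\<lambda>w. ?\<theta> j w $ \<gamma> $ \<beta>) a + dird (axis k 1) (entry \<alpha> \<gamma>) a * ?\<theta> j a $ \<gamma> $ \<beta>
        + \<i> * (G a $ \<alpha> $ \<gamma> * dird (axis k \<i>) (\<lambda>w. ?\<theta> j w $ \<gamma> $ \<beta>) a + dird (axis k \<i>) (entry \<alpha> \<gamma>) a * ?\<theta> j a $ \<gamma> $ \<beta>)) / 2)"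
      unfolding wirtinger_bar_dird[of k "wirtinger j (entry \<alpha> \<beta>)"] d
      by (simp only: sum_divide_distrib[symmetric] sum.distrib[symmetric] sum_distrib_left)
    also have "\<dots> = (\<Sum>\<gamma>\<in>UNIV. wirtinger_bar k (entry \<alpha> \<gamma>) a * ?\<theta> j a $ \<gamma> $ \<beta> + G a $ \<alpha> $ \<gamma> * wirtinger_bar k (\<lambda>w. ?\<theta> j w $ \<gamma> $ \<beta>) a)"
      unfolding wirtinger_bar_dird by (intro sum.cong refl) (simp add: field_simps)
    finally show ?thesis .
  qed
  \<comment> \<open>\<open>W j k\<close> and \<open>B k\<close> collect the entries of \<open>\<partial>\<^sup>-\<^sub>k \<partial>\<^sub>j G\<close> and \<open>\<partial>\<^sup>-\<^sub>k G\<close>\<close>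
  define W where "W j k = (\<chi> \<alpha> \<beta>. wirtinger_bar k (wirtinger j (entry \<alpha> \<beta>)) a)" for j k
  define B where "B k = (\<chi> \<alpha> \<beta>. wirtinger_bar k (entry \<alpha> \<beta>) a)" for k
  have mat: "G a ** chern_curvature_coeff G j k a = B k ** ?\<theta> j a - W j k" for j k
    by (simp add: vec_eq_iff matrix_matrix_mult_def W_def B_def product chern_curvature_coeff_def sum.distrib sum_negf)
  have "sesq (G a) (chern_curvature_coeff G j k a *v x) x = sesq (B k) (?\<theta> j a *v x) x - sesq (W j k) x x" for j k
  proof -
    have "sesq (G a) (chern_curvature_coeff G j k a *v x) x = sesq (G a ** chern_curvature_coeff G j k a) x x"
      by (simp add: sesq_def matrix_vector_mul_assoc)
    also have "\<dots> = sesq (B k ** ?\<theta> j a) x x - sesq (W j k) x x"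
      unfolding mat by (rule sesq_diff_matrix)
    finally show ?thesis by (simp add: sesq_def matrix_vector_mul_assoc)
  qed
  then have "curv z = (\<Sum>j\<in>UNIV. \<Sum>k\<in>UNIV. z $ j * cnj (z $ k) * sesq (B k) (?\<theta> j a *v x) x)
      - (\<Sum>j\<in>UNIV. \<Sum>k\<in>UNIV. z $ j * cnj (z $ k) * sesq (W j k) x x)"
    by (simp add: curv_def right_diff_distrib sum_subtractf)
  also have "(\<Sum>j\<in>UNIV. \<Sum>k\<in>UNIV. z $ j * cnj (z $ k) * sesq (W j k) x x) = sesq (levi z) x x"
  proof -
    have lev: "levi z = (\<Sum>j\<in>UNIV. \<Sum>k\<in>UNIV. (\<chi> \<alpha> \<beta>. z $ j * cnj (z $ k) * W j k $ \<alpha> $ \<beta>))"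
      by (simp add: vec_eq_iff levi_def W_def)
    have s0: "sesq (\<Sum>i\<in>I. M i) s t = (\<Sum>i\<in>I. sesq (M i) s t)" for I :: "'n set" and M and s t :: "complex^'m"
      by (induction I rule: infinite_finite_induct) (auto simp: sesq_add_matrix, simp_all add: sesq_def)
    have s1: "sesq (\<chi> \<alpha> \<beta>. c * M $ \<alpha> $ \<beta>) s t = c * sesq M s t" for c and M :: "complex^'m^'m" and s t
      by (simp add: sesq_entries sum_distrib_left mult_ac)
    show ?thesis unfolding lev s0 s1 ..
  qed
  also have "(\<Sum>j\<in>UNIV. \<Sum>k\<in>UNIV. z $ j * cnj (z $ k) * sesq (B k) (?\<theta> j a *v x) x) = - sesq (delbar z) (corr z) x"
  proof -
    have "(\<Sum>k\<in>UNIV. cnj (z $ k) * sesq (B k) s t) = sesq (delbar z) s t" for s t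
      unfolding sesq_entries delbar_def B_def sum_distrib_left
      by (simp add: sum_distrib_left sum_distrib_right mult_ac)
        (subst sum.swap, rule sum.cong[OF refl], subst sum.swap, simp)
    then have "sesq (delbar z) (corr z) x = - (\<Sum>j\<in>UNIV. z $ j * (\<Sum>k\<in>UNIV. cnj (z $ k) * sesq (B k) (?\<theta> j a *v x) x))"
      by (simp add: corr_def sesq_uminus_left sesq_sum_left sesq_smult_left)
    then show ?thesis by (simp add: sum_distrib_left mult_ac)
  qed
  finally show ?thesis by simp
qed

end


section \<open>Pointwise estimates near the base point\<close>

context hermitian_matrix_map
begin

lemma corr_smult: "corr (c *s z) = c *s corr z"
  unfolding corr_def by (simp add: vec_eq_iff sum_distrib_left sum_negf mult_ac)

lemma corr_add: "corr (z + w) = corr z + corr w"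
  unfolding corr_def by (simp add: vec_eq_iff sum.distrib distrib_right)

lemma corr_0 [simp]: "corr 0 = 0"
  using corr_smult[of 0 0] by simp

lemma corr_uminus: "corr (- z) = - corr z"
  using corr_smult[of "-1" z] by simp

lemma corr_bound: "\<exists>C\<ge>0. \<forall>z. norm (corr z) \<le> C * norm z"
proof (intro exI conjI allI)
  let ?v = "\<lambda>j. chern_connection_form G j a *v x"
  show "0 \<le> (\<Sum>j\<in>UNIV. norm (?v j))" by (simp add: sum_nonneg)
  fix z
  have "norm (corr z) \<le> (\<Sum>j\<in>UNIV. norm z * norm (?v j))"
    unfolding corr_def norm_minus_cancel
    by (intro sum_norm_le) (auto simp: norm_vector_smult intro!: mult_right_mono Finite_Cartesian_Product.norm_nth_le)
  then show "norm (corr z) \<le> (\<Sum>j\<in>UNIV. norm (?v j)) * norm z"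
    by (simp add: sum_distrib_left mult.commute)
qed

lemma sesq_G_real: "z \<in> U \<Longrightarrow> Im (sesq (G z) s s) = 0"
  using sesq_G_hermitian[of z s s] by (metis Reals_cnj_iff complex_is_Real_iff)

lemma sesq_delbar_corr: "sesq (delbar z) (corr z) x = - sesq (G a) (corr z) (corr z)"
  using sesq_G_corr_right[of "corr z" z] by simp

text \<open>Both terms in \<open>curv_eq\<close> are real: the Levi form of a Hermitian matrix is Hermitian, and the other term
is a value of the quadratic form of \<open>G a\<close>. Hence the real-valued integral of the curvature form
determines the complex expression in the expansion.\<close>

lemma curv_real: "Im (curv z) = 0"
  by (simp add: curv_eq sesq_levi_real sesq_delbar_corr sesq_G_real[OF a_in_U])

lemma continuous_on_corr [continuous_intros]: "continuous_on S corr"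
  unfolding corr_def[abs_def] by (intro continuous_intros)

lemma continuous_on_curv [continuous_intros]: "continuous_on S curv"
  unfolding curv_def[abs_def] by (intro continuous_intros)

lemma entry_taylor:
  assumes ball: "cball a \<rho> \<subseteq> U" and \<rho>: "0 \<le> \<rho>"
  shows "\<exists>C\<ge>0. \<forall>z \<alpha> \<beta>. norm z \<le> \<rho> \<longrightarrow>
     cmod ((G (a + z) - G a) $ \<alpha> $ \<beta>) \<le> C * norm z \<and>
     cmod ((G (a + z) - G a - D1 z) $ \<alpha> $ \<beta>) \<le> C * norm z ^ 2 \<and>
     cmod (((1/2) *\<^sub>R (G (a + z) + G (a - z)) - G a - (1/2) *\<^sub>R D2 z) $ \<alpha> $ \<beta>) \<le> C * norm z ^ 4 \<and>
     cmod (((1/2) *\<^sub>R (G (a + z) - G (a - z)) - D1 z) $ \<alpha> $ \<beta>) \<le> C * norm z ^ 3"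
proof -
  define B where "B C \<alpha> \<beta> \<longleftrightarrow> (\<forall>z. norm z \<le> \<rho> \<longrightarrow>
     cmod ((G (a + z) - G a) $ \<alpha> $ \<beta>) \<le> C * norm z \<and>
     cmod ((G (a + z) - G a - D1 z) $ \<alpha> $ \<beta>) \<le> C * norm z ^ 2 \<and>
     cmod (((1/2) *\<^sub>R (G (a + z) + G (a - z)) - G a - (1/2) *\<^sub>R D2 z) $ \<alpha> $ \<beta>) \<le> C * norm z ^ 4 \<and>
     cmod (((1/2) *\<^sub>R (G (a + z) - G (a - z)) - D1 z) $ \<alpha> $ \<beta>) \<le> C * norm z ^ 3)" for C \<alpha> \<beta>
  have "smooth_map_on U (entry \<alpha> \<beta>)" for \<alpha> \<beta>
    using smooth_entry by (simp add: smooth_map_on_def)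
  then have "\<exists>C\<ge>0. B C \<alpha> \<beta>" for \<alpha> \<beta>
    using taylor_even_odd[OF open_U ball \<rho>, of "entry \<alpha> \<beta>"] by (simp add: B_def D1_def D2_def)
  then obtain c where c: "\<And>\<alpha> \<beta>. 0 \<le> c \<alpha> \<beta>" "\<And>\<alpha> \<beta>. B (c \<alpha> \<beta>) \<alpha> \<beta>" by metis
  define C where "C = (\<Sum>\<alpha>\<in>UNIV. \<Sum>\<beta>\<in>UNIV. c \<alpha> \<beta>)"
  have le: "c \<alpha> \<beta> \<le> C" for \<alpha> \<beta>
  proof -
    have "c \<alpha> \<beta> \<le> (\<Sum>\<beta>\<in>UNIV. c \<alpha> \<beta>)"
      using c(1) by (intro member_le_sum) auto
    also have "\<dots> \<le> C"
      unfolding C_def using c(1) by (intro member_le_sum[of \<alpha> UNIV "\<lambda>\<alpha>. \<Sum>\<beta>\<in>UNIV. c \<alpha> \<beta>"]) (auto intro!: sum_nonneg)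
    finally show ?thesis .
  qed
  have mono: "c \<alpha> \<beta> * norm z ^ k \<le> C * norm z ^ k" for \<alpha> \<beta> k and z :: "complex^'n"
    using le by (rule mult_right_mono) simp
  have "B C \<alpha> \<beta>" for \<alpha> \<beta>
    using c(2)[of \<alpha> \<beta>] order_trans[OF _ mono[of \<alpha> \<beta> _ 1]] order_trans[OF _ mono[of \<alpha> \<beta>]]
    unfolding B_def power_one_right by blast
  moreover have "0 \<le> C" using le c(1) order_trans by blast
  ultimately show ?thesis unfolding B_def by blast
qed

text \<open>The almost optimal extension in coordinates centered at \<open>a\<close>, its pointwise squared norm, and the
squared norm of \<open>x\<close>.\<close>

definition "frame z = x + corr z"
definition "Q z = Re (sesq (G (a + z)) (frame z) (frame z))"
definition "N = Re (sesq (G a) x x)"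

lemma D1_uminus: "D1 (- z) = - D1 z"
  using dird_scaleR[OF diff_entry[OF a_in_U], of "-1" z] by (simp add: D1_def vec_eq_iff)

text \<open>Averaging over \<open>\<plusminus>z\<close> leaves the even part of \<open>Q\<close>, which is \<open>M z\<close> up to the fourth order. In the average of
\<open>M\<close> over \<open>z\<close> and \<open>\<i> z\<close> the second derivative turns into the Levi form, the two mixed terms
contribute \<open>2 Re X\<close> with \<open>X = sesq (delbar z) (corr z) x\<close>, and the term quadratic in \<open>corr\<close> contributes
\<open>- X\<close>. The total \<open>N + sesq (levi z) x x + X\<close> is \<open>N - curv z\<close> by \<open>curv_eq\<close>.\<close>

lemma Q_average:
  assumes ball: "cball a \<rho> \<subseteq> U" and \<rho>: "0 \<le> \<rho>"
  shows "\<exists>C\<ge>0. \<forall>z. norm z \<le> \<rho> \<longrightarrow>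
    \<bar>(Q z + Q (- z) + Q (\<i> *s z) + Q (- (\<i> *s z))) / 4 - (N - Re (curv z))\<bar> \<le> C * norm z ^ 4"
proof -
  obtain C where C: "C \<ge> 0"
    "\<And>z \<alpha> \<beta>. norm z \<le> \<rho> \<Longrightarrow> cmod ((G (a + z) - G a - D1 z) $ \<alpha> $ \<beta>) \<le> C * norm z ^ 2"
    "\<And>z \<alpha> \<beta>. norm z \<le> \<rho> \<Longrightarrow> cmod (((1/2) *\<^sub>R (G (a + z) + G (a - z)) - G a - (1/2) *\<^sub>R D2 z) $ \<alpha> $ \<beta>) \<le> C * norm z ^ 4"
    "\<And>z \<alpha> \<beta>. norm z \<le> \<rho> \<Longrightarrow> cmod (((1/2) *\<^sub>R (G (a + z) - G (a - z)) - D1 z) $ \<alpha> $ \<beta>) \<le> C * norm z ^ 3"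
    using entry_taylor[OF assms] by metis
  obtain L where L: "L \<ge> 0" "\<And>z. norm (corr z) \<le> L * norm z" using corr_bound by blast
  define m where "m = (real CARD('m))\<^sup>2"
  have m: "m \<ge> 0" by (simp add: m_def)
  define M where "M z = sesq (G a) x x + (1/2) * sesq (D2 z) x x + sesq (G a) (corr z) (corr z)
     + sesq (D1 z) x (corr z) + sesq (D1 z) (corr z) x" for z
  define K where "K = m * C * (norm x + L)\<^sup>2"
  have half: "\<bar>(Q z + Q (- z)) / 2 - Re (M z)\<bar> \<le> K * norm z ^ 4" if z: "norm z \<le> \<rho>" for z
  proof -
    let ?y = "corr z"
    define Ev where "Ev = (1/2) *\<^sub>R (G (a + z) + G (a - z))"
    define Od where "Od = (1/2) *\<^sub>R (G (a + z) - G (a - z))"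
    have Gp: "G (a + z) = Ev + Od" "G (a - z) = Ev - Od"
      by (simp_all add: Ev_def Od_def vec_eq_iff algebra_simps)
    have Qz: "Q z = Re (sesq (Ev + Od) (x + ?y) (x + ?y))" "Q (- z) = Re (sesq (Ev - Od) (x - ?y) (x - ?y))"
      by (simp_all add: Q_def frame_def corr_uminus Gp)
    have "(Q z + Q (- z)) / 2 = Re (sesq Ev x x + sesq Ev ?y ?y + sesq Od x ?y + sesq Od ?y x)"
      unfolding Qz
      by (simp add: sesq_add_matrix sesq_diff_matrix sesq_add_left sesq_add_right sesq_diff_left sesq_diff_right)
    then have "(Q z + Q (- z)) / 2 - Re (M z) = Re (sesq (Ev - G a - (1/2) *\<^sub>R D2 z) x x + sesq (Ev - G a) ?y ?y
         + sesq (Od - D1 z) x ?y + sesq (Od - D1 z) ?y x)"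
      by (simp add: M_def sesq_diff_matrix sesq_scaleR)
    also have "\<bar>\<dots>\<bar> \<le> cmod (sesq (Ev - G a - (1/2) *\<^sub>R D2 z) x x + sesq (Ev - G a) ?y ?y
         + sesq (Od - D1 z) x ?y + sesq (Od - D1 z) ?y x)"
      by (rule abs_Re_le_cmod)
    also have "\<dots> \<le> cmod (sesq (Ev - G a - (1/2) *\<^sub>R D2 z) x x) + cmod (sesq (Ev - G a) ?y ?y)
         + cmod (sesq (Od - D1 z) x ?y) + cmod (sesq (Od - D1 z) ?y x)"
      by (intro norm_triangle_le add_mono order_refl)
    also have "\<dots> \<le> m * (C * norm z ^ 4) * norm x * norm x + m * (C * norm z ^ 2) * (L * norm z) * (L * norm z)
         + m * (C * norm z ^ 3) * norm x * (L * norm z) + m * (C * norm z ^ 3) * (L * norm z) * norm x"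
    proof (intro add_mono)
      show "cmod (sesq (Ev - G a - (1/2) *\<^sub>R D2 z) x x) \<le> m * (C * norm z ^ 4) * norm x * norm x"
        unfolding m_def Ev_def by (rule sesq_bound) (rule C(3)[OF z])
      \<comment> \<open>the first-order terms cancel, so the even part is constant up to \<open>O(|z|\<^sup>2)\<close>\<close>
      have Ev0: "cmod ((Ev - G a) $ \<alpha> $ \<beta>) \<le> C * norm z ^ 2" for \<alpha> \<beta>
      proof -
        have "(Ev - G a) $ \<alpha> $ \<beta> = ((G (a + z) - G a - D1 z) $ \<alpha> $ \<beta> + (G (a + - z) - G a - D1 (- z)) $ \<alpha> $ \<beta>) / 2"
          by (simp add: Ev_def D1_uminus scaleR_conv_of_real[where 'a=complex] field_simps)
        also have "cmod \<dots> \<le> (C * norm z ^ 2 + C * norm z ^ 2) / 2"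
        proof -
          have "cmod ((u + v) / 2) \<le> (k + k) / 2" if "cmod u \<le> k" "cmod v \<le> k" for u v k
            using norm_triangle_ineq[of u v] that by (simp add: norm_divide)
          then show ?thesis
            using C(2)[OF z, of \<alpha> \<beta>] C(2)[of "- z" \<alpha> \<beta>] z by (simp only: norm_minus_cancel)
        qed
        finally show ?thesis by simp
      qed
      show "cmod (sesq (Ev - G a) ?y ?y) \<le> m * (C * norm z ^ 2) * (L * norm z) * (L * norm z)"
        unfolding m_def by (rule sesq_bound_le[OF Ev0 L(2) L(2)])
      have Od0: "cmod ((Od - D1 z) $ \<alpha> $ \<beta>) \<le> C * norm z ^ 3" for \<alpha> \<beta>
        unfolding Od_def by (rule C(4)[OF z])
      show "cmod (sesq (Od - D1 z) x ?y) \<le> m * (C * norm z ^ 3) * norm x * (L * norm z)"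
        unfolding m_def by (rule sesq_bound_le[OF Od0 order_refl L(2)])
      show "cmod (sesq (Od - D1 z) ?y x) \<le> m * (C * norm z ^ 3) * (L * norm z) * norm x"
        unfolding m_def by (rule sesq_bound_le[OF Od0 L(2) order_refl])
    qed
    also have "\<dots> = K * norm z ^ 4"
      by (simp add: K_def power2_eq_square eval_nat_numeral algebra_simps)
    finally show ?thesis .
  qed
  have main: "(Re (M z) + Re (M (\<i> *s z))) / 2 = N - Re (curv z)" for z
  proof -
    let ?y = "corr z"
    have lev: "sesq (levi z) x x = (1/4) * (sesq (D2 z) x x + sesq (D2 (\<i> *s z)) x x)"
      by (simp add: levi_eq sesq_scaleR sesq_add_matrix)
    have D1i: "sesq (D1 (\<i> *s z)) s t = \<i> * (sesq (del z) s t - sesq (delbar z) s t)" for s t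
      unfolding sesq_entries D1_i by (simp add: sum_distrib_left sum_subtractf[symmetric] algebra_simps)
    have D1z: "sesq (D1 z) s t = sesq (del z) s t + sesq (delbar z) s t" for s t
      by (simp add: D1_eq sesq_add_matrix)
    have "M z + M (\<i> *s z) = 2 * sesq (G a) x x + 2 * sesq (levi z) x x + 2 * sesq (G a) ?y ?y
        + 2 * sesq (delbar z) ?y x + 2 * sesq (del z) x ?y"
      unfolding M_def lev by (simp add: corr_smult sesq_smult_left sesq_smult_right D1i D1z algebra_simps)
    also have "\<dots> = 2 * sesq (G a) x x + 2 * sesq (levi z) x x + 2 * cnj (sesq (delbar z) ?y x)"
      unfolding sesq_del_adjoint[of z x ?y] sesq_delbar_corr by simp
    finally have "Re (M z) + Re (M (\<i> *s z)) = 2 * N + 2 * Re (sesq (levi z) x x) + 2 * Re (sesq (delbar z) ?y x)"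
      unfolding N_def by (metis (no_types, lifting) Re_complex_of_real complex_cnj_complex_of_real cnj.simps(1) plus_complex.simps(1) mult_2 )
    then show ?thesis by (simp add: curv_eq)
  qed
  have "\<bar>(Q z + Q (- z) + Q (\<i> *s z) + Q (- (\<i> *s z))) / 4 - (N - Re (curv z))\<bar> \<le> K * norm z ^ 4"
    if z: "norm z \<le> \<rho>" for z
  proof -
    have ni: "norm (\<i> *s z) = norm z" by (simp add: norm_vector_smult)
    have "norm (\<i> *s z) \<le> \<rho>" using z ni by simp
    from half[OF this] have h: "\<bar>(Q (\<i> *s z) + Q (- (\<i> *s z))) / 2 - Re (M (\<i> *s z))\<bar> \<le> K * norm z ^ 4"
      by (simp only: ni)
    have "\<bar>(p + q) / 4 - n\<bar> \<le> k" if "\<bar>p / 2 - u\<bar> \<le> k" "\<bar>q / 2 - v\<bar> \<le> k" "(u + v) / 2 = n" for p q u v k n :: real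
      using that by (auto simp: abs_le_iff field_simps)
    from this[OF half[OF z] h main] show ?thesis by (simp only: add.assoc)
  qed
  moreover have "K \<ge> 0" using m C(1) by (simp add: K_def)
  ultimately show ?thesis by blast
qed

lemma G_uniformly_positive:
  assumes ball: "cball a \<rho> \<subseteq> U" and \<rho>: "0 \<le> \<rho>"
  shows "\<exists>c>0. \<forall>z\<in>cball a \<rho>. \<forall>y. c * (norm y)\<^sup>2 \<le> Re (sesq (G z) y y)"
proof -
  let ?S = "cball a \<rho> \<times> sphere (0::complex^'m) 1"
  have cont: "continuous_on ?S (\<lambda>p. Re (sesq (G (fst p)) (snd p) (snd p)))"
  proof (intro continuous_intros)
    have "continuous_on U G" using smooth_G Ck_on_imp_continuous by (auto simp: smooth_map_on_def)
    then show "continuous_on ?S (\<lambda>p. G (fst p))"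
      using ball by (intro continuous_on_compose2[of U G _ fst] continuous_intros) auto
  qed
  have "?S \<noteq> {}"
    using \<rho> vector_choose_size[of 1] by (auto simp: sphere_eq_empty)
  then obtain p where p: "p \<in> ?S" "\<And>p'. p' \<in> ?S \<Longrightarrow> Re (sesq (G (fst p)) (snd p) (snd p)) \<le> Re (sesq (G (fst p')) (snd p') (snd p'))"
    using continuous_attains_inf[OF compact_Times[OF compact_cball compact_sphere] _ cont] by blast
  define c where "c = Re (sesq (G (fst p)) (snd p) (snd p))"
  have "c > 0" unfolding c_def using p(1) ball by (intro pos_G) auto
  moreover have "c * (norm y)\<^sup>2 \<le> Re (sesq (G z) y y)" if z: "z \<in> cball a \<rho>" for z y
  proof (cases "y = 0")
    case False
    define u where "u = (1 / norm y) *\<^sub>R y"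
    have u: "norm u = 1" using False by (simp add: u_def)
    have y: "y = of_real (norm y) *s u" using False by (simp add: u_def scaleR_vector_smult vector_smult_assoc)
    have "c \<le> Re (sesq (G z) u u)" using p(2)[of "(z, u)"] z u by (simp add: c_def)
    moreover have "Re (sesq (G z) y y) = (norm y)\<^sup>2 * Re (sesq (G z) u u)"
      by (subst (1 2) y) (simp add: sesq_smult_left sesq_smult_right power2_eq_square mult.assoc)
    ultimately show ?thesis by (metis mult.commute mult_left_mono zero_le_power2)
  qed simp
  ultimately show ?thesis by blast
qed

text \<open>Expand around \<open>frame z\<close>. By \<open>sesq_G_corr_right\<close> the cross term agrees with the holomorphic expression
\<open>sesq (G a + del z) y x\<close> up to \<open>B |z|\<^sup>2 |y|\<close>, and \<open>c |y|\<^sup>2 - 2 B |z|\<^sup>2 |y| \<ge> - B\<^sup>2 |z|\<^sup>4 / c\<close> by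
completing the square.\<close>

lemma Q_lower:
  assumes ball: "cball a \<rho> \<subseteq> U" and \<rho>: "0 \<le> \<rho>"
  shows "\<exists>C\<ge>0. \<forall>z y. norm z \<le> \<rho> \<longrightarrow>
    Q z + 2 * Re (sesq (G a + del z) y x) - C * norm z ^ 4 \<le> Re (sesq (G (a + z)) (frame z + y) (frame z + y))"
proof -
  obtain C where C: "C \<ge> 0"
    "\<And>z \<alpha> \<beta>. norm z \<le> \<rho> \<Longrightarrow> cmod ((G (a + z) - G a) $ \<alpha> $ \<beta>) \<le> C * norm z"
    "\<And>z \<alpha> \<beta>. norm z \<le> \<rho> \<Longrightarrow> cmod ((G (a + z) - G a - D1 z) $ \<alpha> $ \<beta>) \<le> C * norm z ^ 2"
    using entry_taylor[OF assms] by metis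
  obtain L where L: "L \<ge> 0" "\<And>z. norm (corr z) \<le> L * norm z" using corr_bound by blast
  obtain c where c: "c > 0" "\<And>z y. z \<in> cball a \<rho> \<Longrightarrow> c * (norm y)\<^sup>2 \<le> Re (sesq (G z) y y)"
    using G_uniformly_positive[OF assms] by blast
  define m where "m = (real CARD('m))\<^sup>2"
  have m: "m \<ge> 0" by (simp add: m_def)
  define B where "B = m * C * (norm x + L)"
  have "Q z + 2 * Re (sesq (G a + del z) y x) - B\<^sup>2 / c * norm z ^ 4 \<le> Re (sesq (G (a + z)) (frame z + y) (frame z + y))"
    if z: "norm z \<le> \<rho>" for z y
  proof -
    let ?w = "a + z"
    have w: "?w \<in> cball a \<rho>" "?w \<in> U" using z ball by (auto simp: dist_norm)
    have "Re (sesq (G ?w) (frame z + y) (frame z + y)) = Q z + 2 * Re (sesq (G ?w) y (frame z)) + Re (sesq (G ?w) y y)"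
      unfolding Q_def using arg_cong[OF sesq_G_hermitian[OF w(2), of "frame z" y], of Re]
      by (simp add: sesq_add_left sesq_add_right)
    moreover have "\<bar>Re (sesq (G ?w) y (frame z)) - Re (sesq (G a + del z) y x)\<bar> \<le> B * (norm z)\<^sup>2 * norm y"
    proof -
      have "sesq (G ?w) y (frame z) - sesq (G a + del z) y x
          = sesq (G ?w - G a - D1 z) y x + sesq (G ?w - G a) y (corr z)"
        by (simp add: frame_def sesq_add_right sesq_diff_matrix sesq_add_matrix D1_eq sesq_G_corr_right)
      moreover have "cmod (sesq (G ?w - G a - D1 z) y x) \<le> m * (C * norm z ^ 2) * norm y * norm x"
        unfolding m_def by (rule sesq_bound[OF C(3)[OF z]])
      moreover have "cmod (sesq (G ?w - G a) y (corr z)) \<le> m * (C * norm z) * norm y * (L * norm z)"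
        unfolding m_def by (rule sesq_bound_le[OF C(2)[OF z] order_refl L(2)])
      ultimately have "cmod (sesq (G ?w) y (frame z) - sesq (G a + del z) y x)
          \<le> m * (C * norm z ^ 2) * norm y * norm x + m * (C * norm z) * norm y * (L * norm z)"
        by (simp add: norm_triangle_le)
      also have "\<dots> = B * (norm z)\<^sup>2 * norm y"
        by (simp add: B_def power2_eq_square algebra_simps)
      finally show ?thesis using abs_Re_le_cmod[of "sesq (G ?w) y (frame z) - sesq (G a + del z) y x"] by simp
    qed
    moreover have "c * (norm y)\<^sup>2 \<le> Re (sesq (G ?w) y y)" by (rule c(2)[OF w(1)])
    moreover have "0 \<le> c * (norm y)\<^sup>2 - 2 * (B * (norm z)\<^sup>2 * norm y) + B\<^sup>2 / c * norm z ^ 4"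
    proof -
      have "c * (norm y)\<^sup>2 - 2 * (B * (norm z)\<^sup>2 * norm y) + B\<^sup>2 / c * norm z ^ 4 = c * (norm y - B * (norm z)\<^sup>2 / c)\<^sup>2"
        using c(1) by (simp add: power2_eq_square eval_nat_numeral field_simps)
      then show ?thesis using c(1) by simp
    qed
    ultimately show ?thesis by (smt (verit))
  qed
  moreover have "B\<^sup>2 / c \<ge> 0" using c(1) by simp
  ultimately show ?thesis by blast
qed

end


section \<open>Integration over small balanced sets\<close>

text \<open>Holomorphy of several variables enters only through the complex lines through the base point.\<close>

lemma holomorphic_map_on_line:
  fixes f :: "complex^'n::finite \<Rightarrow> complex^'m::finite"
  assumes "holomorphic_map_on S f" "a + w *s z \<in> S"
  shows "(\<lambda>w. f (a + w *s z) $ \<beta>) field_differentiable (at w)"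
proof -
  obtain D where D: "(f has_derivative D) (at (a + w *s z))" "\<And>c v. D (c *s v) = c *s D v"
    using assms by (auto simp: holomorphic_map_on_def)
  have "bounded_linear (\<lambda>c. c *s z)"
    unfolding linear_conv_bounded_linear[symmetric] linear_iff
    by (simp add: vector_sadd_rdistrib scaleR_vector_smult vector_smult_assoc scaleR_conv_of_real[where 'a=complex])
  then have "((\<lambda>w. a + w *s z) has_derivative (\<lambda>h. h *s z)) (at w)"
    by (auto intro!: derivative_eq_intros bounded_linear.has_derivative[of "\<lambda>c. c *s z"])
  from has_derivative_compose[OF this D(1)]
  have "((\<lambda>w. f (a + w *s z)) has_derivative (\<lambda>h. h *s D z)) (at w)" by (simp add: D(2))
  from bounded_linear.has_derivative[OF bounded_linear_vec_nth this]
  have "((\<lambda>w. f (a + w *s z) $ \<beta>) has_derivative (\<lambda>h. D z $ \<beta> * h)) (at w)"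
    by (simp add: mult.commute)
  then show ?thesis
    unfolding field_differentiable_def has_field_derivative_def by (metis (no_types))
qed

lemma holomorphic_map_on_imp_continuous: "holomorphic_map_on S f \<Longrightarrow> continuous_on S f"
  unfolding holomorphic_map_on_def
  by (meson continuous_at_imp_continuous_on has_derivative_continuous)

context hermitian_matrix_map
begin

lemma continuous_on_G: "continuous_on U G"
  using smooth_G Ck_on_imp_continuous by (auto simp: smooth_map_on_def)

lemma continuous_on_frame [continuous_intros]: "continuous_on S frame"
  unfolding frame_def[abs_def] by (intro continuous_intros)

lemma continuous_on_del: "continuous_on S del"
  unfolding del_def[abs_def] by (intro continuous_intros)

lemma continuous_on_Q:
  assumes "cball a \<rho> \<subseteq> U"
  shows "continuous_on (cball 0 \<rho>) Q"
  unfolding Q_def[abs_def]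
proof (intro continuous_intros)
  show "continuous_on (cball 0 \<rho>) (\<lambda>z. G (a + z))"
    using assms by (intro continuous_on_compose2[OF continuous_on_G] continuous_intros) (auto simp: dist_norm)
qed

lemma set_integrable_Q:
  assumes "cball a \<rho> \<subseteq> U" "P \<subseteq> cball 0 \<rho>" "open P"
  shows "set_integrable lborel P Q"
proof -
  have "set_integrable lborel (cball 0 \<rho>) Q"
    unfolding set_integrable_def by (rule borel_integrable_compact[OF compact_cball continuous_on_Q[OF assms(1)]])
  then show ?thesis by (rule set_integrable_subset) (use assms in auto)
qed

lemma LINT_Q:
  assumes ball: "cball a \<rho>\<^sub>0 \<subseteq> U" and \<rho>\<^sub>0: "0 \<le> \<rho>\<^sub>0"
  shows "\<exists>C\<ge>0. \<forall>\<rho> P. open P \<longrightarrow> balanced P \<longrightarrow> \<rho> \<le> \<rho>\<^sub>0 \<longrightarrow> P \<subseteq> cball 0 \<rho> \<longrightarrow>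
    \<bar>(LINT z:P|lborel. Q z) - (N * measure lborel P - (LINT z:P|lborel. Re (curv z)))\<bar> \<le> C * \<rho> ^ 4 * measure lborel P"
proof -
  obtain C where C: "C \<ge> 0" "\<And>z. norm z \<le> \<rho>\<^sub>0 \<Longrightarrow>
    \<bar>(Q z + Q (- z) + Q (\<i> *s z) + Q (- (\<i> *s z))) / 4 - (N - Re (curv z))\<bar> \<le> C * norm z ^ 4"
    using Q_average[OF assms] by blast
  have "\<bar>(LINT z:P|lborel. Q z) - (N * measure lborel P - (LINT z:P|lborel. Re (curv z)))\<bar> \<le> C * \<rho> ^ 4 * measure lborel P"
    if P: "open P" "balanced P" "\<rho> \<le> \<rho>\<^sub>0" "P \<subseteq> cball 0 \<rho>" for \<rho> P
  proof -
    have bP: "bounded P" using P(4) bounded_cball bounded_subset by blast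
    have Pb: "P \<in> sets borel" using P(1) by (simp add: borel_open)
    have sub: "P \<subseteq> cball 0 \<rho>\<^sub>0" using P by auto
    have iQ: "set_integrable lborel P (\<lambda>z. Q (c *s z))" if "cmod c = 1" for c
    proof -
      have "continuous_on (cball 0 \<rho>\<^sub>0) (\<lambda>z. Q (c *s z))"
        using that by (intro continuous_on_compose2[OF continuous_on_Q[OF ball]] continuous_intros) (auto simp: norm_vector_smult)
      then have "set_integrable lborel (cball 0 \<rho>\<^sub>0) (\<lambda>z. Q (c *s z))"
        unfolding set_integrable_def by (rule borel_integrable_compact[OF compact_cball])
      then show ?thesis by (rule set_integrable_subset) (use Pb sub in auto)
    qed
    have i4: "set_integrable lborel P (\<lambda>z. Q z)" "set_integrable lborel P (\<lambda>z. Q (- z))"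
        "set_integrable lborel P (\<lambda>z. Q (\<i> *s z))" "set_integrable lborel P (\<lambda>z. Q (- (\<i> *s z)))"
      using iQ[of 1] iQ[of "-1"] iQ[of \<i>] iQ[of "-\<i>"] by simp_all
    have ic: "set_integrable lborel P (\<lambda>z. Re (curv z))" "set_integrable lborel P (\<lambda>z. N)"
        "set_integrable lborel P (\<lambda>z. C * \<rho> ^ 4)" "set_integrable lborel P (\<lambda>z. - (C * \<rho> ^ 4))"
      by (intro set_integrable_bounded_continuous bP Pb continuous_intros)+
    let ?A = "\<lambda>z. (Q z + Q (- z) + Q (\<i> *s z) + Q (- (\<i> *s z))) / 4"
    have const: "(LINT z:P|lborel. k) = k * measure lborel P" for k :: real
      using emeasure_bounded_finite[OF bP] Pb by (simp add: set_lebesgue_integral_def)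
    have rot: "(LINT z:P|lborel. Q (c *s z)) = (LINT z:P|lborel. Q z)" if "cmod c = 1" for c
      by (rule balanced_LINT_smult[OF P(2) that])
    have "(LINT z:P|lborel. ?A z) = ((LINT z:P|lborel. Q z) + (LINT z:P|lborel. Q (- z))
        + (LINT z:P|lborel. Q (\<i> *s z)) + (LINT z:P|lborel. Q (- (\<i> *s z)))) / 4"
      using i4 by (simp add: set_integral_add)
    also have "\<dots> = (LINT z:P|lborel. Q z)"
      using rot[of "-1"] rot[of \<i>] rot[of "-\<i>"] by simp
    finally have A: "(LINT z:P|lborel. ?A z) = (LINT z:P|lborel. Q z)" .
    have iA: "set_integrable lborel P ?A"
      using i4 by (intro set_integrable_divide set_integral_add)
    have bd: "\<bar>?A z - (N - Re (curv z))\<bar> \<le> C * \<rho> ^ 4" if "z \<in> P" for z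
    proof -
      have z: "norm z \<le> \<rho>" "norm z \<le> \<rho>\<^sub>0" using that P by auto
      have "\<bar>?A z - (N - Re (curv z))\<bar> \<le> C * norm z ^ 4" by (rule C(2)[OF z(2)])
      also have "\<dots> \<le> C * \<rho> ^ 4" using z C(1) by (intro mult_left_mono power_mono) auto
      finally show ?thesis .
    qed
    have eq: "(LINT z:P|lborel. ?A z - (N - Re (curv z))) = (LINT z:P|lborel. Q z) - (N * measure lborel P - (LINT z:P|lborel. Re (curv z)))"
      unfolding set_integral_diff(2)[OF iA set_integral_diff(1)[OF ic(2,1)]] set_integral_diff(2)[OF ic(2,1)] A const ..
    have iD: "set_integrable lborel P (\<lambda>z. ?A z - (N - Re (curv z)))"
      using iA ic by (intro set_integral_diff)
    have "(LINT z:P|lborel. ?A z - (N - Re (curv z))) \<le> (LINT z:P|lborel. C * \<rho> ^ 4)"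
      using bd by (intro set_integral_mono iD ic) (simp add: abs_le_iff)
    moreover have "(LINT z:P|lborel. - (C * \<rho> ^ 4)) \<le> (LINT z:P|lborel. ?A z - (N - Re (curv z)))"
    proof (intro set_integral_mono iD ic)
      fix z assume "z \<in> P"
      from bd[OF this] show "- (C * \<rho> ^ 4) \<le> ?A z - (N - Re (curv z))" by linarith
    qed
    ultimately show ?thesis
      unfolding eq const by (simp add: abs_le_iff)
  qed
  then show ?thesis using C(1) by blast
qed

text \<open>The holomorphic part of the cross term between \<open>frame\<close> and another extension \<open>f\<close>, as in \<open>Q_lower\<close>.\<close>

definition pairing :: "(complex^'n \<Rightarrow> complex^'m) \<Rightarrow> complex^'n \<Rightarrow> complex" where
  "pairing f z = sesq (G a + del z) (f (a + z) - frame z) x"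

text \<open>The pairing is holomorphic along complex lines through \<open>0\<close> and vanishes at \<open>0\<close>, where \<open>f\<close> and \<open>frame\<close>
agree.\<close>

lemma LINT_pairing:
  assumes P: "open P" "bounded P" "balanced P" "0 \<in> P"
    and f: "holomorphic_map_on ((+) a ` P) f" "f a = x"
    and int: "set_integrable lborel P (pairing f)"
  shows "(LINT z:P|lborel. pairing f z) = 0"
proof -
  have "(LINT z:P|lborel. pairing f z) = measure lborel P * pairing f 0"
  proof (rule mean_value_balanced[OF P(1,2,3) _ int])
    fix z assume z: "z \<in> P"
    have dl: "del (w *s z) $ \<alpha> $ \<beta> = w * del z $ \<alpha> $ \<beta>" for w \<alpha> \<beta>
      by (simp add: del_def sum_distrib_left mult_ac)
    have "(\<lambda>w. pairing f (w *s z)) field_differentiable (at w within cball 0 1)" if "w \<in> cball 0 1" for w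
    proof -
      have "a + w *s z \<in> (+) a ` P" using z that P(3) by (auto simp: balanced_def)
      note d = holomorphic_map_on_line[OF f(1) this]
      have "(\<lambda>w. pairing f (w *s z)) field_differentiable (at w)"
        unfolding pairing_def sesq_entries frame_def corr_smult vector_add_component dl vector_minus_component vector_smult_component
        by (intro field_differentiable_sum field_differentiable_mult field_differentiable_add
            field_differentiable_diff field_differentiable_const field_differentiable_ident d)
      then show ?thesis by (rule field_differentiable_at_within)
    qed
    then show "(\<lambda>w. pairing f (w *s z)) holomorphic_on cball 0 1"
      by (simp add: holomorphic_on_def)
  qed
  then show ?thesis using f(2) by (simp add: pairing_def frame_def)
qed

text \<open>Square integrability of \<open>f\<close> is given with respect to \<open>G\<close>. Since \<open>G\<close> is uniformly positive and
\<open>P\<close> is bounded, \<open>|f| \<le> 1 + |f|\<^sup>2\<close> makes \<open>f\<close> itself integrable, and the coefficients of the pairing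
are bounded.\<close>

lemma set_integrable_pairing:
  assumes ball: "cball a \<rho> \<subseteq> U" and \<rho>: "0 \<le> \<rho>"
    and P: "open P" "P \<subseteq> cball 0 \<rho>"
    and f: "continuous_on ((+) a ` P) f"
    and int: "set_integrable lborel P (\<lambda>z. Re (sesq (G (a + z)) (f (a + z)) (f (a + z))))"
  shows "set_integrable lborel P (pairing f)"
proof -
  have bP: "bounded P" using P(2) bounded_cball bounded_subset by blast
  have Pb: "P \<in> sets borel" using P(1) by (simp add: borel_open)
  have cf: "continuous_on P (\<lambda>z. f (a + z))"
    by (rule continuous_on_compose2[OF f]) (auto intro!: continuous_intros)
  obtain c where c: "c > 0" "\<And>z y. z \<in> cball a \<rho> \<Longrightarrow> c * (norm y)\<^sup>2 \<le> Re (sesq (G z) y y)"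
    using G_uniformly_positive[OF ball \<rho>] by blast
  have "bounded ((\<lambda>z. G a + del z) ` cball 0 \<rho>)"
    by (intro compact_imp_bounded compact_continuous_image compact_cball continuous_intros continuous_on_del)
  then obtain K where K: "K > 0" "\<And>z. z \<in> cball 0 \<rho> \<Longrightarrow> norm (G a + del z) \<le> K"
    unfolding bounded_pos by blast
  have "bounded (frame ` cball 0 \<rho>)"
    by (intro compact_imp_bounded compact_continuous_image compact_cball continuous_intros)
  then obtain F where F: "F > 0" "\<And>z. z \<in> cball 0 \<rho> \<Longrightarrow> norm (frame z) \<le> F"
    unfolding bounded_pos by blast
  define B where "B = (real CARD('m))\<^sup>2 * K * norm x"
  have B: "B \<ge> 0" using K by (simp add: B_def)
  let ?g = "\<lambda>z. B * (1 + F + Re (sesq (G (a + z)) (f (a + z)) (f (a + z))) / c)"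
  have "set_integrable lborel P ?g"
  proof -
    have "set_integrable lborel P (\<lambda>z. 1 :: real)" "set_integrable lborel P (\<lambda>z. F)"
      by (intro set_integrable_bounded_continuous bP Pb continuous_intros)+
    then show ?thesis using int by (intro set_integrable_mult_right set_integral_add set_integrable_divide)
  qed
  then show ?thesis
  proof (rule set_integrable_bound)
    show "set_borel_measurable lborel P (pairing f)"
      unfolding pairing_def[abs_def]
      by (intro set_borel_measurable_continuous_open P continuous_intros continuous_on_del cf)
    show "AE z in lborel. z \<in> P \<longrightarrow> norm (pairing f z) \<le> norm (?g z)"
    proof (intro AE_I2 impI)
      fix z assume z: "z \<in> P"
      have zc: "z \<in> cball 0 \<rho>" "a + z \<in> cball a \<rho>" using z P by (auto simp: dist_norm)
      have "cmod ((G a + del z) $ \<alpha> $ \<beta>) \<le> K" for \<alpha> \<beta>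
        using K(2)[OF zc(1)] Finite_Cartesian_Product.norm_nth_le[of "G a + del z" \<alpha>] Finite_Cartesian_Product.norm_nth_le[of "(G a + del z) $ \<alpha>" \<beta>] by linarith
      then have "norm (pairing f z) \<le> (real CARD('m))\<^sup>2 * K * norm (f (a + z) - frame z) * norm x"
        unfolding pairing_def by (rule sesq_bound)
      also have "\<dots> = B * norm (f (a + z) - frame z)" by (simp add: B_def)
      also have "\<dots> \<le> ?g z"
      proof (rule mult_left_mono[OF _ B])
        have "norm (f (a + z) - frame z) \<le> norm (f (a + z)) + F"
          using norm_triangle_ineq4[of "f (a + z)" "frame z"] F(2)[OF zc(1)] by linarith
        moreover have "norm (f (a + z)) \<le> 1 + (norm (f (a + z)))\<^sup>2"
          using zero_le_power2[of "norm (f (a + z)) - 1/2"] by (simp add: power2_eq_square algebra_simps)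
        moreover have "(norm (f (a + z)))\<^sup>2 \<le> Re (sesq (G (a + z)) (f (a + z)) (f (a + z))) / c"
          using c(2)[OF zc(2), of "f (a + z)"] c(1) by (simp add: field_simps)
        ultimately show "norm (f (a + z) - frame z) \<le> 1 + F + Re (sesq (G (a + z)) (f (a + z)) (f (a + z))) / c" by linarith
      qed
      finally show "norm (pairing f z) \<le> norm (?g z)" by simp
    qed
  qed
qed

lemma LINT_lower:
  assumes ball: "cball a \<rho>\<^sub>0 \<subseteq> U" and \<rho>\<^sub>0: "0 \<le> \<rho>\<^sub>0"
  shows "\<exists>C\<ge>0. \<forall>\<rho> P f. open P \<longrightarrow> balanced P \<longrightarrow> 0 \<in> P \<longrightarrow> \<rho> \<le> \<rho>\<^sub>0 \<longrightarrow> P \<subseteq> cball 0 \<rho> \<longrightarrow>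
    holomorphic_map_on ((+) a ` P) f \<longrightarrow> f a = x \<longrightarrow>
    set_integrable lborel P (\<lambda>z. Re (sesq (G (a + z)) (f (a + z)) (f (a + z)))) \<longrightarrow>
    (LINT z:P|lborel. Q z) - C * \<rho> ^ 4 * measure lborel P
      \<le> (LINT z:P|lborel. Re (sesq (G (a + z)) (f (a + z)) (f (a + z))))"
proof -
  obtain C where C: "C \<ge> 0" "\<And>z y. norm z \<le> \<rho>\<^sub>0 \<Longrightarrow>
    Q z + 2 * Re (sesq (G a + del z) y x) - C * norm z ^ 4 \<le> Re (sesq (G (a + z)) (frame z + y) (frame z + y))"
    using Q_lower[OF assms] by blast
  have "(LINT z:P|lborel. Q z) - C * \<rho> ^ 4 * measure lborel P
      \<le> (LINT z:P|lborel. Re (sesq (G (a + z)) (f (a + z)) (f (a + z))))"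
    if P: "open P" "balanced P" "0 \<in> P" "\<rho> \<le> \<rho>\<^sub>0" "P \<subseteq> cball 0 \<rho>"
      and f: "holomorphic_map_on ((+) a ` P) f" "f a = x"
      and int: "set_integrable lborel P (\<lambda>z. Re (sesq (G (a + z)) (f (a + z)) (f (a + z))))" for \<rho> P f
  proof -
    have bP: "bounded P" using P(5) bounded_cball bounded_subset by blast
    have Pb: "P \<in> sets borel" using P(1) by (simp add: borel_open)
    have sub: "P \<subseteq> cball 0 \<rho>\<^sub>0" using P by auto
    have const: "(LINT z:P|lborel. k) = k * measure lborel P" for k :: real
      using emeasure_bounded_finite[OF bP] Pb by (simp add: set_lebesgue_integral_def)
    have ip: "set_integrable lborel P (pairing f)"
      by (rule set_integrable_pairing[OF assms P(1) sub holomorphic_map_on_imp_continuous[OF f(1)] int])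
    then have ipR: "set_integrable lborel P (\<lambda>z. Re (pairing f z))"
      unfolding set_integrable_def using integrable_Re by fastforce
    have LR: "(LINT z:P|lborel. Re (pairing f z)) = 0"
    proof -
      have "(LINT z:P|lborel. Re (pairing f z)) = Re (LINT z:P|lborel. pairing f z)"
        using ip unfolding set_integrable_def set_lebesgue_integral_def by (subst integral_Re[symmetric]) auto
      then show ?thesis using LINT_pairing[OF P(1) bP P(2,3) f ip] by simp
    qed
    have iQ: "set_integrable lborel P Q" by (rule set_integrable_Q[OF ball sub P(1)])
    have ic: "set_integrable lborel P (\<lambda>z. C * \<rho> ^ 4)"
      by (intro set_integrable_bounded_continuous bP Pb continuous_intros)
    have i2: "set_integrable lborel P (\<lambda>z. 2 * Re (pairing f z))"
      using ipR by (rule set_integrable_mult_right)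
    have "(LINT z:P|lborel. Q z) - C * \<rho> ^ 4 * measure lborel P = (LINT z:P|lborel. Q z + 2 * Re (pairing f z) - C * \<rho> ^ 4)"
      using iQ ic i2 by (simp add: set_integral_add set_integral_diff const LR)
    also have "\<dots> \<le> (LINT z:P|lborel. Re (sesq (G (a + z)) (f (a + z)) (f (a + z))))"
    proof (rule set_integral_mono)
      show "set_integrable lborel P (\<lambda>z. Q z + 2 * Re (pairing f z) - C * \<rho> ^ 4)"
        using iQ ic i2 by (intro set_integral_diff set_integral_add)
      fix z assume "z \<in> P"
      then have z: "norm z \<le> \<rho>" "norm z \<le> \<rho>\<^sub>0" using P by auto
      have "C * norm z ^ 4 \<le> C * \<rho> ^ 4" using z C(1) by (intro mult_left_mono power_mono) auto
      moreover have "frame z + (f (a + z) - frame z) = f (a + z)" by simp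
      ultimately show "Q z + 2 * Re (pairing f z) - C * \<rho> ^ 4 \<le> Re (sesq (G (a + z)) (f (a + z)) (f (a + z)))"
        using C(2)[OF z(2), of "f (a + z) - frame z"] by (simp add: pairing_def)
    qed (rule int)
    finally show ?thesis .
  qed
  then show ?thesis using C(1) by (intro exI[of _ C]) blast
qed

end


section \<open>Hermitian metrics in a trivialization\<close>

locale hermitian_bundle =
  fixes \<Omega> :: "(complex^'n::finite) set" and E :: "('e, 'n, 'm::finite) vbundle" and h :: "'e \<Rightarrow> 'e \<Rightarrow> complex"
  assumes hol_bundle: "holomorphic_vector_bundle \<Omega> E" and herm_metric: "smooth_hermitian_metric \<Omega> E h"
begin

lemmas bundle_conjuncts = hol_bundle[unfolded holomorphic_vector_bundle_def, THEN conjunct2]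

lemma bundle_fibres:
  assumes "z \<in> \<Omega>"
  shows "vb_zero E z \<in> fibre E z \<and>
     (\<forall>u\<in>fibre E z. \<forall>v\<in>fibre E z. vb_add E u v \<in> fibre E z) \<and>
     (\<forall>c. \<forall>u\<in>fibre E z. vb_scale E c u \<in> fibre E z)"
  using bundle_conjuncts[THEN conjunct1] assms by (rule bspec)

lemma atlas_covers: "(\<Union>(U, \<phi>)\<in>vb_atlas E. U) = \<Omega>"
  using bundle_conjuncts[THEN conjunct2, THEN conjunct1] .

lemma bundle_charts:
  assumes "(U, \<phi>) \<in> vb_atlas E"
  shows "open U \<and> (\<forall>z\<in>U. bij_betw \<phi> (fibre E z) UNIV \<and> \<phi> (vb_zero E z) = 0 \<and>
           (\<forall>u\<in>fibre E z. \<forall>v\<in>fibre E z. \<phi> (vb_add E u v) = \<phi> u + \<phi> v) \<and>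
           (\<forall>c. \<forall>u\<in>fibre E z. \<phi> (vb_scale E c u) = c *s \<phi> u))"
  by (rule bspec[OF bundle_conjuncts[THEN conjunct2, THEN conjunct2, THEN conjunct1] assms, unfolded prod.case])

lemma transition_holomorphic:
  assumes "(U, \<phi>) \<in> vb_atlas E" "(V, \<psi>) \<in> vb_atlas E"
  shows "holomorphic_map_on (U \<inter> V) (\<lambda>z. \<psi> (triv_inv E \<phi> z w))"
  using bspec[OF bspec[OF bundle_conjuncts[THEN conjunct2, THEN conjunct2, THEN conjunct2] assms(1), unfolded prod.case] assms(2),
      unfolded prod.case] by (rule spec)

lemma atlas_open: "(U, \<phi>) \<in> vb_atlas E \<Longrightarrow> open U"
  using bundle_charts by blast

lemma atlas_subset: "(U, \<phi>) \<in> vb_atlas E \<Longrightarrow> U \<subseteq> \<Omega>"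
  using atlas_covers by blast

lemma trivialization:
  assumes "(U, \<phi>) \<in> vb_atlas E" "z \<in> U"
  shows "bij_betw \<phi> (fibre E z) UNIV" "\<phi> (vb_zero E z) = 0"
    "\<And>u v. u \<in> fibre E z \<Longrightarrow> v \<in> fibre E z \<Longrightarrow> \<phi> (vb_add E u v) = \<phi> u + \<phi> v"
    "\<And>c u. u \<in> fibre E z \<Longrightarrow> \<phi> (vb_scale E c u) = c *s \<phi> u"
  using bspec[OF conjunct2[OF bundle_charts[OF assms(1)]] assms(2)] by blast+

lemma fibre_closed:
  assumes "z \<in> \<Omega>"
  shows "vb_zero E z \<in> fibre E z" "\<And>u v. u \<in> fibre E z \<Longrightarrow> v \<in> fibre E z \<Longrightarrow> vb_add E u v \<in> fibre E z"
    "\<And>c u. u \<in> fibre E z \<Longrightarrow> vb_scale E c u \<in> fibre E z"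
  using bundle_fibres[OF assms] by blast+

lemmas metric_conjuncts = herm_metric[unfolded smooth_hermitian_metric_def]

lemma metric_sesquilinear:
  assumes "z \<in> \<Omega>"
  shows "\<And>u v w. u \<in> fibre E z \<Longrightarrow> v \<in> fibre E z \<Longrightarrow> w \<in> fibre E z \<Longrightarrow> h (vb_add E u v) w = h u w + h v w"
    "\<And>c u v. u \<in> fibre E z \<Longrightarrow> v \<in> fibre E z \<Longrightarrow> h (vb_scale E c u) v = c * h u v"
    "\<And>u v. u \<in> fibre E z \<Longrightarrow> v \<in> fibre E z \<Longrightarrow> h v u = cnj (h u v)"
    "\<And>u. u \<in> fibre E z \<Longrightarrow> u \<noteq> vb_zero E z \<Longrightarrow> 0 < Re (h u u)"
  using bspec[OF conjunct1[OF metric_conjuncts] assms] by blast+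

lemma gram_smooth:
  assumes "(U, \<phi>) \<in> vb_atlas E"
  shows "smooth_map_on U (gram E h \<phi>)"
  by (rule bspec[OF conjunct2[OF metric_conjuncts] assms, unfolded prod.case])

context
  fixes U \<phi> assumes chart: "(U, \<phi>) \<in> vb_atlas E"
begin

lemma triv_inv_fibre: "z \<in> U \<Longrightarrow> triv_inv E \<phi> z w \<in> fibre E z"
  unfolding triv_inv_def using trivialization(1)[OF chart]
  by (intro the_inv_into_into) (auto simp: bij_betw_def)

lemma triv_triv_inv: "z \<in> U \<Longrightarrow> \<phi> (triv_inv E \<phi> z w) = w"
  unfolding triv_inv_def using trivialization(1)[OF chart]
  by (intro f_the_inv_into_f) (auto simp: bij_betw_def)

lemma triv_inv_triv: "z \<in> U \<Longrightarrow> u \<in> fibre E z \<Longrightarrow> triv_inv E \<phi> z (\<phi> u) = u"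
  unfolding triv_inv_def using trivialization(1)[OF chart]
  by (intro the_inv_into_f_f) (auto simp: bij_betw_def)

lemma triv_inv_add: "z \<in> U \<Longrightarrow> triv_inv E \<phi> z (s + t) = vb_add E (triv_inv E \<phi> z s) (triv_inv E \<phi> z t)"
  using triv_inv_triv[of z "vb_add E (triv_inv E \<phi> z s) (triv_inv E \<phi> z t)"] atlas_subset[OF chart]
  by (simp add: trivialization(3)[OF chart] triv_inv_fibre triv_triv_inv fibre_closed(2) subset_iff)

lemma triv_inv_smult: "z \<in> U \<Longrightarrow> triv_inv E \<phi> z (c *s s) = vb_scale E c (triv_inv E \<phi> z s)"
  using triv_inv_triv[of z "vb_scale E c (triv_inv E \<phi> z s)"] atlas_subset[OF chart]
  by (simp add: trivialization(4)[OF chart] triv_inv_fibre triv_triv_inv fibre_closed(3) subset_iff)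

lemma metric_eq_sesq:
  assumes z: "z \<in> U"
  shows "h (triv_inv E \<phi> z s) (triv_inv E \<phi> z t) = sesq (gram E h \<phi> z) s t"
proof -
  have z\<Omega>: "z \<in> \<Omega>" using z atlas_subset[OF chart] by blast
  note f = triv_inv_fibre[OF z]
  show ?thesis
    unfolding gram_def
  proof (rule sesquilinear_eq_sesq[of "\<lambda>s t. h (triv_inv E \<phi> z s) (triv_inv E \<phi> z t)"])
    fix s s' t c
    show "h (triv_inv E \<phi> z (s + s')) (triv_inv E \<phi> z t) = h (triv_inv E \<phi> z s) (triv_inv E \<phi> z t) + h (triv_inv E \<phi> z s') (triv_inv E \<phi> z t)"
      unfolding triv_inv_add[OF z] by (rule metric_sesquilinear(1)[OF z\<Omega> f f f])
    show "h (triv_inv E \<phi> z (c *s s)) (triv_inv E \<phi> z t) = c * h (triv_inv E \<phi> z s) (triv_inv E \<phi> z t)"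
      unfolding triv_inv_smult[OF z] by (rule metric_sesquilinear(2)[OF z\<Omega> f f])
    show "h (triv_inv E \<phi> z t) (triv_inv E \<phi> z s) = cnj (h (triv_inv E \<phi> z s) (triv_inv E \<phi> z t))"
      by (rule metric_sesquilinear(3)[OF z\<Omega> f f])
  qed
qed

lemma metric_eq_sesq_fibre:
  assumes "z \<in> U" "u \<in> fibre E z" "v \<in> fibre E z"
  shows "h u v = sesq (gram E h \<phi> z) (\<phi> u) (\<phi> v)"
  using metric_eq_sesq[OF assms(1), of "\<phi> u" "\<phi> v"] by (simp add: triv_inv_triv assms)

text \<open>The bridge to the coordinate computations: every trivialization gives a Gram matrix to which the
preceding sections apply.\<close>

lemma hermitian_matrix_map_gram:
  assumes "a \<in> U"
  shows "hermitian_matrix_map U (gram E h \<phi>) a"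
proof
  show "open U" by (rule atlas_open[OF chart])
  show "smooth_map_on U (gram E h \<phi>)" by (rule gram_smooth[OF chart])
  fix z assume z: "z \<in> U"
  then have z\<Omega>: "z \<in> \<Omega>" using atlas_subset[OF chart] by blast
  show "gram E h \<phi> z $ \<beta> $ \<alpha> = cnj (gram E h \<phi> z $ \<alpha> $ \<beta>)" for \<alpha> \<beta>
    unfolding gram_def vec_lambda_beta
    by (rule metric_sesquilinear(3)[OF z\<Omega> triv_inv_fibre[OF z] triv_inv_fibre[OF z]])
  fix s :: "complex^'m" assume s: "s \<noteq> 0"
  have "triv_inv E \<phi> z s \<noteq> vb_zero E z"
    using s triv_triv_inv[OF z, of s] trivialization(2)[OF chart z] by metis
  then show "0 < Re (sesq (gram E h \<phi> z) s s)"
    using metric_sesquilinear(4)[OF z\<Omega> triv_inv_fibre[OF z]] metric_eq_sesq[OF z] by metis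
qed (rule assms)

text \<open>A section given by holomorphic coefficients \<open>c\<close> in one trivialization is holomorphic in every other
one: in terms of the transition functions \<open>w \<beta>\<close>, the images of the frame vectors, its coefficients are
\<open>\<Sum>\<^sub>\<beta> c\<^sub>\<beta> w \<beta>\<close>, and the product rule preserves complex linearity of the derivative.\<close>

lemma holomorphic_section_local:
  assumes D: "D \<subseteq> U"
    and c: "\<And>z. z \<in> D \<Longrightarrow> \<exists>c'. (c has_derivative c') (at z) \<and> (\<forall>k v. c' (k *s v) = k *s c' v)"
  shows "holomorphic_section E D (\<lambda>z. triv_inv E \<phi> z (c z))"
  unfolding holomorphic_section_def
proof (intro conjI ballI, goal_cases)
  case (1 z)
  then show ?case using triv_inv_fibre D by blast
next
  case (2 p)
  obtain V \<psi> where p: "p = (V, \<psi>)" by (cases p)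
  have V: "(V, \<psi>) \<in> vb_atlas E" using 2 p by simp
  have "holomorphic_map_on (D \<inter> V) (\<lambda>z. \<psi> (triv_inv E \<phi> z (c z)))"
    unfolding holomorphic_map_on_def
  proof
    fix z assume z: "z \<in> D \<inter> V"
    then have zUV: "z \<in> U \<inter> V" using D by blast
    obtain c' where c': "(c has_derivative c') (at z)" "\<And>k v. c' (k *s v) = k *s c' v" using c z by blast
    define w where "w = (\<lambda>\<beta> z. \<psi> (triv_inv E \<phi> z (axis \<beta> 1)))"
    have "\<exists>D. (w \<beta> has_derivative D) (at z) \<and> (\<forall>k v. D (k *s v) = k *s D v)" for \<beta>
      using transition_holomorphic[OF chart V, of "axis \<beta> 1"] zUV unfolding holomorphic_map_on_def w_def by blast
    then obtain w' where w': "\<And>\<beta>. (w \<beta> has_derivative w' \<beta>) (at z)" "\<And>\<beta> k v. w' \<beta> (k *s v) = k *s w' \<beta> v" by metis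
    have eq: "\<psi> (triv_inv E \<phi> y s) = (\<Sum>\<beta>\<in>UNIV. s $ \<beta> *s w \<beta> y)" if y: "y \<in> U \<inter> V" for y s
    proof -
      let ?f = "\<lambda>s. \<psi> (triv_inv E \<phi> y s)"
      have yU: "y \<in> U" "y \<in> V" using y by auto
      have add: "?f (s + t) = ?f s + ?f t" for s t
        by (simp add: triv_inv_add yU trivialization(3)[OF V yU(2)] triv_inv_fibre)
      have smult: "?f (k *s s) = k *s ?f s" for k s
        by (simp add: triv_inv_smult yU trivialization(4)[OF V yU(2)] triv_inv_fibre)
      have zero: "?f 0 = 0" using smult[of 0 0] by simp
      have sum: "?f (\<Sum>i\<in>I. g i) = (\<Sum>i\<in>I. ?f (g i))" for I :: "'m set" and g
        by (induction I rule: infinite_finite_induct) (simp_all add: zero add)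
      show ?thesis
        unfolding w_def by (subst basis_expansion[of s, symmetric]) (simp only: sum smult)
    qed
    define F' where "F' = (\<lambda>v. \<Sum>\<beta>\<in>UNIV. c z $ \<beta> *s w' \<beta> v + c' v $ \<beta> *s w \<beta> z)"
    have "((\<lambda>y. \<Sum>\<beta>\<in>UNIV. c y $ \<beta> *s w \<beta> y) has_derivative F') (at z)"
      unfolding F'_def
      by (intro has_derivative_sum bounded_bilinear.FDERIV[OF bounded_bilinear_vector_smult]
        bounded_linear.has_derivative[OF bounded_linear_vec_nth] c'(1) w'(1))
    then have "((\<lambda>y. \<psi> (triv_inv E \<phi> y (c y))) has_derivative F') (at z)"
      by (rule has_derivative_transform_within_open[where s = "U \<inter> V"])
        (use atlas_open[OF chart] atlas_open[OF V] zUV eq in auto)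
    moreover have "F' (k *s v) = k *s F' v" for k v
      by (simp add: F'_def c'(2) w'(2) vec_eq_iff sum_distrib_left algebra_simps)
    ultimately show "\<exists>D. ((\<lambda>z. \<psi> (triv_inv E \<phi> z (c z))) has_derivative D) (at z) \<and> (\<forall>k v. D (k *s v) = k *s D v)"
      by blast
  qed
  then show ?case by (simp add: p)
qed

end

end


section \<open>The extension index of a balanced set\<close>

text \<open>In the expansion of the form along the columns of \<open>A\<close> only the diagonal terms survive integration.\<close>

lemma LINT_biball_sesq:
  fixes A :: "complex^'n::finite^'n"
  assumes r: "0 < r" and s: "0 < s"
  shows "(LINT w:biball J r s|lborel. sesq M (A *v w) (A *v w)) = measure lborel (biball J r s) *
     (\<Sum>l\<in>UNIV. of_real (if l \<in> J then r\<^sup>2 / (real (card J) + 1) else s\<^sup>2 / (real (card (- J)) + 1)) *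
        sesq M (A *v axis l 1) (A *v axis l 1))"
proof -
  let ?m = "\<lambda>l. of_real (if l \<in> J then r\<^sup>2 / (real (card J) + 1) else s\<^sup>2 / (real (card (- J)) + 1)) :: complex"
  define c where "c = (\<lambda>l k. sesq M (A *v axis l 1) (A *v axis k 1))"
  have Aw: "A *v w = (\<Sum>l\<in>UNIV. w $ l *s (A *v axis l 1))" for w
  proof -
    have "A *v w = A *v (\<Sum>l\<in>UNIV. w $ l *s axis l 1)" by (simp only: basis_expansion)
    then show ?thesis by (simp only: matrix_vector_mult_sum vector_scalar_commute)
  qed
  have form: "sesq M (A *v w) (A *v w) = (\<Sum>l\<in>UNIV. \<Sum>k\<in>UNIV. c l k * (w $ l * cnj (w $ k)))" for w
    unfolding Aw[of w] sesq_sum_left sesq_sum_right sesq_smult_left sesq_smult_right c_def sum_distrib_left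
    by (subst sum.swap) (simp add: mult_ac)
  have int: "set_integrable lborel (biball J r s) (\<lambda>w. w $ l * cnj (w $ k))" for l k
    by (intro set_integrable_bounded_continuous continuous_intros bounded_biball borel_biball)
  have int2: "integrable lborel (\<lambda>w. indicator (biball J r s) w *\<^sub>R (c l k * (w $ l * cnj (w $ k))))" for l k
    by (rule set_integrable_mult_right[unfolded set_integrable_def, OF int[unfolded set_integrable_def]])
  have "(LINT w:biball J r s|lborel. sesq M (A *v w) (A *v w))
      = (\<Sum>l\<in>UNIV. \<Sum>k\<in>UNIV. (LINT w:biball J r s|lborel. c l k * (w $ l * cnj (w $ k))))"
    unfolding form set_lebesgue_integral_def scaleR_sum_right
    by (simp only: Bochner_Integration.integral_sum Bochner_Integration.integrable_sum int2)
  also have "\<dots> = (\<Sum>l\<in>UNIV. \<Sum>k\<in>UNIV. if k = l then measure lborel (biball J r s) * (?m l * c l l) else 0)"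
    unfolding set_integral_mult_right LINT_biball_moments[OF r s] by (intro sum.cong refl) auto
  also have "\<dots> = measure lborel (biball J r s) * (\<Sum>l\<in>UNIV. ?m l * c l l)"
    by (simp add: sum_distrib_left)
  finally show ?thesis by (simp add: c_def)
qed

context hermitian_matrix_map
begin

lemma curv_eq_sesq: "curv z = sesq (\<chi> k j. sesq (G a) (chern_curvature_coeff G j k a *v x) x) z z"
  unfolding curv_def sesq_entries[of "\<chi> k j. sesq (G a) (chern_curvature_coeff G j k a *v x) x"]
  by (subst sum.swap) (simp add: mult_ac)

lemma LINT_curv:
  fixes A :: "complex^'n^'n"
  assumes A: "orthogonal_transformation (\<lambda>w. A *v w)" and r: "0 < r" and s: "0 < s"
  shows "complex_of_real (LINT z:(\<lambda>w. A *v w) ` biball J r s|lborel. Re (curv z)) = measure lborel (biball J r s) *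
     (\<Sum>l\<in>UNIV. of_real (if l \<in> J then r\<^sup>2 / (real (card J) + 1) else s\<^sup>2 / (real (card (- J)) + 1)) *
        curv (A *v axis l 1))"
proof -
  have "complex_of_real (LINT z:(\<lambda>w. A *v w) ` biball J r s|lborel. Re (curv z))
      = (LINT z:(\<lambda>w. A *v w) ` biball J r s|lborel. of_real (Re (curv z)))"
    by (rule set_integral_complex_of_real[symmetric])
  also have "(\<lambda>z. complex_of_real (Re (curv z))) = curv"
    using curv_real by (simp add: fun_eq_iff complex_eq_iff)
  also have "(LINT z:(\<lambda>w. A *v w) ` biball J r s|lborel. curv z) = (LINT w:biball J r s|lborel. curv (A *v w))"
    by (rule set_integral_orthogonal[OF A, symmetric])
  also have "\<dots> = measure lborel (biball J r s) *
     (\<Sum>l\<in>UNIV. of_real (if l \<in> J then r\<^sup>2 / (real (card J) + 1) else s\<^sup>2 / (real (card (- J)) + 1)) *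
        curv (A *v axis l 1))"
    unfolding curv_eq_sesq by (rule LINT_biball_sesq[OF r s])
  finally show ?thesis .
qed

end

context hermitian_bundle
begin

text \<open>\<open>L2_ext_index\<close> with an arbitrary set in place of the polyball.\<close>

definition ext_index :: "complex^'n \<Rightarrow> (complex^'n) set \<Rightarrow> 'e \<Rightarrow> real" where
  "ext_index a P \<xi> = Inf {(LINT z:(+) a ` P|lebesgue. hnorm2 h (\<sigma> z)) / (measure lebesgue P * hnorm2 h \<xi>) | \<sigma>.
     \<sigma> \<in> A2 E h ((+) a ` P) \<and> \<sigma> a = \<xi>}"

text \<open>The infimum is bounded from above by the value at the section with coefficients \<open>frame\<close>, and from
below by \<open>LINT_lower\<close>, which applies to the coefficients of every competitor; the two bounds differ by
\<open>O(\<rho>\<^sup>4)\<close>. The constants depend on the trivialization, the base point and \<open>\<xi>\<close>, but neither on \<open>P\<close> nor on \<open>\<rho>\<close>.\<close>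

theorem ext_index_expansion:
  assumes chart: "(U, \<phi>) \<in> vb_atlas E" and a: "a \<in> U" and \<xi>: "\<xi> \<in> fibre E a" "\<xi> \<noteq> vb_zero E a"
  shows "\<exists>C\<ge>0. \<exists>\<rho>\<^sub>0>0. \<forall>\<rho> P. open P \<longrightarrow> balanced P \<longrightarrow> 0 \<in> P \<longrightarrow> \<rho> \<le> \<rho>\<^sub>0 \<longrightarrow> P \<subseteq> cball 0 \<rho> \<longrightarrow>
    \<bar>ext_index a P \<xi> - (1 - (LINT z:P|lborel. Re (hermitian_matrix_map.curv (gram E h \<phi>) a (\<phi> \<xi>) z)) / (measure lborel P * hnorm2 h \<xi>))\<bar> \<le> C * \<rho> ^ 4"
proof -
  interpret hermitian_matrix_map U "gram E h \<phi>" a "\<phi> \<xi>"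
    by (rule hermitian_matrix_map_gram[OF chart a])
  obtain \<rho>\<^sub>0 where \<rho>\<^sub>0: "\<rho>\<^sub>0 > 0" "cball a \<rho>\<^sub>0 \<subseteq> U" using open_U a open_contains_cball by blast
  have \<rho>\<^sub>0': "0 \<le> \<rho>\<^sub>0" using \<rho>\<^sub>0 by simp
  obtain C1 where C1: "C1 \<ge> 0" "\<And>\<rho> P. open P \<Longrightarrow> balanced P \<Longrightarrow> \<rho> \<le> \<rho>\<^sub>0 \<Longrightarrow> P \<subseteq> cball 0 \<rho> \<Longrightarrow>
    \<bar>(LINT z:P|lborel. Q z) - (N * measure lborel P - (LINT z:P|lborel. Re (curv z)))\<bar> \<le> C1 * \<rho> ^ 4 * measure lborel P"
    using LINT_Q[OF \<rho>\<^sub>0(2) \<rho>\<^sub>0'] by blast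
  obtain C2 where C2: "C2 \<ge> 0" "\<And>\<rho> P f. open P \<Longrightarrow> balanced P \<Longrightarrow> 0 \<in> P \<Longrightarrow> \<rho> \<le> \<rho>\<^sub>0 \<Longrightarrow> P \<subseteq> cball 0 \<rho> \<Longrightarrow>
    holomorphic_map_on ((+) a ` P) f \<Longrightarrow> f a = \<phi> \<xi> \<Longrightarrow>
    set_integrable lborel P (\<lambda>z. Re (sesq (gram E h \<phi> (a + z)) (f (a + z)) (f (a + z)))) \<Longrightarrow>
    (LINT z:P|lborel. Q z) - C2 * \<rho> ^ 4 * measure lborel P
      \<le> (LINT z:P|lborel. Re (sesq (gram E h \<phi> (a + z)) (f (a + z)) (f (a + z))))"
    using LINT_lower[OF \<rho>\<^sub>0(2) \<rho>\<^sub>0'] by blast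
  have N: "N = hnorm2 h \<xi>" unfolding N_def hnorm2_def
    by (simp add: metric_eq_sesq_fibre[OF chart a \<xi>(1) \<xi>(1)])
  have "\<phi> \<xi> \<noteq> 0"
    using triv_inv_triv[OF chart a] \<xi> fibre_closed(1) trivialization(2)[OF chart a] atlas_subset[OF chart] a by (metis subsetD)
  then have Npos: "N > 0" unfolding N_def by (rule pos_G[OF a])
  have "\<bar>ext_index a P \<xi> - (1 - (LINT z:P|lborel. Re (curv z)) / (measure lborel P * hnorm2 h \<xi>))\<bar> \<le> (C1 + C2) / N * \<rho> ^ 4"
    if P: "open P" "balanced P" "0 \<in> P" "\<rho> \<le> \<rho>\<^sub>0" "P \<subseteq> cball 0 \<rho>" for \<rho> P
  proof -
    let ?D = "(+) a ` P"
    define V where "V = measure lborel P"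
    define I where "I = (LINT z:P|lborel. Re (curv z))"
    define W where "W = (LINT z:P|lborel. Q z)"
    have V: "V > 0"
      unfolding V_def using P bounded_subset[OF bounded_cball P(5)] by (intro measure_lborel_open_pos) auto
    have VL: "measure lebesgue P = V"
      unfolding V_def using P(1) by (simp add: measure_completion)
    have sub: "P \<subseteq> cball 0 \<rho>\<^sub>0" using P by auto
    have DU: "?D \<subseteq> U" using sub \<rho>\<^sub>0(2) by (force simp: dist_norm)
    have oD: "open ?D" using P(1) by (rule open_translation)
    have aD: "a \<in> ?D" using P(3) by force
    let ?H = "\<lambda>f z. Re (sesq (gram E h \<phi> z) (f z) (f z))"
    have transfer: "set_integrable lebesgue ?D (?H f) \<longleftrightarrow> set_integrable lborel P (\<lambda>z. ?H f (a + z))"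
        "(LINT z:?D|lebesgue. ?H f z) = (LINT z:P|lborel. ?H f (a + z))" if "continuous_on ?D f" for f
    proof -
      have "continuous_on ?D (?H f)"
        by (intro continuous_intros that continuous_on_subset[OF continuous_on_G DU])
      then show "set_integrable lebesgue ?D (?H f) \<longleftrightarrow> set_integrable lborel P (\<lambda>z. ?H f (a + z))"
          "(LINT z:?D|lebesgue. ?H f z) = (LINT z:P|lborel. ?H f (a + z))"
        using lebesgue_continuous_open[OF oD] lborel_translation[OF P(1)] by simp_all
    qed
    let ?S = "{(LINT z:?D|lebesgue. hnorm2 h (\<sigma> z)) / (measure lebesgue P * hnorm2 h \<xi>) | \<sigma>. \<sigma> \<in> A2 E h ?D \<and> \<sigma> a = \<xi>}"
    have lower: "(W - C2 * \<rho> ^ 4 * V) / (V * N) \<le> t" if tS: "t \<in> ?S" for t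
    proof -
      obtain \<sigma> where \<sigma>: "\<sigma> \<in> A2 E h ?D" "\<sigma> a = \<xi>"
        and t: "t = (LINT z:?D|lebesgue. hnorm2 h (\<sigma> z)) / (measure lebesgue P * hnorm2 h \<xi>)" using tS by blast
      define f where "f = (\<lambda>z. \<phi> (\<sigma> z))"
      have sec: "\<And>z. z \<in> ?D \<Longrightarrow> \<sigma> z \<in> fibre E z" and hol: "holomorphic_map_on (?D \<inter> U) f"
        using \<sigma>(1) chart unfolding A2_def holomorphic_section_def f_def by blast+
      have hol: "holomorphic_map_on ?D f" using hol DU by (simp add: Int_absorb2)
      have eq: "hnorm2 h (\<sigma> z) = ?H f z" if "z \<in> ?D" for z
        unfolding hnorm2_def f_def using metric_eq_sesq_fibre[OF chart _ sec[OF that] sec[OF that]] DU that by auto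
      have cf: "continuous_on ?D f" by (rule holomorphic_map_on_imp_continuous[OF hol])
      have "set_integrable lebesgue ?D (\<lambda>z. hnorm2 h (\<sigma> z))" using \<sigma>(1) by (simp add: A2_def)
      then have "set_integrable lebesgue ?D (?H f)"
        by (rule set_integrable_cong[THEN iffD1, rotated -1]) (auto simp: eq)
      then have "W - C2 * \<rho> ^ 4 * V \<le> (LINT z:P|lborel. ?H f (a + z))"
        unfolding W_def V_def transfer(1)[OF cf] using \<sigma>(2) by (intro C2(2) P hol) (auto simp: f_def)
      also have "\<dots> = (LINT z:?D|lebesgue. hnorm2 h (\<sigma> z))"
        unfolding transfer(2)[OF cf, symmetric] using oD eq
        by (intro set_lebesgue_integral_cong) auto
      finally show ?thesis
        unfolding t VL N[symmetric] using V Npos by (intro divide_right_mono) auto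
    qed
    have upper: "W / (V * N) \<in> ?S"
    proof -
      define c where "c = (\<lambda>z. frame (z - a))"
      define \<sigma> where "\<sigma> = (\<lambda>z. triv_inv E \<phi> z (c z))"
      have lin: "bounded_linear corr"
        unfolding linear_conv_bounded_linear[symmetric] linear_iff by (simp add: corr_add corr_smult scaleR_vector_smult)
      have dc: "(c has_derivative corr) (at z)" for z
        unfolding c_def frame_def
        by (auto intro!: derivative_eq_intros bounded_linear.has_derivative[OF lin])
      have cc: "continuous_on ?D c"
        unfolding c_def by (intro continuous_on_compose2[OF continuous_on_frame] continuous_intros) auto
      have sec: "holomorphic_section E ?D \<sigma>"
        unfolding \<sigma>_def by (rule holomorphic_section_local[OF chart DU]) (use dc corr_smult in blast)
      have eq: "hnorm2 h (\<sigma> z) = ?H c z" if "z \<in> ?D" for z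
        unfolding hnorm2_def \<sigma>_def using metric_eq_sesq[OF chart] DU that by auto
      have HQ: "?H c (a + z) = Q z" for z by (simp add: c_def Q_def)
      have "set_integrable lebesgue ?D (?H c)"
        unfolding transfer(1)[OF cc] HQ by (rule set_integrable_Q[OF \<rho>\<^sub>0(2) sub P(1)])
      then have "set_integrable lebesgue ?D (\<lambda>z. hnorm2 h (\<sigma> z))"
        by (rule set_integrable_cong[THEN iffD1, rotated -1]) (auto simp: eq)
      then have A2: "\<sigma> \<in> A2 E h ?D" using sec by (simp add: A2_def)
      have \<sigma>a: "\<sigma> a = \<xi>"
        by (simp add: \<sigma>_def c_def frame_def triv_inv_triv[OF chart a \<xi>(1)])
      have "(LINT z:?D|lebesgue. hnorm2 h (\<sigma> z)) = (LINT z:?D|lebesgue. ?H c z)"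
        using oD eq by (intro set_lebesgue_integral_cong) auto
      also have "\<dots> = W" unfolding transfer(2)[OF cc] HQ W_def ..
      finally have "W / (V * N) = (LINT z:?D|lebesgue. hnorm2 h (\<sigma> z)) / (measure lebesgue P * hnorm2 h \<xi>)"
        unfolding VL N by simp
      then show ?thesis using A2 \<sigma>a by blast
    qed
    have le: "ext_index a P \<xi> \<le> W / (V * N)"
      unfolding ext_index_def by (rule cInf_lower[OF upper bdd_belowI[OF lower]])
    have ge: "(W - C2 * \<rho> ^ 4 * V) / (V * N) \<le> ext_index a P \<xi>"
      unfolding ext_index_def by (rule cInf_greatest[OF _ lower]) (use upper in blast)
    have W: "\<bar>W - (N * V - I)\<bar> \<le> C1 * \<rho> ^ 4 * V"
      unfolding W_def V_def I_def by (rule C1(2)[OF P(1,2,4,5)])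
    have VN: "V * N > 0" using V Npos by simp
    have c: "(N * V - I) / (V * N) = 1 - I / (V * N)" using V Npos by (simp add: field_simps)
    have e: "(C1 + C2) * \<rho> ^ 4 * V / (V * N) = (C1 + C2) / N * \<rho> ^ 4" using V Npos by (simp add: field_simps)
    have C2p: "0 \<le> C2 * \<rho> ^ 4 * V" "0 \<le> C1 * \<rho> ^ 4 * V" using C1(1) C2(1) V by auto
    have up: "ext_index a P \<xi> \<le> ((N * V - I) + (C1 + C2) * \<rho> ^ 4 * V) / (V * N)"
    proof (rule order_trans[OF le divide_right_mono])
      show "W \<le> (N * V - I) + (C1 + C2) * \<rho> ^ 4 * V" using W C2p by (simp add: distrib_right)
    qed (use VN in simp)
    have lo: "((N * V - I) - (C1 + C2) * \<rho> ^ 4 * V) / (V * N) \<le> ext_index a P \<xi>"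
    proof (rule order_trans[OF divide_right_mono ge])
      show "(N * V - I) - (C1 + C2) * \<rho> ^ 4 * V \<le> W - C2 * \<rho> ^ 4 * V" using W by (simp add: distrib_right)
    qed (use VN in simp)
    show ?thesis
      using up lo unfolding add_divide_distrib diff_divide_distrib[of "N * V - I" "(C1 + C2) * \<rho> ^ 4 * V"] c e
      unfolding I_def V_def N[symmetric] by (simp add: abs_le_iff)
  qed
  moreover have "0 \<le> (C1 + C2) / N" using C1(1) C2(1) Npos by simp
  ultimately show ?thesis using \<rho>\<^sub>0(1) by blast
qed

end


section \<open>Polyballs\<close>

text \<open>\<open>|A v|\<^sup>2 = v\<^sup>* A\<^sup>* A v = |v|\<^sup>2\<close>, written with \<open>sesq\<close>.\<close>

lemma orthogonal_transformation_unitary: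
  fixes A :: "complex^'n::finite^'n"
  assumes "A \<in> unitary_group"
  shows "orthogonal_transformation (\<lambda>v. A *v v)"
proof -
  let ?B = "(\<chi> i j. cnj (A $ j $ i)) :: complex^'n^'n"
  have BA: "?B ** A = mat 1" using assms by (simp add: unitary_group_def)
  have "norm (A *v v) = norm v" for v
  proof -
    have "complex_of_real ((norm v)\<^sup>2) = sesq ?B (A *v v) v"
      unfolding sesq_mat_1[symmetric] BA[symmetric] by (simp add: sesq_def matrix_vector_mul_assoc)
    also have "\<dots> = cnj (sesq A v (A *v v))" by (rule sesq_adjoint) simp
    also have "sesq A v (A *v v) = sesq (mat 1) (A *v v) (A *v v)"
      by (simp add: sesq_def)
    also have "cnj \<dots> = complex_of_real ((norm (A *v v))\<^sup>2)" by (simp only: sesq_mat_1 complex_cnj_complex_of_real)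
    finally have "(norm v)\<^sup>2 = (norm (A *v v))\<^sup>2" by (simp only: of_real_eq_iff)
    then show ?thesis by simp
  qed
  moreover have "linear (\<lambda>v. A *v v)"
    unfolding linear_iff by (simp add: matrix_vector_right_distrib scaleR_vector_smult vector_scalar_commute)
  ultimately show ?thesis by (simp add: orthogonal_transformation)
qed

lemma sqsum_image:
  assumes "inj_on \<iota> I"
  shows "sqsum (\<iota> ` I) z = (\<Sum>j\<in>I. (cmod (z $ \<iota> j))\<^sup>2)"
  unfolding sqsum_def by (simp add: sum.reindex[OF assms])

lemma L2_set_less_iff: "0 < r \<Longrightarrow> L2_set f I < r \<longleftrightarrow> (\<Sum>i\<in>I. (f i)\<^sup>2) < r\<^sup>2"
  unfolding L2_set_def using real_sqrt_less_iff[of "\<Sum>i\<in>I. (f i)\<^sup>2" "r\<^sup>2"] by simp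

text \<open>The enumeration \<open>\<iota>\<close> enters only through the set of the first \<open>q\<close> coordinates and its complement.\<close>

lemma polyball_eq_biball:
  fixes \<iota> :: "nat \<Rightarrow> 'n::finite"
  assumes \<iota>: "bij_betw \<iota> {1..CARD('n)} UNIV" and q: "q \<le> CARD('n)" and r: "0 < r" and s: "0 < s"
  shows "- (\<iota> ` {1..q}) = \<iota> ` {q+1..CARD('n)}"
    and "inj_on \<iota> {1..q}" and "inj_on \<iota> {q+1..CARD('n)}"
    and "polyball \<iota> q r s A = (\<lambda>z. A *v z) ` biball (\<iota> ` {1..q}) r s"
proof -
  have inj: "inj_on \<iota> {1..CARD('n)}" and im: "\<iota> ` {1..CARD('n)} = UNIV"
    using \<iota> by (auto simp: bij_betw_def)
  show i1: "inj_on \<iota> {1..q}" and i2: "inj_on \<iota> {q+1..CARD('n)}"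
    using q by (auto intro: inj_on_subset[OF inj])
  have split: "{1..CARD('n)} = {1..q} \<union> {q+1..CARD('n)}" using q by auto
  have "\<iota> ` {1..q} \<inter> \<iota> ` {q+1..CARD('n)} = {}"
    using inj_on_image_Int[OF inj, of "{1..q}" "{q+1..CARD('n)}"] q by auto
  moreover have "\<iota> ` {1..q} \<union> \<iota> ` {q+1..CARD('n)} = UNIV" using im split by (simp add: image_Un)
  ultimately show c: "- (\<iota> ` {1..q}) = \<iota> ` {q+1..CARD('n)}" by blast
  show "polyball \<iota> q r s A = (\<lambda>z. A *v z) ` biball (\<iota> ` {1..q}) r s"
    unfolding polyball_def biball_def c sqsum_image[OF i1] sqsum_image[OF i2] L2_set_less_iff[OF r] L2_set_less_iff[OF s] ..
qed

lemma polyball_norm: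
  fixes \<iota> :: "nat \<Rightarrow> 'n::finite"
  assumes "bij_betw \<iota> {1..CARD('n)} UNIV" "q \<le> CARD('n)" "0 < r" "0 < s" "A \<in> unitary_group"
  shows "polyball \<iota> q r s A \<subseteq> cball 0 (sqrt (r\<^sup>2 + s\<^sup>2))"
proof -
  have "norm (A *v w) \<le> sqrt (r\<^sup>2 + s\<^sup>2)" if "w \<in> biball J r s" for w and J :: "'n set"
    using biball_norm[OF that] orthogonal_transformation_norm[OF orthogonal_transformation_unitary[OF assms(5)], of w]
    by (intro real_le_rsqrt) simp
  then show ?thesis unfolding polyball_eq_biball(4)[OF assms(1-4)] by auto
qed

lemma polyball_full_eq_ball:
  fixes \<iota> :: "nat \<Rightarrow> 'n::finite"
  assumes \<iota>: "bij_betw \<iota> {1..CARD('n)} UNIV" and "0 < r" "0 < s" and A: "A \<in> unitary_group"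
  shows "polyball \<iota> CARD('n) r s A = ball 0 r"
proof -
  have "\<iota> ` {1..CARD('n)} = UNIV" using \<iota> by (simp add: bij_betw_def)
  then show ?thesis
    unfolding polyball_eq_biball(4)[OF \<iota> order_refl assms(2,3)]
    using image_orthogonal_transformation_ball[OF orthogonal_transformation_unitary[OF A], of 0 r]
    by (simp add: biball_UNIV[OF assms(2,3)])
qed

definition (in hermitian_bundle) index_remainder ::
    "(nat \<Rightarrow> 'n) \<Rightarrow> nat \<Rightarrow> complex^'n \<Rightarrow> 'e \<Rightarrow> real \<Rightarrow> real \<Rightarrow> complex^'n^'n \<Rightarrow> complex" where
  "index_remainder \<iota> q a \<xi> r s A = complex_of_real (L2_ext_index E h \<iota> q a r s A \<xi>)
                  - (1 - complex_of_real (r^2 / (real q + 1)) *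
                         (\<Sum>j=1..q. h (chern_curvature E h a (A *v axis (\<iota> j) 1) \<xi>) \<xi>
                                     / complex_of_real (hnorm2 h \<xi>))
                       - complex_of_real (s^2 / (real CARD('n) - real q + 1)) *
                         (\<Sum>j=q+1..CARD('n). h (chern_curvature E h a (A *v axis (\<iota> j) 1) \<xi>) \<xi>
                                     / complex_of_real (hnorm2 h \<xi>)))"

text \<open>Keeping the radius \<open>\<rho>\<close> of a ball containing the polyball as a separate parameter yields both
forms of the remainder from one statement.\<close>

lemma (in hermitian_bundle) L2_ext_index_expansion:
  fixes \<iota> :: "nat \<Rightarrow> 'n"
  assumes \<iota>: "bij_betw \<iota> {1..CARD('n)} UNIV" and q: "q \<le> CARD('n)"
    and a: "a \<in> \<Omega>" and \<xi>: "\<xi> \<in> fibre E a" "\<xi> \<noteq> vb_zero E a"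
  shows "\<exists>C\<ge>0. \<exists>\<rho>\<^sub>0>0. \<forall>r s \<rho> A. 0 < r \<longrightarrow> 0 < s \<longrightarrow> A \<in> unitary_group \<longrightarrow> \<rho> \<le> \<rho>\<^sub>0 \<longrightarrow>
      polyball \<iota> q r s A \<subseteq> cball 0 \<rho> \<longrightarrow>
      cmod (index_remainder \<iota> q a \<xi> r s A) \<le> C * \<rho> ^ 4"
proof -
  \<comment> \<open>the trivialization in which the curvature is defined is also used for the estimates\<close>
  define p where "p = (SOME (U, \<phi>). (U, \<phi>) \<in> vb_atlas E \<and> a \<in> U)"
  obtain U0 \<phi>0 where "(U0, \<phi>0) \<in> vb_atlas E \<and> a \<in> U0" using atlas_covers a by blast
  then have "case p of (U, \<phi>) \<Rightarrow> (U, \<phi>) \<in> vb_atlas E \<and> a \<in> U"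
    unfolding p_def by (intro someI[of "\<lambda>(U, \<phi>). (U, \<phi>) \<in> vb_atlas E \<and> a \<in> U" "(U0, \<phi>0)"]) simp
  then obtain U \<phi> where p: "p = (U, \<phi>)" and chart: "(U, \<phi>) \<in> vb_atlas E" and aU: "a \<in> U" by (cases p) auto
  interpret hermitian_matrix_map U "gram E h \<phi>" a "\<phi> \<xi>"
    by (rule hermitian_matrix_map_gram[OF chart aU])
  let ?N = "hnorm2 h \<xi>"
  have N: "?N > 0" unfolding hnorm2_def by (rule metric_sesquilinear(4)[OF a \<xi>])
  have curvature: "h (chern_curvature E h a v \<xi>) \<xi> = curv v" for v
  proof -
    have "chern_curvature E h a v \<xi> = triv_inv E \<phi> a (\<Sum>j\<in>UNIV. \<Sum>k\<in>UNIV.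
           (v $ j * cnj (v $ k)) *s (chern_curvature_coeff (gram E h \<phi>) j k a *v \<phi> \<xi>))"
      unfolding chern_curvature_def p_def[symmetric] p by (simp add: Let_def)
    then have "h (chern_curvature E h a v \<xi>) \<xi> = sesq (gram E h \<phi> a) (\<Sum>j\<in>UNIV. \<Sum>k\<in>UNIV.
           (v $ j * cnj (v $ k)) *s (chern_curvature_coeff (gram E h \<phi>) j k a *v \<phi> \<xi>)) (\<phi> \<xi>)"
      using metric_eq_sesq[OF chart aU, of _ "\<phi> \<xi>"] by (simp add: triv_inv_triv[OF chart aU \<xi>(1)])
    then show ?thesis by (simp add: curv_def sesq_sum_left sesq_smult_left)
  qed
  obtain C \<rho>\<^sub>0 where C: "C \<ge> 0" "\<rho>\<^sub>0 > 0" "\<And>\<rho> P. open P \<Longrightarrow> balanced P \<Longrightarrow> 0 \<in> P \<Longrightarrow> \<rho> \<le> \<rho>\<^sub>0 \<Longrightarrow> P \<subseteq> cball 0 \<rho> \<Longrightarrow>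
      \<bar>ext_index a P \<xi> - (1 - (LINT z:P|lborel. Re (curv z)) / (measure lborel P * ?N))\<bar> \<le> C * \<rho> ^ 4"
    using ext_index_expansion[OF chart aU \<xi>] by blast
  have "cmod (index_remainder \<iota> q a \<xi> r s A) \<le> C * \<rho> ^ 4"
    if r: "0 < r" and s: "0 < s" and A: "A \<in> unitary_group" and \<rho>: "\<rho> \<le> \<rho>\<^sub>0" and sub: "polyball \<iota> q r s A \<subseteq> cball 0 \<rho>" for r s \<rho> A
  proof -
    let ?J = "\<iota> ` {1..q}"
    let ?T = "\<lambda>z. A *v z"
    let ?P = "polyball \<iota> q r s A"
    let ?m = "\<lambda>l. if l \<in> ?J then r\<^sup>2 / (real (card ?J) + 1) else s\<^sup>2 / (real (card (- ?J)) + 1)"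
    note pb = polyball_eq_biball[OF \<iota> q r s]
    have T: "orthogonal_transformation ?T" by (rule orthogonal_transformation_unitary[OF A])
    have "open ?P"
      unfolding pb(4) using open_biball orthogonal_transformation_linear[OF T] orthogonal_transformation_surj[OF T]
      by (rule open_surjective_linear_image)
    moreover have "balanced ?P"
      unfolding pb(4) balanced_def
    proof clarify
      fix w and c :: complex assume "w \<in> biball ?J r s" "cmod c \<le> 1"
      then have "c *s w \<in> biball ?J r s" by (rule biball_balanced)
      then show "c *s (A *v w) \<in> ?T ` biball ?J r s" by (metis imageI vector_scalar_commute)
    qed
    moreover have "0 \<in> ?P"
      unfolding pb(4) using zero_in_biball[OF r s] by (force simp: image_iff)
    ultimately have main: "\<bar>ext_index a ?P \<xi> - (1 - (LINT z:?P|lborel. Re (curv z)) / (measure lborel ?P * ?N))\<bar> \<le> C * \<rho> ^ 4"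
      using \<rho> sub by (rule C(3))
    define V where "V = measure lborel (biball ?J r s)"
    have V: "V > 0" unfolding V_def by (rule measure_biball_pos[OF r s])
    have mV: "measure lborel ?P = V"
      unfolding pb(4) V_def by (rule measure_orthogonal_image_eq[OF T borel_biball])
    have cards: "card ?J = q" "card (- ?J) = CARD('n) - q"
      unfolding pb(1) card_image[OF pb(2)] card_image[OF pb(3)] by simp_all
    have "complex_of_real (LINT z:?P|lborel. Re (curv z)) = of_real V * (\<Sum>l\<in>UNIV. of_real (?m l) * curv (A *v axis l 1))"
      unfolding pb(4) V_def by (rule LINT_curv[OF T r s])
    also have "(\<Sum>l\<in>UNIV. of_real (?m l) * curv (A *v axis l 1))
        = (\<Sum>l\<in>?J. of_real (?m l) * curv (A *v axis l 1)) + (\<Sum>l\<in>- ?J. of_real (?m l) * curv (A *v axis l 1))"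
      using sum.subset_diff[of ?J UNIV "\<lambda>l. of_real (?m l) * curv (A *v axis l 1)"] by (simp add: Compl_eq_Diff_UNIV add.commute)
    also have "(\<Sum>l\<in>?J. of_real (?m l) * curv (A *v axis l 1)) = of_real (r\<^sup>2 / (real q + 1)) * (\<Sum>j=1..q. curv (A *v axis (\<iota> j) 1))"
    proof -
      have "(\<Sum>l\<in>?J. of_real (?m l) * curv (A *v axis l 1)) = (\<Sum>l\<in>?J. of_real (r\<^sup>2 / (real q + 1)) * curv (A *v axis l 1))"
        unfolding cards by (intro sum.cong refl) simp
      then show ?thesis unfolding sum.reindex[OF pb(2)] o_def sum_distrib_left .
    qed
    also have "(\<Sum>l\<in>- ?J. of_real (?m l) * curv (A *v axis l 1)) = of_real (s\<^sup>2 / (real CARD('n) - real q + 1)) * (\<Sum>j=q+1..CARD('n). curv (A *v axis (\<iota> j) 1))"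
    proof -
      have "(\<Sum>l\<in>- ?J. of_real (?m l) * curv (A *v axis l 1)) = (\<Sum>l\<in>- ?J. of_real (s\<^sup>2 / (real CARD('n) - real q + 1)) * curv (A *v axis l 1))"
        unfolding cards using q by (intro sum.cong refl) (simp add: of_nat_diff)
      then show ?thesis unfolding pb(1) sum.reindex[OF pb(3)] o_def sum_distrib_left .
    qed
    finally have int: "complex_of_real (LINT z:?P|lborel. Re (curv z)) = of_real V *
       (of_real (r\<^sup>2 / (real q + 1)) * (\<Sum>j=1..q. curv (A *v axis (\<iota> j) 1))
        + of_real (s\<^sup>2 / (real CARD('n) - real q + 1)) * (\<Sum>j=q+1..CARD('n). curv (A *v axis (\<iota> j) 1)))" .
    have idx: "L2_ext_index E h \<iota> q a r s A \<xi> = ext_index a ?P \<xi>"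
      unfolding L2_ext_index_def ext_index_def ..
    have "complex_of_real (ext_index a ?P \<xi> - (1 - (LINT z:?P|lborel. Re (curv z)) / (V * ?N)))
       = of_real (ext_index a ?P \<xi>) - (1 - complex_of_real (r^2 / (real q + 1)) * (\<Sum>j=1..q. curv (A *v axis (\<iota> j) 1) / of_real ?N)
          - complex_of_real (s^2 / (real CARD('n) - real q + 1)) * (\<Sum>j=q+1..CARD('n). curv (A *v axis (\<iota> j) 1) / of_real ?N))"
    proof -
      have "complex_of_real ((LINT z:?P|lborel. Re (curv z)) / (V * ?N)) =
         of_real (r\<^sup>2 / (real q + 1)) * ((\<Sum>j=1..q. curv (A *v axis (\<iota> j) 1)) / of_real ?N)
        + of_real (s\<^sup>2 / (real CARD('n) - real q + 1)) * ((\<Sum>j=q+1..CARD('n). curv (A *v axis (\<iota> j) 1)) / of_real ?N)"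
        unfolding of_real_divide[of "LINT z:?P|lborel. Re (curv z)"] int of_real_mult[of V ?N]
        using V N by (simp add: add_divide_distrib del: of_real_divide)
      then show ?thesis unfolding sum_divide_distrib by (simp del: of_real_divide)
    qed
    then show ?thesis
      unfolding index_remainder_def idx curvature using main[unfolded mV] by (metis norm_of_real)
  qed
  then show ?thesis using C(1,2) by (intro exI[of _ C] conjI exI[of _ \<rho>\<^sub>0]) auto
qed

theorem theorem3p2:
  fixes \<Omega> :: "(complex^'n::finite) set"
    and E :: "('e, 'n, 'm::finite) vbundle"
    and h :: "'e \<Rightarrow> 'e \<Rightarrow> complex"
    and \<iota> :: "nat \<Rightarrow> 'n" and q :: nat
    and a :: "complex^'n" and \<xi> :: 'e
  assumes "2 \<le> CARD('n)" and "bij_betw \<iota> {1..CARD('n)} UNIV"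
    and "1 \<le> q" and "q \<le> CARD('n)"
    and "open \<Omega>" and "connected \<Omega>"
    and "holomorphic_vector_bundle \<Omega> E"
    and "smooth_hermitian_metric \<Omega> E h"
    and "a \<in> \<Omega>" and "\<xi> \<in> fibre E a" and "\<xi> \<noteq> vb_zero E a"
  shows "(\<exists>C::real. \<exists>\<delta>>0. \<forall>r s A.
            0 < r \<and> r < \<delta> \<and> 0 < s \<and> s < \<delta> \<and> A \<in> unitary_group \<and>
            (+) a ` polyball \<iota> q r s A \<subseteq> \<Omega> \<longrightarrow>
            cmod (complex_of_real (L2_ext_index E h \<iota> q a r s A \<xi>)
                  - (1 - complex_of_real (r^2 / (real q + 1)) *
                         (\<Sum>j=1..q. h (chern_curvature E h a (A *v axis (\<iota> j) 1) \<xi>) \<xi>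
                                     / complex_of_real (hnorm2 h \<xi>))
                       - complex_of_real (s^2 / (real CARD('n) - real q + 1)) *
                         (\<Sum>j=q+1..CARD('n). h (chern_curvature E h a (A *v axis (\<iota> j) 1) \<xi>) \<xi>
                                     / complex_of_real (hnorm2 h \<xi>))))
            \<le> C * (r^2 + s^2)^2)
       \<and> (q = CARD('n) \<longrightarrow>
           (\<forall>r s. \<forall>A\<in>unitary_group. 0 < r \<and> 0 < s \<longrightarrow> polyball \<iota> q r s A = ball 0 r) \<and>
           {q+1..CARD('n)} = {} \<and>
           (\<exists>C::real. \<exists>\<delta>>0. \<forall>r s A.
            0 < r \<and> r < \<delta> \<and> 0 < s \<and> A \<in> unitary_group \<and>
            (+) a ` polyball \<iota> q r s A \<subseteq> \<Omega> \<longrightarrow>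
            cmod (complex_of_real (L2_ext_index E h \<iota> q a r s A \<xi>)
                  - (1 - complex_of_real (r^2 / (real q + 1)) *
                         (\<Sum>j=1..q. h (chern_curvature E h a (A *v axis (\<iota> j) 1) \<xi>) \<xi>
                                     / complex_of_real (hnorm2 h \<xi>))))
            \<le> C * r^4))"
proof -
  interpret hermitian_bundle \<Omega> E h
    using assms by unfold_locales
  obtain C \<rho>\<^sub>0 where C: "C \<ge> 0" "\<rho>\<^sub>0 > 0" and bound: "\<And>r s \<rho> A. 0 < r \<Longrightarrow> 0 < s \<Longrightarrow> A \<in> unitary_group \<Longrightarrow> \<rho> \<le> \<rho>\<^sub>0 \<Longrightarrow>
      polyball \<iota> q r s A \<subseteq> cball 0 \<rho> \<Longrightarrow> cmod (index_remainder \<iota> q a \<xi> r s A) \<le> C * \<rho> ^ 4"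
    using L2_ext_index_expansion[OF assms(2,4,9,10,11)] by blast
  show ?thesis
  proof (intro conjI impI, goal_cases)
    case 1
    show ?case
    proof (rule exI[of _ C], rule exI[of _ "\<rho>\<^sub>0 / 2"], intro conjI allI impI, goal_cases)
      case 1
      show ?case using C by simp
    next
      case (2 r s A)
      then have rs: "0 < r" "r < \<rho>\<^sub>0 / 2" "0 < s" "s < \<rho>\<^sub>0 / 2" and A: "A \<in> unitary_group" by auto
      let ?\<rho> = "sqrt (r\<^sup>2 + s\<^sup>2)"
      have "?\<rho> \<le> r + s" using rs by (intro sqrt_sum_squares_le_sum) auto
      then have "?\<rho> \<le> \<rho>\<^sub>0" using rs by linarith
      moreover have "?\<rho> ^ 4 = (r\<^sup>2 + s\<^sup>2)\<^sup>2"
        using power_mult[of ?\<rho> 2 2] by simp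
      ultimately show ?case
        using bound[OF rs(1,3) A _ polyball_norm[OF assms(2,4) rs(1,3) A]] by (simp add: index_remainder_def)
    qed
  next
    case 2
    then show ?case using polyball_full_eq_ball[OF assms(2)] by blast
  next
    case 3
    then show ?case by simp
  next
    case qn: 4
    show ?case
    proof (rule exI[of _ C], rule exI[of _ \<rho>\<^sub>0], intro conjI allI impI, goal_cases)
      case 1
      show ?case by (rule C(2))
    next
      case (2 r s A)
      then have rs: "0 < r" "r < \<rho>\<^sub>0" "0 < s" and A: "A \<in> unitary_group" by auto
      have "polyball \<iota> q r s A \<subseteq> cball 0 r"
        using polyball_full_eq_ball[OF assms(2) rs(1,3) A] qn ball_subset_cball by metis
      from bound[OF rs(1,3) A less_imp_le[OF rs(2)] this] show ?case
        by (simp add: index_remainder_def qn)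
    qed
  qed
qed

end
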